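(* Fix $B_0\in\mathbb{R}^m_{>0}$ and consider the budget $B=tB_0$ with $t\to\infty$. Suppose $X$ has finite second moments, $\Sigma=\operatorname{Cov}(X)$ is positive definite, and the continuous problem \[ \min_{\underline\nu}\ a^\top\Big(\sum_{I}\nu_IP_I^\top\Sigma_I^{-1}P_I\Big)^\dagger a\quad\text{s.t.}\quad \underline\nu\in\mathbb{R}_{\ge0}^{\mathcal I},\ \sum_I\nu_Ic_I\le B_0,\ \operatorname{supp}(a)\subseteq\textstyle\bigcup\{I:\nu_I>0\} \] has a unique minimizer $\underline\nu^\star$; let $\mathcal V^*$ be its minimum value. Let $\widehat\Sigma=\widehat\Sigma_t$ be random symmetric matrices (allowed to depend arbitrarily on the sample array below) with $\widehat\Sigma\to\Sigma$ in probability in operator norm as $t\to\infty$. Let $(\hat{\underline n},\hat{\underline\lambda})$ be a minimizer of $\sum_{I:n_I>0}\frac1{n_I}\lambda_I^\top\widehat\Sigma_I\lambda_I$ over integer allocations with $\sum_In_Ic_I\le tB_0$ and weights with $\sum_{I:n_I>0}P_I^\top\lambda_I=a$, and let $\hat\theta=\sum_{I:\hat n_I>0}\frac1{\hat n_I}\sum_{j=1}^{\hat n_I}\hat\lambda_I^\top X_I^{(I,j)}$, where $(X^{(I,j)})_{I\in\mathcal I,j\ge1}$ is an array of i.i.d. copies of $X$. Then \[ \sqrt t\,\big(\hat\theta-a^\top\mathbb{E}X\big)\xrightarrow{d}\mathcal N(0,\mathcal V^* ), \] and $\mathcal V^*=\lim_{t\to\infty}t\,\mathcal V_{tB_0}$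.
   Context: $X\in\mathbb{R}^k$, $a\in\mathbb{R}^k\setminus\{0\}$; $\mathcal I$ a collection of nonempty subsets of $\{1,\dots,k\}$; $P_I:\mathbb{R}^k\to\mathbb{R}^{|I|}$ the coordinate projection onto $I$; $X_I=P_IX$; for a matrix $A$, $A_I=P_IAP_I^\top$. Costs $c_I\in\mathbb{R}^m_{\ge0}$ with vector inequalities componentwise. $\dagger$ is the Moore–Penrose pseudo-inverse. For a budget $B$, $\mathcal V_B=\min\{a^\top(\sum_In_IP_I^\top\Sigma_I^{-1}P_I)^\dagger a:\ \underline n\in\mathbb{Z}^{\mathcal I}_{\ge0},\ \sum_In_Ic_I\le B,\ \operatorname{supp}(a)\subseteq\bigcup\{I:n_I>0\}\}$. *)

theory Defs
  imports "HOL-Probability.Probability"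
begin

text \<open>Vectors in R^k are modelled as real^'k; for I a subset of the coordinates, a vector
  in R^|I| is modelled as a vector of real^'k supported on I (i.e. P_I^T applied to it).\<close>

definition pinv :: "real^'k^'k \<Rightarrow> real^'k^'k" where
  "pinv A = (THE B. A ** B ** A = A \<and> B ** A ** B = B \<and>
                    transpose (A ** B) = A ** B \<and> transpose (B ** A) = B ** A)"

text \<open>The k x k matrix P_I^T (S_I)^{-1} P_I, where S_I = P_I S P_I^T.\<close>
definition subinv :: "real^'k^'k \<Rightarrow> 'k set \<Rightarrow> real^'k^'k" where
  "subinv S I = (THE M. (\<forall>i j. (i \<notin> I \<or> j \<notin> I) \<longrightarrow> M $ i $ j = 0) \<and>
      (\<forall>i\<in>I. \<forall>j\<in>I. (\<Sum>l\<in>I. M $ i $ l * S $ l $ j) = (if i = j then 1 else 0)))"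

definition supp :: "real^'k \<Rightarrow> 'k set" where
  "supp a = {i. a $ i \<noteq> 0}"

definition var_obj :: "'k set set \<Rightarrow> real^'k^'k \<Rightarrow> real^'k \<Rightarrow> ('k set \<Rightarrow> real) \<Rightarrow> real" where
  "var_obj Is S a w = a \<bullet> (pinv (\<Sum>I\<in>Is. w I *\<^sub>R subinv S I) *v a)"

definition cont_feasible ::
  "'k set set \<Rightarrow> ('k set \<Rightarrow> real^'m) \<Rightarrow> real^'m \<Rightarrow> real^'k \<Rightarrow> ('k set \<Rightarrow> real) \<Rightarrow> bool" where
  "cont_feasible Is c B a \<nu> \<longleftrightarrow>
     (\<forall>I. I \<notin> Is \<longrightarrow> \<nu> I = 0) \<and> (\<forall>I\<in>Is. 0 \<le> \<nu> I) \<and>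
     (\<forall>i. (\<Sum>I\<in>Is. \<nu> I *\<^sub>R c I) $ i \<le> B $ i) \<and>
     supp a \<subseteq> \<Union>{I\<in>Is. 0 < \<nu> I}"

definition cont_minimizer ::
  "'k set set \<Rightarrow> ('k set \<Rightarrow> real^'m) \<Rightarrow> real^'m \<Rightarrow> real^'k^'k \<Rightarrow> real^'k \<Rightarrow> ('k set \<Rightarrow> real) \<Rightarrow> bool" where
  "cont_minimizer Is c B S a \<nu> \<longleftrightarrow> cont_feasible Is c B a \<nu> \<and>
     (\<forall>\<mu>. cont_feasible Is c B a \<mu> \<longrightarrow> var_obj Is S a \<nu> \<le> var_obj Is S a \<mu>)"

definition alloc_feasible :: "'k set set \<Rightarrow> ('k set \<Rightarrow> real^'m) \<Rightarrow> real^'m \<Rightarrow> ('k set \<Rightarrow> nat) \<Rightarrow> bool" where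
  "alloc_feasible Is c B n \<longleftrightarrow> (\<forall>I. I \<notin> Is \<longrightarrow> n I = 0) \<and>
     (\<forall>i. (\<Sum>I\<in>Is. real (n I) *\<^sub>R c I) $ i \<le> B $ i)"

definition V_budget ::
  "'k set set \<Rightarrow> ('k set \<Rightarrow> real^'m) \<Rightarrow> real^'k^'k \<Rightarrow> real^'k \<Rightarrow> real^'m \<Rightarrow> real" where
  "V_budget Is c S a B = Inf {var_obj Is S a (\<lambda>I. real (n I)) | n.
      alloc_feasible Is c B n \<and> supp a \<subseteq> \<Union>{I\<in>Is. 0 < n I}}"

definition weights_feasible ::
  "'k set set \<Rightarrow> real^'k \<Rightarrow> ('k set \<Rightarrow> nat) \<Rightarrow> ('k set \<Rightarrow> real^'k) \<Rightarrow> bool" where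
  "weights_feasible Is a n lam \<longleftrightarrow> (\<forall>I\<in>Is. \<forall>i. i \<notin> I \<longrightarrow> lam I $ i = 0) \<and>
     (\<Sum>I\<in>{I\<in>Is. 0 < n I}. lam I) = a"

definition est_obj ::
  "'k set set \<Rightarrow> real^'k^'k \<Rightarrow> ('k set \<Rightarrow> nat) \<Rightarrow> ('k set \<Rightarrow> real^'k) \<Rightarrow> real" where
  "est_obj Is S n lam = (\<Sum>I\<in>{I\<in>Is. 0 < n I}. (1 / real (n I)) * (lam I \<bullet> (S *v lam I)))"

definition est_minimizer ::
  "'k set set \<Rightarrow> ('k set \<Rightarrow> real^'m) \<Rightarrow> real^'m \<Rightarrow> real^'k^'k \<Rightarrow> real^'k
    \<Rightarrow> ('k set \<Rightarrow> nat) \<Rightarrow> ('k set \<Rightarrow> real^'k) \<Rightarrow> bool" where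
  "est_minimizer Is c B S a n lam \<longleftrightarrow>
     alloc_feasible Is c B n \<and> weights_feasible Is a n lam \<and>
     (\<forall>n' lam'. alloc_feasible Is c B n' \<and> weights_feasible Is a n' lam' \<longrightarrow>
        est_obj Is S n lam \<le> est_obj Is S n' lam')"

definition normal_measure :: "real \<Rightarrow> real measure" where
  "normal_measure v = (if v = 0 then return borel 0 else density lborel (normal_density 0 (sqrt v)))"

definition conv_distr_at_top :: "'a measure \<Rightarrow> (real \<Rightarrow> 'a \<Rightarrow> real) \<Rightarrow> real measure \<Rightarrow> bool" where
  "conv_distr_at_top M Y L \<longleftrightarrow>
     (\<forall>s. filterlim s at_top sequentially \<longrightarrow> weak_conv_m (\<lambda>n. distr M borel (Y (s n))) L)"

end

theory Submission
  imports Defs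
begin

text \<open>
  For a fixed allocation the optimal weights have the form \<open>\<lambda>\<^sub>I = n\<^sub>I \<Sigma>\<^sub>I\<^sup>-\<^sup>1 y\<^sub>I\<close> for a common
  dual vector \<open>y\<close>, and every other admissible choice costs the objective of its difference from
  them.  Uniqueness of \<open>\<nu>\<^sup>*\<close> forces all costs to be nonzero, so feasible allocations are bounded,
  and by compactness every nearly optimal pair \<open>(n / t, \<lambda>)\<close> is close to the continuous optimum.

  The plug-in allocation may depend on the sample and may use a small number of draws from sets
  with \<open>\<nu>\<^sup>*\<^sub>I = 0\<close>.  These contributions are negligible because \<open>\<lambda>\<^sub>I / n\<^sub>I = O(1 / t)\<close> for all \<open>I\<close>: outside
  the coordinates covered by \<open>\<nu>\<^sup>*\<close> the dual vector minimises a weighted sum of quadratic forms, and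
  comparison with zero bounds it on one further set at a time, in order of decreasing weight,
  with constants that do not depend on the weights.  Kolmogorov's maximal inequality then
  allows \<open>n\<^sub>I\<close> to be replaced by the deterministic sizes \<open>\<lfloor>t \<nu>\<^sup>*\<^sub>I\<rfloor>\<close>, for which the limit is computed
  from characteristic functions.
\<close>

text \<open>For sizes fixed in advance, near optimality alone would dispose of the draws from sets
  with \<open>nustar I = 0\<close>: their variance, multiplied by \<open>t\<close>, is part of the
  excess of the objective. Here the sizes may be selected from the very sample that is averaged, so
  a centred sum cannot be assessed at its own size \<open>n\<close>. Only a bound uniform over all
  sizes up to \<open>\<epsilon> * t\<close> is available, of order
  \<open>sqrt (\<epsilon> * t)\<close>, however small \<open>n\<close> is. Near optimality gives t
  |\<lambda>|^2 / n = O(1), which leaves t |\<lambda>| / n possibly as large as sqrt (t / n). This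
  is why a separate bound on the dual vector is needed, and why it must not depend on how the small
  sizes compare with each other. On those sets a bounded ratio suffices, as the centred sum is
  small; on the others the ratio has to converge.\<close>

section \<open>Inverses of principal submatrices\<close>

text \<open>Restricting the test vectors to those supported on \<open>I\<close> expresses that the
  principal submatrix is positive definite without leaving the k by k matrices.\<close>

definition pos_def_on :: "'k set \<Rightarrow> real^'k^'k \<Rightarrow> bool" where
  "pos_def_on I S \<longleftrightarrow> (\<forall>v. v \<noteq> 0 \<longrightarrow> supp v \<subseteq> I \<longrightarrow> 0 < v \<bullet> (S *v v))"

lemma pos_def_on_mono: "pos_def_on J S \<Longrightarrow> I \<subseteq> J \<Longrightarrow> pos_def_on I S"
  unfolding pos_def_on_def by blast

lemma symD: "transpose S = S \<Longrightarrow> (S::real^'k^'k) $ i $ j = S $ j $ i"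
  by (auto simp: transpose_def vec_eq_iff)

lemma sym_inner: "transpose S = S \<Longrightarrow> x \<bullet> (S *v y) = y \<bullet> (S *v (x::real^'k))"
  by (metis dot_lmul_matrix inner_commute vector_transpose_matrix)

definition coord_restrict :: "'k set \<Rightarrow> real^'k \<Rightarrow> real^'k" where
  "coord_restrict I v = (\<chi> i. if i \<in> I then v $ i else 0)"

lemma inner_coord_restrict: "supp h \<subseteq> I \<Longrightarrow> h \<bullet> coord_restrict I v = h \<bullet> v"
  unfolding inner_vec_def coord_restrict_def supp_def
  by (intro sum.cong) auto

text \<open>The uniqueness clause is what lets the definite description in \<open>subinv\<close> be
  evaluated; the symmetry of \<open>M\<close>, which that description does not mention, comes from
  the same construction.\<close>

lemma subinv_exists:
  fixes S :: "real^'k^'k"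
  assumes sym: "transpose S = S" and pd: "pos_def_on I S"
  shows "\<exists>M. (\<forall>i j. (i \<notin> I \<or> j \<notin> I) \<longrightarrow> M $ i $ j = 0) \<and> transpose M = M \<and>
      (\<forall>i\<in>I. \<forall>j\<in>I. (\<Sum>l\<in>I. M $ i $ l * S $ l $ j) = (if i = j then 1 else 0)) \<and>
      (\<forall>N. (\<forall>i j. (i \<notin> I \<or> j \<notin> I) \<longrightarrow> N $ i $ j = 0) \<and>
      (\<forall>i\<in>I. \<forall>j\<in>I. (\<Sum>l\<in>I. N $ i $ l * S $ l $ j) = (if i = j then 1 else 0)) \<longrightarrow> N = M)"
proof -
  \<comment> \<open>Replacing \<open>S\<close> by the identity outside \<open>I\<close> gives an invertible matrix whose inverse restricts to \<open>M\<close>.\<close>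
  define T :: "real^'k^'k" where
    "T = (\<chi> i j. if i \<in> I \<and> j \<in> I then S $ i $ j else if i = j then 1 else 0)"
  have Tx: "T *v x = coord_restrict I (S *v coord_restrict I x) + coord_restrict (-I) x" for x
    unfolding vec_eq_iff
  proof
    fix i
    show "(T *v x) $ i = (coord_restrict I (S *v coord_restrict I x) + coord_restrict (-I) x) $ i"
    proof (cases "i \<in> I")
      case True
      then show ?thesis by (auto simp: T_def matrix_vector_mult_def coord_restrict_def intro!: sum.cong)
    next
      case False
      then have "(T *v x) $ i = (\<Sum>j\<in>UNIV. if i = j then x $ j else 0)"
        unfolding T_def matrix_vector_mult_def vec_lambda_beta by (intro sum.cong) auto
      with False show ?thesis by (simp add: coord_restrict_def)
    qed
  qed
  \<comment> \<open>Positive definiteness on \<open>I\<close> and the identity block outside it make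
    the quadratic form of \<open>T\<close> vanish only at zero.\<close>
  have inj: "x = 0" if "T *v x = 0" for x
  proof -
    have "x \<bullet> (T *v x) = coord_restrict I x \<bullet> (S *v coord_restrict I x) + coord_restrict (-I) x \<bullet> coord_restrict (-I) x"
      unfolding Tx inner_vec_def coord_restrict_def by (auto simp: sum.distrib[symmetric] intro!: sum.cong)
    then have 1: "coord_restrict I x \<bullet> (S *v coord_restrict I x) + coord_restrict (-I) x \<bullet> coord_restrict (-I) x = 0"
      using that by simp
    have "supp (coord_restrict I x) \<subseteq> I" by (auto simp: supp_def coord_restrict_def)
    with pd have "coord_restrict I x \<bullet> (S *v coord_restrict I x) \<ge> 0"
      by (cases "coord_restrict I x = 0") (auto simp: pos_def_on_def less_imp_le)
    with 1 have "coord_restrict (-I) x \<bullet> coord_restrict (-I) x = 0" "coord_restrict I x \<bullet> (S *v coord_restrict I x) = 0"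
      by (smt (verit) inner_ge_zero)+
    moreover from this(2) have "coord_restrict I x = 0" using pd \<open>supp (coord_restrict I x) \<subseteq> I\<close>
      by (metis less_irrefl pos_def_on_def)
    ultimately show "x = 0" by (simp add: vec_eq_iff coord_restrict_def) metis
  qed
  have "invertible T"
    by (metis inj invertible_left_inverse matrix_left_invertible_ker)
  then obtain T' where T': "T ** T' = mat 1" "T' ** T = mat 1"
    unfolding invertible_def by auto
  have symT: "transpose T = T"
    using symD[OF sym] by (auto simp: T_def transpose_def vec_eq_iff)
  have "transpose T' ** T = mat 1"
    by (metis T'(1) matrix_transpose_mul symT transpose_mat)
  then have symT': "transpose T' = T'"
    by (metis T'(1) matrix_mul_assoc matrix_mul_lid matrix_mul_rid)
  define M :: "real^'k^'k" where "M = (\<chi> i j. if i \<in> I \<and> j \<in> I then T' $ i $ j else 0)"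
  have supM: "\<forall>i j. (i \<notin> I \<or> j \<notin> I) \<longrightarrow> M $ i $ j = 0" by (auto simp: M_def)
  have symM: "transpose M = M"
    using symD[OF symT'] by (auto simp: M_def transpose_def vec_eq_iff)
  have left: "\<forall>i\<in>I. \<forall>j\<in>I. (\<Sum>l\<in>I. M $ i $ l * S $ l $ j) = (if i = j then 1 else 0)"
  proof (intro ballI)
    fix i j assume ij: "i \<in> I" "j \<in> I"
    have "(\<Sum>l\<in>I. M $ i $ l * S $ l $ j) = (\<Sum>l\<in>UNIV. T' $ i $ l * T $ l $ j)"
      by (rule sum.mono_neutral_cong_left) (use ij in \<open>auto simp: M_def T_def\<close>)
    also have "\<dots> = (T' ** T) $ i $ j" by (simp add: matrix_matrix_mult_def)
    finally show "(\<Sum>l\<in>I. M $ i $ l * S $ l $ j) = (if i = j then 1 else 0)"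
      by (simp add: T' mat_def)
  qed
  \<comment> \<open>Filling up \<open>N\<close> with the identity outside \<open>I\<close> gives a
    left inverse of \<open>T\<close>, so \<open>N\<close> is determined on the block.\<close>
  have uniq: "N = M" if N: "\<forall>i j. (i \<notin> I \<or> j \<notin> I) \<longrightarrow> N $ i $ j = 0"
    "\<forall>i\<in>I. \<forall>j\<in>I. (\<Sum>l\<in>I. N $ i $ l * S $ l $ j) = (if i = j then 1 else 0)" for N
  proof -
    define N' where "N' = (\<chi> i j. if i \<in> I \<and> j \<in> I then N $ i $ j else if i = j then 1 else 0)"
    have "(N' ** T) $ i $ j = (if i = j then 1 else 0)" for i j
    proof (cases "i \<in> I")
      case True
      have "(\<Sum>l\<in>UNIV. N' $ i $ l * T $ l $ j) = (\<Sum>l\<in>I. N $ i $ l * T $ l $ j)"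
        by (rule sum.mono_neutral_cong_right) (use True in \<open>auto simp: N'_def\<close>)
      also have "\<dots> = (if i = j then 1 else 0)"
      proof (cases "j \<in> I")
        case True
        then show ?thesis using N(2) \<open>i \<in> I\<close> by (auto simp: T_def cong: sum.cong)
      next
        case False
        then have "(\<Sum>l\<in>I. N $ i $ l * T $ l $ j) = 0"
          by (intro sum.neutral) (auto simp: T_def)
        then show ?thesis using False \<open>i \<in> I\<close> by auto
      qed
      finally show ?thesis by (simp add: matrix_matrix_mult_def)
    next
      case False
      then have "(N' ** T) $ i $ j = (\<Sum>l\<in>UNIV. if i = l then T $ l $ j else 0)"
        unfolding N'_def matrix_matrix_mult_def vec_lambda_beta by (intro sum.cong) auto
      with False show ?thesis by (simp add: T_def)
    qed
    then have "N' ** T = mat 1" by (simp add: vec_eq_iff mat_def)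
    then have "N' = T'" by (metis T'(1) matrix_mul_assoc matrix_mul_lid matrix_mul_rid)
    have "N $ i $ j = M $ i $ j" if "i \<in> I" "j \<in> I" for i j
    proof -
      have "N' $ i $ j = T' $ i $ j" by (simp add: \<open>N' = T'\<close>)
      then show ?thesis using that by (simp add: N'_def M_def)
    qed
    with N(1) supM show "N = M" by (metis vec_eq_iff)
  qed
  show ?thesis using supM symM left uniq by blast
qed

lemma
  fixes S :: "real^'k^'k"
  assumes sym: "transpose S = S" and pd: "pos_def_on I S"
  shows subinv_outside: "i \<notin> I \<or> j \<notin> I \<Longrightarrow> subinv S I $ i $ j = 0"
    and subinv_sym: "transpose (subinv S I) = subinv S I"
    and subinv_left: "i \<in> I \<Longrightarrow> j \<in> I \<Longrightarrow>
      (\<Sum>l\<in>I. subinv S I $ i $ l * S $ l $ j) = (if i = j then 1 else 0)"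
proof -
  obtain M where M: "\<forall>i j. (i \<notin> I \<or> j \<notin> I) \<longrightarrow> M $ i $ j = 0" "transpose M = M"
      "\<forall>i\<in>I. \<forall>j\<in>I. (\<Sum>l\<in>I. M $ i $ l * S $ l $ j) = (if i = j then 1 else 0)"
      "\<forall>N. (\<forall>i j. (i \<notin> I \<or> j \<notin> I) \<longrightarrow> N $ i $ j = 0) \<and>
      (\<forall>i\<in>I. \<forall>j\<in>I. (\<Sum>l\<in>I. N $ i $ l * S $ l $ j) = (if i = j then 1 else 0)) \<longrightarrow> N = M"
    using subinv_exists[OF assms] by (elim exE conjE)
  have eq: "subinv S I = M"
    unfolding subinv_def by (rule the_equality) (use M in blast)+
  show "i \<notin> I \<or> j \<notin> I \<Longrightarrow> subinv S I $ i $ j = 0"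
    unfolding eq using M(1) by blast
  show "transpose (subinv S I) = subinv S I"
    unfolding eq by (rule M(2))
  show "i \<in> I \<Longrightarrow> j \<in> I \<Longrightarrow>
      (\<Sum>l\<in>I. subinv S I $ i $ l * S $ l $ j) = (if i = j then 1 else 0)"
    unfolding eq using M(3) by blast
qed

lemma supp_subinv_mult:
  fixes S :: "real^'k^'k"
  assumes "transpose S = S" "pos_def_on I S"
  shows "supp (subinv S I *v y) \<subseteq> I"
  using subinv_outside[OF assms]
  by (force simp: supp_def matrix_vector_mult_def intro: sum.neutral)

lemma mult_subinv:
  fixes S :: "real^'k^'k"
  assumes S: "transpose S = S" "pos_def_on I S" and i: "i \<in> I"
  shows "(S *v (subinv S I *v y)) $ i = y $ i"
proof -
  \<comment> \<open>The description of \<open>subinv\<close> is one-sided; the symmetry of both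
    matrices turns the left inverse into a right inverse on \<open>I\<close>.\<close>
  have *: "(\<Sum>l\<in>UNIV. S $ i $ l * subinv S I $ l $ j) = (if i = j then 1 else 0)" for j
  proof (cases "j \<in> I")
    case True
    have "(\<Sum>l\<in>UNIV. S $ i $ l * subinv S I $ l $ j) = (\<Sum>l\<in>I. subinv S I $ j $ l * S $ l $ i)"
      by (rule sum.mono_neutral_cong_right)
        (use subinv_outside[OF S] symD[OF S(1)] symD[OF subinv_sym[OF S]] in auto)
    then show ?thesis using subinv_left[OF S True i] by auto
  next
    case False
    then show ?thesis using i subinv_outside[OF S] by auto
  qed
  have "(S *v (subinv S I *v y)) $ i = (\<Sum>j\<in>UNIV. (\<Sum>l\<in>UNIV. S $ i $ l * subinv S I $ l $ j) * y $ j)"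
    unfolding matrix_vector_mul_assoc by (simp add: matrix_vector_mult_def matrix_matrix_mult_def)
  also have "\<dots> = (\<Sum>j\<in>UNIV. if i = j then y $ j else 0)"
    unfolding * by (intro sum.cong) auto
  also have "\<dots> = y $ i" by simp
  finally show ?thesis .
qed

text \<open>For two candidates \<open>B\<close> and \<open>C\<close>, the products
  \<open>A ** B\<close> and \<open>A ** C\<close> are symmetric and each absorbs the other, so
  transposing shows them equal, and likewise with the factors reversed. Then
  \<open>C = C ** A ** C\<close> can be rewritten into \<open>B ** A ** B = B\<close>.\<close>

lemma pinv_eqI:
  fixes A B :: "real^'k^'k"
  assumes "A ** B ** A = A" "B ** A ** B = B"
    "transpose (A ** B) = A ** B" "transpose (B ** A) = B ** A"
  shows "pinv A = B"
  unfolding pinv_def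
proof (rule the_equality)
  show "A ** B ** A = A \<and> B ** A ** B = B \<and> transpose (A ** B) = A ** B \<and> transpose (B ** A) = B ** A"
    using assms by blast
  fix C assume "A ** C ** A = A \<and> C ** A ** C = C \<and> transpose (A ** C) = A ** C \<and> transpose (C ** A) = C ** A"
  then have C: "A ** C ** A = A" "C ** A ** C = C" "transpose (A ** C) = A ** C" "transpose (C ** A) = C ** A"
    by auto
  have "A ** B = (A ** C) ** (A ** B)"
    by (metis C(1) matrix_mul_assoc)
  also have "\<dots> = transpose ((A ** B) ** (A ** C))"
    by (subst matrix_transpose_mul) (simp only: C assms)
  also have "\<dots> = A ** C"
    by (metis C(3) assms(1) matrix_mul_assoc)
  finally have 1: "A ** B = A ** C" .
  have "B ** A = (B ** A) ** (C ** A)"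
    by (metis C(1) matrix_mul_assoc)
  also have "\<dots> = transpose ((C ** A) ** (B ** A))"
    by (subst matrix_transpose_mul) (simp only: C assms)
  also have "\<dots> = C ** A"
    by (metis C(4) assms(1) matrix_mul_assoc)
  finally have 2: "B ** A = C ** A" .
  show "C = B"
    by (metis 1 2 C(2) assms(2) matrix_mul_assoc)
qed

text \<open>The matrix is invertible on the block \<open>U\<close> and zero elsewhere, so both
  products with the block inverse are the coordinate projection \<open>?E\<close>, which is
  symmetric. The second claim is the solvability of the equation for the dual vector.\<close>

lemma pinv_subinv:
  fixes A :: "real^'k^'k"
  assumes A: "transpose A = A" "pos_def_on U A" and out: "\<And>i j. i \<notin> U \<Longrightarrow> A $ i $ j = 0"
  shows "pinv A = subinv A U" "supp a \<subseteq> U \<Longrightarrow> A *v (pinv A *v a) = a"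
proof -
  let ?B = "subinv A U"
  let ?E = "(\<chi> i j. if i = j \<and> i \<in> U then 1 else 0) :: real^'k^'k"
  have out2: "A $ i $ j = 0" if "i \<notin> U \<or> j \<notin> U" for i j using out that symD[OF A(1)] by metis
  have B0: "?B $ i $ j = 0" if "i \<notin> U \<or> j \<notin> U" for i j using subinv_outside[OF A] that by blast
  have BA: "?B ** A = ?E"
    unfolding vec_eq_iff
  proof (intro allI)
    fix i j
    have "(?B ** A) $ i $ j = (\<Sum>l\<in>U. ?B $ i $ l * A $ l $ j)"
      unfolding matrix_matrix_mult_def vec_lambda_beta
      by (rule sum.mono_neutral_right) (use B0 in auto)
    then show "(?B ** A) $ i $ j = ?E $ i $ j"
      using subinv_left[OF A] B0 out2 by (cases "i \<in> U"; cases "j \<in> U") (auto intro!: sum.neutral)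
  qed
  have symE: "transpose ?E = ?E" by (auto simp: transpose_def vec_eq_iff)
  have AB: "A ** ?B = ?E"
    by (metis BA symE A(1) subinv_sym[OF A] matrix_transpose_mul)
  have EA: "?E ** A = A" 
  proof -
    have "(?E ** A) $ i $ j = (\<Sum>l\<in>UNIV. if i = l then A $ l $ j else 0)" for i j
      unfolding matrix_matrix_mult_def vec_lambda_beta using out by (intro sum.cong) auto
    then show ?thesis by (simp add: vec_eq_iff)
  qed
  have EB: "?E ** ?B = ?B" 
  proof -
    have "(?E ** ?B) $ i $ j = (\<Sum>l\<in>UNIV. if i = l then ?B $ l $ j else 0)" for i j
      unfolding matrix_matrix_mult_def vec_lambda_beta using B0 by (intro sum.cong) auto
    then show ?thesis by (simp add: vec_eq_iff)
  qed
  show pinv: "pinv A = ?B"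
    by (rule pinv_eqI) (simp_all only: AB BA symE EA EB)
  assume a: "supp a \<subseteq> U"
  have "(?E *v a) $ i = (\<Sum>j\<in>UNIV. if i = j then a $ j else 0)" for i
    using a unfolding matrix_vector_mult_def vec_lambda_beta
    by (intro sum.cong) (auto simp: supp_def)
  then have "?E *v a = a" by (simp add: vec_eq_iff)
  then show "A *v (pinv A *v a) = a"
    unfolding pinv by (simp only: matrix_vector_mul_assoc AB)
qed

section \<open>Weights for a given allocation\<close>

text \<open>The cost of \<open>est_obj\<close> for real sizes, so that rescaled integer allocations
  and the continuous problem share one notion.\<close>

definition weight_cost :: "'k set set \<Rightarrow> real^'k^'k \<Rightarrow> ('k set \<Rightarrow> real) \<Rightarrow> ('k set \<Rightarrow> real^'k) \<Rightarrow> real" where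
  "weight_cost Is S w lam = (\<Sum>I\<in>{I\<in>Is. 0 < w I}. (1 / w I) * (lam I \<bullet> (S *v lam I)))"

definition weights_for :: "'k set set \<Rightarrow> real^'k \<Rightarrow> ('k set \<Rightarrow> real) \<Rightarrow> ('k set \<Rightarrow> real^'k) \<Rightarrow> bool" where
  "weights_for Is a w lam \<longleftrightarrow> (\<forall>I\<in>Is. supp (lam I) \<subseteq> I) \<and> (\<Sum>I\<in>{I\<in>Is. 0 < w I}. lam I) = a"

lemma est_obj_eq_weight_cost: "est_obj Is S n lam = weight_cost Is S (\<lambda>I. real (n I)) lam"
  by (simp add: est_obj_def weight_cost_def)

lemma weights_feasible_weights_for: "weights_feasible Is a n lam \<longleftrightarrow> weights_for Is a (\<lambda>I. real (n I)) lam"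
  by (auto simp: weights_feasible_def weights_for_def supp_def)

lemma inner_cong_on:
  fixes d :: "real^'k"
  shows "supp d \<subseteq> I \<Longrightarrow> (\<And>i. i \<in> I \<Longrightarrow> u $ i = v $ i) \<Longrightarrow> d \<bullet> u = d \<bullet> v"
  unfolding inner_vec_def supp_def by (rule sum.cong) auto

lemma weights_for_supp:
  assumes "weights_for Is a w lam"
  shows "supp a \<subseteq> \<Union>{I\<in>Is. 0 < w I}"
proof
  fix i assume "i \<in> supp a"
  then have "(\<Sum>I\<in>{I\<in>Is. 0 < w I}. lam I $ i) \<noteq> 0"
    using assms unfolding weights_for_def supp_def by (auto simp flip: sum_component)
  then obtain I where "I \<in> Is" "0 < w I" "lam I $ i \<noteq> 0"
    by (auto elim: sum.not_neutral_contains_not_neutral)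
  then show "i \<in> \<Union>{I\<in>Is. 0 < w I}" using assms by (auto simp: weights_for_def supp_def)
qed

lemma weight_cost_scale:
  assumes "0 < r"
  shows "weight_cost Is S (\<lambda>I. w I / r) lam = r * weight_cost Is S w lam"
  using assms by (simp add: weight_cost_def sum_distrib_left zero_less_divide_iff mult_ac)

lemma weights_for_scale:
  assumes "0 < r"
  shows "weights_for Is a (\<lambda>I. w I / r) lam \<longleftrightarrow> weights_for Is a w lam"
  using assms by (simp add: weights_for_def zero_less_divide_iff)

lemma pos_def_on_ge0: "pos_def_on UNIV S \<Longrightarrow> 0 \<le> x \<bullet> (S *v x)"
  by (cases "x = 0") (auto simp: pos_def_on_def less_imp_le)

lemma weight_cost_nonneg:
  assumes "pos_def_on UNIV S"
  shows "0 \<le> weight_cost Is S w lam"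
  unfolding weight_cost_def using pos_def_on_ge0[OF assms] by (intro sum_nonneg) auto

lemma weight_cost_eq_0D:
  fixes Is :: "'k::finite set set"
  assumes S: "pos_def_on UNIV S" and 0: "weight_cost Is S w lam = 0" and I: "I \<in> Is" "0 < w I"
  shows "lam I = 0"
proof -
  have "\<forall>I\<in>{I\<in>Is. 0 < w I}. (1 / w I) * (lam I \<bullet> (S *v lam I)) = 0"
    using 0 unfolding weight_cost_def
    by (subst (asm) sum_nonneg_eq_0_iff) (auto intro!: divide_nonneg_pos pos_def_on_ge0[OF S])
  then have "lam I \<bullet> (S *v lam I) = 0" using I by auto
  then show ?thesis using S by (metis pos_def_on_def less_irrefl top_greatest)
qed

section \<open>Optimal weights and the dual vector\<close>

lemma inner_subinv:
  fixes S :: "real^'k^'k"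
  assumes S: "transpose S = S" "pos_def_on UNIV S"
  shows "supp d \<subseteq> I \<Longrightarrow> d \<bullet> (S *v (subinv S I *v y)) = d \<bullet> y"
  by (rule inner_cong_on) (auto intro!: mult_subinv S(1) pos_def_on_mono[OF S(2)])

text \<open>With \<open>M = subinv S I\<close> this is the identity M S M = M: for equal arguments,
  the dual quadratic form is the primal cost of the vector \<open>M *v x\<close>.\<close>

lemma subinv_form:
  fixes S :: "real^'k^'k"
  assumes S: "transpose S = S" "pos_def_on UNIV S"
  shows "x \<bullet> (subinv S I *v y) = (subinv S I *v x) \<bullet> (S *v (subinv S I *v y))"
proof -
  have pd: "pos_def_on I S" using pos_def_on_mono[OF S(2)] by simp
  have "(subinv S I *v x) \<bullet> (S *v (subinv S I *v y)) = (subinv S I *v x) \<bullet> y"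
    by (rule inner_subinv[OF S]) (rule supp_subinv_mult[OF S(1) pd])
  also have "\<dots> = x \<bullet> (subinv S I *v y)"
    by (metis inner_commute sym_inner[OF subinv_sym[OF S(1) pd]])
  finally show ?thesis by simp
qed

lemma sum_matrix_vector: "(\<Sum>i\<in>J. f i) *v x = (\<Sum>i\<in>J. (f i :: real^'k^'k) *v x)"
  by (induction J rule: infinite_finite_induct) (auto simp: matrix_vector_mult_add_rdistrib)

lemma scaleR_matrix_vector: "(r *\<^sub>R (A :: real^'k^'k)) *v x = r *\<^sub>R (A *v x)"
  by (metis scaleR_matrix_vector_assoc)

text \<open>The vector \<open>y\<close> is the Lagrange multiplier of the constraint that the
  weights add up to \<open>a\<close>. Stationarity requires \<open>S *v lam I\<close> to agree with
  \<open>w I *\<^sub>R y\<close> on the coordinates in \<open>I\<close>; inserting the solution into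
  the constraint gives \<open>A *v y = a\<close>, and the cost collapses to
  \<open>y \<bullet> a\<close>.\<close>

lemma optimal_weights:
  fixes Is :: "'k::finite set set" and a :: "real^'k"
  assumes S: "transpose S = S" "pos_def_on UNIV S"
    and w: "\<And>I. I \<in> Is \<Longrightarrow> 0 \<le> w I" and a: "supp a \<subseteq> \<Union>{I\<in>Is. 0 < w I}"
  obtains y where "weights_for Is a w (\<lambda>I. w I *\<^sub>R (subinv S I *v y))"
    and "weight_cost Is S w (\<lambda>I. w I *\<^sub>R (subinv S I *v y)) = var_obj Is S a w"
proof -
  define U where "U = \<Union>{I\<in>Is. 0 < w I}"
  define A where "A = (\<Sum>I\<in>Is. w I *\<^sub>R subinv S I)"
  define y where "y = pinv A *v a"
  have pdI: "pos_def_on I S" for I using pos_def_on_mono[OF S(2)] by simp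
  note out = subinv_outside[OF S(1) pdI]
  have Ay: "A *v x = (\<Sum>I\<in>{I\<in>Is. 0 < w I}. w I *\<^sub>R (subinv S I *v x))" for x
    unfolding A_def sum_matrix_vector scaleR_matrix_vector
    by (rule sum.mono_neutral_right) (use w in \<open>force simp: less_eq_real_def\<close>)+
  have symA: "transpose A = A"
    unfolding A_def vec_eq_iff transpose_def using symD[OF subinv_sym[OF S(1) pdI]]
    by (auto intro!: sum.cong)
  have outA: "A $ i $ j = 0" if "i \<notin> U" for i j
    unfolding A_def sum_component
  proof (rule sum.neutral, rule ballI)
    fix I assume "I \<in> Is"
    then show "(w I *\<^sub>R subinv S I) $ i $ j = 0"
      using that w[of I] out[of i I j] by (cases "i \<in> I") (auto simp: U_def less_eq_real_def)
  qed
  \<comment> \<open>A nonzero coordinate of \<open>v\<close> lies in some set of positive weight,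
    and the vector \<open>subinv S I *v v\<close> of that set cannot vanish because \<open>S\<close>
    maps it back to \<open>v\<close> on \<open>I\<close>.\<close>
  have pdA: "pos_def_on U A"
    unfolding pos_def_on_def
  proof (intro allI impI)
    fix v :: "real^'k" assume v: "v \<noteq> 0" "supp v \<subseteq> U"
    have eq: "v \<bullet> (A *v v) = (\<Sum>I\<in>{I\<in>Is. 0 < w I}. w I * ((subinv S I *v v) \<bullet> (S *v (subinv S I *v v))))"
      unfolding Ay inner_sum_right by (auto simp: subinv_form[OF S] intro!: sum.cong)
    obtain i where i: "v $ i \<noteq> 0" using v(1) by (metis vec_eq_iff zero_index)
    then obtain I where I: "I \<in> Is" "0 < w I" "i \<in> I" using v(2) by (auto simp: U_def supp_def)
    have "subinv S I *v v \<noteq> 0" using mult_subinv[OF S(1) pdI I(3), of v] i by auto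
    then have "0 < (subinv S I *v v) \<bullet> (S *v (subinv S I *v v))" using S(2) by (simp add: pos_def_on_def)
    then show "0 < v \<bullet> (A *v v)"
      unfolding eq using I pos_def_on_ge0[OF S(2)] by (intro sum_pos2[of _ I]) auto
  qed
  have "A *v y = a"
    unfolding y_def by (rule pinv_subinv(2)[OF symA pdA outA]) (use a U_def in auto)
  then have feas: "weights_for Is a w (\<lambda>I. w I *\<^sub>R (subinv S I *v y))"
    unfolding weights_for_def using supp_subinv_mult[OF S(1) pdI, of _ y] by (auto simp: Ay supp_def)
  have "weight_cost Is S w (\<lambda>I. w I *\<^sub>R (subinv S I *v y)) =
      (\<Sum>I\<in>{I\<in>Is. 0 < w I}. w I * (y \<bullet> (subinv S I *v y)))"
    unfolding weight_cost_def
    by (intro sum.cong) (auto simp: matrix_vector_mult_scaleR subinv_form[OF S])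
  also have "\<dots> = y \<bullet> a" 
    using feas unfolding weights_for_def by (auto simp: inner_sum_right)
  also have "\<dots> = var_obj Is S a w"
    by (simp add: var_obj_def y_def A_def inner_commute)
  finally show ?thesis using feas that by blast
qed

text \<open>A Pythagorean identity. Each difference from the optimal weights is supported on
  \<open>I\<close>, so its cross term only sees the common vector \<open>y\<close>; the differences
  add up to zero, hence the cross terms cancel in the sum.\<close>

lemma weight_cost_decomp:
  fixes Is :: "'k::finite set set" and a :: "real^'k"
  assumes S: "transpose S = S" "pos_def_on UNIV S"
    and lam: "weights_for Is a w lam" and opt: "weights_for Is a w (\<lambda>I. w I *\<^sub>R (subinv S I *v y))"
  shows "weight_cost Is S w lam = weight_cost Is S w (\<lambda>I. w I *\<^sub>R (subinv S I *v y))
    + weight_cost Is S w (\<lambda>I. lam I - w I *\<^sub>R (subinv S I *v y))"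
proof -
  let ?h = "\<lambda>I. subinv S I *v y" and ?P = "{I\<in>Is. 0 < w I}"
  have summand: "(1 / w I) * (lam I \<bullet> (S *v lam I)) =
      (1 / w I) * ((w I *\<^sub>R ?h I) \<bullet> (S *v (w I *\<^sub>R ?h I)))
      + (1 / w I) * ((lam I - w I *\<^sub>R ?h I) \<bullet> (S *v (lam I - w I *\<^sub>R ?h I)))
      + 2 * ((lam I - w I *\<^sub>R ?h I) \<bullet> y)" if "I \<in> ?P" for I
  proof -
    define d where "d = lam I - w I *\<^sub>R ?h I"
    have "supp (lam I) \<subseteq> I" "supp (w I *\<^sub>R ?h I) \<subseteq> I"
      using lam opt that by (auto simp: weights_for_def)
    then have "supp d \<subseteq> I" unfolding d_def supp_def by force
    then have dy: "d \<bullet> (S *v ?h I) = d \<bullet> y" by (rule inner_subinv[OF S])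
    have l: "lam I = w I *\<^sub>R ?h I + d" by (simp add: d_def)
    have "?h I \<bullet> (S *v d) = d \<bullet> (S *v ?h I)" by (rule sym_inner[OF S(1)])
    then have "(w I *\<^sub>R ?h I + d) \<bullet> (S *v (w I *\<^sub>R ?h I + d)) =
      (w I *\<^sub>R ?h I) \<bullet> (S *v (w I *\<^sub>R ?h I)) + d \<bullet> (S *v d) + 2 * w I * (d \<bullet> y)"
      by (simp add: matrix_vector_right_distrib inner_add_left inner_add_right matrix_vector_mult_scaleR dy
          distrib_left)
    then show ?thesis
      using that unfolding d_def[symmetric] unfolding l by (simp add: field_simps)
  qed
  have "(\<Sum>I\<in>?P. 2 * ((lam I - w I *\<^sub>R ?h I) \<bullet> y)) = 2 * ((\<Sum>I\<in>?P. lam I - w I *\<^sub>R ?h I) \<bullet> y)"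
    by (simp add: inner_sum_left sum_distrib_left)
  also have "(\<Sum>I\<in>?P. lam I - w I *\<^sub>R ?h I) = 0"
    using lam opt by (simp add: weights_for_def sum_subtractf)
  finally have "(\<Sum>I\<in>?P. 2 * ((lam I - w I *\<^sub>R ?h I) \<bullet> y)) = 0" by simp
  moreover have "weight_cost Is S w lam = (\<Sum>I\<in>?P. (1 / w I) * ((w I *\<^sub>R ?h I) \<bullet> (S *v (w I *\<^sub>R ?h I)))
      + (1 / w I) * ((lam I - w I *\<^sub>R ?h I) \<bullet> (S *v (lam I - w I *\<^sub>R ?h I)))
      + 2 * ((lam I - w I *\<^sub>R ?h I) \<bullet> y))"
    unfolding weight_cost_def by (rule sum.cong[OF refl]) (rule summand)
  ultimately show ?thesis unfolding weight_cost_def sum.distrib by linarith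
qed

lemma var_obj_le_weight_cost:
  fixes Is :: "'k::finite set set" and a :: "real^'k"
  assumes S: "transpose S = S" "pos_def_on UNIV S"
    and w: "\<And>I. I \<in> Is \<Longrightarrow> 0 \<le> w I" and lam: "weights_for Is a w lam"
  shows "var_obj Is S a w \<le> weight_cost Is S w lam"
proof -
  obtain y where y: "weights_for Is a w (\<lambda>I. w I *\<^sub>R (subinv S I *v y))"
    "weight_cost Is S w (\<lambda>I. w I *\<^sub>R (subinv S I *v y)) = var_obj Is S a w"
    by (rule optimal_weights[OF S w weights_for_supp[OF lam]])
  show ?thesis
    using weight_cost_decomp[OF S lam y(1)] y(2)
      weight_cost_nonneg[OF S(2), of Is w "\<lambda>I. lam I - w I *\<^sub>R (subinv S I *v y)"] by linarith
qed

text \<open>The weight of the heaviest set not yet inside \<open>C\<close> dominates all weights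
  that enter the comparison, so it cancels and no lower bound on the weights is needed. The
  induction then adds this set to \<open>C\<close>. Each enlargement gains at least one coordinate
  and costs a factor \<open>R\<close>, which explains the exponent. In \<open>R\<close>, the factor
  \<open>K\<^sup>2 / \<kappa>\<close> passes from a cost to coordinates, the remaining product
  bounds the cost of the comparison vector, and the 1 makes the powers of \<open>R\<close>
  increase.\<close>

lemma dual_bound:
  fixes Is :: "'k::finite set set" and a y :: "real^'k"
  assumes S: "transpose S = S" and \<kappa>: "0 < \<kappa>" "\<And>x. \<kappa> * (norm x)\<^sup>2 \<le> x \<bullet> (S *v x)"
    and K: "0 \<le> K" "\<And>x. norm (S *v x) \<le> K * norm x"
    and w: "\<And>I. I \<in> Is \<Longrightarrow> 0 \<le> w I"
    and eq: "(\<Sum>I\<in>{I\<in>Is. 0 < w I}. w I *\<^sub>R (subinv S I *v y)) = a"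
    and C: "supp a \<subseteq> C" "\<And>i. i \<in> C \<Longrightarrow> \<bar>y $ i\<bar> \<le> D" "0 \<le> D"
    and R: "R = 1 + K\<^sup>2 / \<kappa> * (card Is * (CARD('k) / \<kappa>))"
    and i: "i \<in> \<Union>{I\<in>Is. 0 < w I}"
  shows "\<bar>y $ i\<bar> \<le> D * R ^ card (- C)"
  using C
proof (induction "card (- C)" arbitrary: C D rule: less_induct)
  case less
  have pd: "pos_def_on UNIV S" unfolding pos_def_on_def
  proof (intro allI impI)
    fix v :: "real^'k" assume "v \<noteq> 0"
    then have "0 < \<kappa> * (norm v)\<^sup>2" using \<kappa>(1) by simp
    then show "0 < v \<bullet> (S *v v)" using \<kappa>(2)[of v] by linarith
  qed
  have pdI: "pos_def_on I S" for I using pos_def_on_mono[OF pd] by simp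
  have R1: "1 \<le> R" using \<kappa> K R by simp
  let ?J = "{I\<in>Is. 0 < w I \<and> \<not> I \<subseteq> C}"
  let ?Q = "\<lambda>I x. (subinv S I *v x) \<bullet> (S *v (subinv S I *v x))"
  show ?case
  proof (cases "?J = {}")
    case True
    then have "i \<in> C" using i by auto
    then have "\<bar>y $ i\<bar> \<le> D" using less by auto
    also have "\<dots> \<le> D * R ^ card (- C)" using less R1 by (simp add: mult_le_cancel_left1)
    finally show ?thesis .
  next
    case False
    define m where "m = Max (w ` ?J)"
    have "m \<in> w ` ?J" unfolding m_def using False by (intro Max_in) auto
    then obtain I1 where I1: "I1 \<in> ?J" "w I1 = m" by auto
    have mx: "w I \<le> m" if "I \<in> ?J" for I unfolding m_def using that by (intro Max_ge) auto
    define z u where "z = coord_restrict (- C) y" and "u = coord_restrict C y"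
    have yzu: "y = z + u" by (auto simp: z_def u_def coord_restrict_def vec_eq_iff)
    \<comment> \<open>As \<open>a\<close> vanishes outside \<open>C\<close>, testing the equation
      for \<open>y\<close> with \<open>z\<close> gives the orthogonality relation \<open>zy\<close>,
      the Euler equation of the minimisation outside \<open>C\<close>; sets inside \<open>C\<close>
      drop out of it.\<close>
    have "z \<bullet> a = 0" unfolding inner_vec_def using less(2)
      by (intro sum.neutral) (auto simp: z_def coord_restrict_def supp_def)
    then have "(\<Sum>I\<in>{I\<in>Is. 0 < w I}. w I * (z \<bullet> (subinv S I *v y))) = 0"
      unfolding eq[symmetric] by (simp add: inner_sum_right)
    also have "(\<Sum>I\<in>{I\<in>Is. 0 < w I}. w I * (z \<bullet> (subinv S I *v y))) = (\<Sum>I\<in>?J. w I * (z \<bullet> (subinv S I *v y)))"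
    proof (rule sum.mono_neutral_right)
      show "\<forall>I\<in>{I \<in> Is. 0 < w I} - ?J. w I * (z \<bullet> (subinv S I *v y)) = 0"
      proof
        fix I assume "I \<in> {I \<in> Is. 0 < w I} - ?J"
        then have "I \<subseteq> C" by auto
        then have "z \<bullet> (subinv S I *v y) = 0"
          unfolding inner_vec_def using supp_subinv_mult[OF S pdI, of I y]
          by (intro sum.neutral) (auto simp: z_def coord_restrict_def supp_def)
        then show "w I * (z \<bullet> (subinv S I *v y)) = 0" by simp
      qed
    qed auto
    finally have zy: "(\<Sum>I\<in>?J. w I * (z \<bullet> (subinv S I *v y))) = 0" .
    have Qu: "?Q I u = ?Q I y + ?Q I z - 2 * (z \<bullet> (subinv S I *v y))" for I
    proof -
      have u: "u = y - z" using yzu by simp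
      have "(subinv S I *v z) \<bullet> (S *v (subinv S I *v y)) = (subinv S I *v y) \<bullet> (S *v (subinv S I *v z))"
        by (rule sym_inner[OF S])
      then show ?thesis
        unfolding u subinv_form[OF S pd, of z]
        by (simp add: matrix_vector_mult_diff_distrib inner_diff_left inner_diff_right)
    qed
    have "m * ?Q I1 y \<le> (\<Sum>I\<in>?J. w I * ?Q I y)"
      using I1 pos_def_on_ge0[OF pd] by (subst I1(2)[symmetric], intro member_le_sum) auto
    \<comment> \<open>\<open>u\<close> is the competitor that is zero outside \<open>C\<close>. By
      \<open>Qu\<close> and \<open>zy\<close> its weighted cost exceeds that of \<open>y\<close> by
      exactly the weighted cost of \<open>z\<close>.\<close>
    also have "\<dots> \<le> (\<Sum>I\<in>?J. w I * ?Q I u)"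
    proof -
      have "(\<Sum>I\<in>?J. w I * ?Q I u) = (\<Sum>I\<in>?J. w I * ?Q I y) + (\<Sum>I\<in>?J. w I * ?Q I z)
          - 2 * (\<Sum>I\<in>?J. w I * (z \<bullet> (subinv S I *v y)))"
        unfolding Qu by (simp add: algebra_simps sum.distrib sum_subtractf sum_distrib_left)
      moreover have "0 \<le> (\<Sum>I\<in>?J. w I * ?Q I z)"
        using pos_def_on_ge0[OF pd] by (intro sum_nonneg) auto
      ultimately show ?thesis using zy by simp
    qed
    also have "\<dots> \<le> (\<Sum>I\<in>?J. m * (CARD('k) * D\<^sup>2 / \<kappa>))"
    proof (rule sum_mono)
      fix I assume I: "I \<in> ?J"
      let ?h = "subinv S I *v u"
      have Q: "?Q I u = ?h \<bullet> u"
        using subinv_form[OF S pd, of u I u] by (simp add: inner_commute)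
      have "\<kappa> * (norm ?h)\<^sup>2 \<le> ?h \<bullet> u" using \<kappa>(2)[of ?h] Q by simp
      also have 1: "\<dots> \<le> norm ?h * norm u" by (rule norm_cauchy_schwarz)
      finally have "\<kappa> * norm ?h * norm ?h \<le> norm u * norm ?h"
        by (simp add: power2_eq_square mult_ac)
      then have "\<kappa> * norm ?h \<le> norm u"
        by (cases "norm ?h = 0") (auto simp: mult_le_cancel_right)
      then have "norm ?h \<le> norm u / \<kappa>" using \<kappa>(1) by (simp add: field_simps)
      then have "norm ?h * norm u \<le> norm u / \<kappa> * norm u" by (rule mult_right_mono) simp
      also have "\<dots> = (norm u)\<^sup>2 / \<kappa>" by (simp add: power2_eq_square)
      also have "(norm u)\<^sup>2 \<le> CARD('k) * D\<^sup>2"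
      proof -
        have "(norm u)\<^sup>2 = (\<Sum>i\<in>UNIV. (u $ i)\<^sup>2)"
          by (simp add: norm_vec_def L2_set_def sum_nonneg)
        also have "\<dots> \<le> (\<Sum>i\<in>(UNIV::'k set). D\<^sup>2)"
        proof (rule sum_mono)
          fix i
          have "\<bar>u $ i\<bar> \<le> \<bar>D\<bar>" using less(3)[of i] less(4) by (auto simp: u_def coord_restrict_def)
          then show "(u $ i)\<^sup>2 \<le> D\<^sup>2" by (simp add: abs_le_square_iff)
        qed
        finally show ?thesis by simp
      qed
      finally have "?Q I u \<le> CARD('k) * D\<^sup>2 / \<kappa>"
        using 1 Q \<kappa>(1) by (simp add: divide_right_mono)
      then show "w I * ?Q I u \<le> m * (CARD('k) * D\<^sup>2 / \<kappa>)"
        using mx[OF I] I pos_def_on_ge0[OF pd] \<kappa>(1) by (intro mult_mono) auto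
    qed
    also have "\<dots> = m * (card ?J * (CARD('k) * D\<^sup>2 / \<kappa>))" by simp
    also have "\<dots> \<le> m * (card Is * (CARD('k) * D\<^sup>2 / \<kappa>))"
      using I1 \<kappa>(1) by (intro mult_left_mono mult_right_mono) (auto intro!: card_mono)
    finally have "m * ?Q I1 y \<le> m * (card Is * (CARD('k) * D\<^sup>2 / \<kappa>))" .
    moreover have "0 < m" using I1 by auto
    ultimately have QI1: "?Q I1 y \<le> card Is * (CARD('k) * D\<^sup>2 / \<kappa>)"
      by (simp only: mult_le_cancel_left_pos)
    \<comment> \<open>The coordinates of \<open>y\<close> on \<open>I1\<close> are recovered from
      \<open>subinv S I1 *v y\<close> by applying \<open>S\<close>, whose growth is bounded by
      \<open>K\<close>.\<close>
    have bound: "\<bar>y $ j\<bar> \<le> D * R" if j: "j \<in> I1" for j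
    proof -
      let ?h = "subinv S I1 *v y"
      have "\<bar>y $ j\<bar> = \<bar>(S *v ?h) $ j\<bar>" using mult_subinv[OF S pdI j] by simp
      also have "\<dots> \<le> norm (S *v ?h)" by (rule component_le_norm_cart)
      also have "\<dots> \<le> K * norm ?h" by (rule K)
      finally have "\<bar>y $ j\<bar>\<^sup>2 \<le> (K * norm ?h)\<^sup>2" by (rule power_mono) simp
      also have "\<dots> = K\<^sup>2 / \<kappa> * (\<kappa> * (norm ?h)\<^sup>2)" using \<kappa>(1) by (simp add: power_mult_distrib)
      also have "\<dots> \<le> K\<^sup>2 / \<kappa> * (card Is * (CARD('k) * D\<^sup>2 / \<kappa>))"
        using \<kappa> QI1 by (intro mult_left_mono order_trans[OF \<kappa>(2) QI1]) auto
      also have "\<dots> = D\<^sup>2 * (R - 1)" unfolding R by simp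
      also have "\<dots> \<le> D\<^sup>2 * R\<^sup>2"
        using R1 self_le_power[of R 2] by (intro mult_left_mono) auto
      also have "\<dots> = (D * R)\<^sup>2" by (simp add: power_mult_distrib)
      finally show ?thesis using less(4) R1 by (simp add: power2_le_iff_abs_le)
    qed
    have sub: "- (C \<union> I1) \<subset> - C" using I1 by auto
    then have lt: "card (- (C \<union> I1)) < card (- C)" by (intro psubset_card_mono) auto
    have "\<bar>y $ i\<bar> \<le> (D * R) * R ^ card (- (C \<union> I1))"
    proof (rule less.hyps[OF lt])
      show "\<bar>y $ j\<bar> \<le> D * R" if "j \<in> C \<union> I1" for j
        using that bound less(3)[of j] less(4) R1
        by (auto intro: order_trans simp: mult_le_cancel_left1)
    qed (use less R1 in auto)
    also have "\<dots> = D * R ^ Suc (card (- (C \<union> I1)))" by simp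
    also have "\<dots> \<le> D * R ^ card (- C)"
      using lt less(4) R1 by (intro mult_left_mono power_increasing) auto
    finally show ?thesis .
  qed
qed

section \<open>The continuous allocation problem\<close>

definition budget :: "'k set set \<Rightarrow> ('k set \<Rightarrow> real^'m) \<Rightarrow> real^'m \<Rightarrow> ('k set \<Rightarrow> real) \<Rightarrow> bool" where
  "budget Is c B w \<longleftrightarrow> (\<forall>I. I \<notin> Is \<longrightarrow> w I = 0) \<and> (\<forall>I\<in>Is. 0 \<le> w I) \<and>
     (\<forall>i. (\<Sum>I\<in>Is. w I * c I $ i) \<le> B $ i)"

lemma cont_feasible_budget:
  "cont_feasible Is c B a w \<longleftrightarrow> budget Is c B w \<and> supp a \<subseteq> \<Union>{I\<in>Is. 0 < w I}"
  by (auto simp: cont_feasible_def budget_def)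

lemma alloc_feasible_budget:
  assumes "0 < t"
  shows "alloc_feasible Is c (t *\<^sub>R B) n \<longleftrightarrow> budget Is c B (\<lambda>I. real (n I) / t)"
proof -
  have "(\<Sum>I\<in>Is. real (n I) / t * c I $ i) = (\<Sum>I\<in>Is. real (n I) * c I $ i) / t" for i
    by (simp add: sum_divide_distrib)
  then show ?thesis
    using assms by (auto simp: alloc_feasible_def budget_def divide_le_eq mult.commute)
qed

locale design =
  fixes Is :: "'k::finite set set" and c :: "'k set \<Rightarrow> real^'m" and B0 :: "real^'m"
    and a :: "real^'k" and Sigma :: "real^'k^'k" and nustar :: "'k set \<Rightarrow> real" and Vstar :: real
  assumes a_nz: "a \<noteq> 0"
    and c_nonneg: "\<And>I i. I \<in> Is \<Longrightarrow> 0 \<le> c I $ i"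
    and B0_pos: "\<And>i. 0 < B0 $ i"
    and sym: "transpose Sigma = Sigma" and pd: "pos_def_on UNIV Sigma"
    and minimizer: "cont_minimizer Is c B0 Sigma a nustar"
    and unique: "\<And>\<nu>. cont_minimizer Is c B0 Sigma a \<nu> \<Longrightarrow> \<nu> = nustar"
    and Vstar_eq: "Vstar = var_obj Is Sigma a nustar"
begin

section \<open>The continuous optimum and its optimal weights\<close>

lemma nustar_nonneg: "I \<in> Is \<Longrightarrow> 0 \<le> nustar I"
  and nustar_budget: "budget Is c B0 nustar"
  and nustar_supp: "supp a \<subseteq> \<Union>{I\<in>Is. 0 < nustar I}"
  using minimizer by (auto simp: cont_minimizer_def cont_feasible_budget budget_def)

lemma Vstar_le: "budget Is c B0 w \<Longrightarrow> supp a \<subseteq> \<Union>{I\<in>Is. 0 < w I} \<Longrightarrow> Vstar \<le> var_obj Is Sigma a w"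
  using minimizer by (auto simp: cont_minimizer_def cont_feasible_budget Vstar_eq)

definition dual_star :: "real^'k" where
  "dual_star = (SOME y. weights_for Is a nustar (\<lambda>I. nustar I *\<^sub>R (subinv Sigma I *v y)) \<and>
    weight_cost Is Sigma nustar (\<lambda>I. nustar I *\<^sub>R (subinv Sigma I *v y)) = var_obj Is Sigma a nustar)"

text \<open>The limit that matters for \<open>t\<close> times the weight divided by the sample size.
  It is set to zero where \<open>nustar I = 0\<close>, even though
  \<open>subinv Sigma I *v dual_star\<close> may be nonzero there, because such draws do not enter
  the limit law.\<close>

definition ratio_star :: "'k set \<Rightarrow> real^'k" where
  "ratio_star I = (if 0 < nustar I then subinv Sigma I *v dual_star else 0)"

definition weight_star :: "'k set \<Rightarrow> real^'k" where
  "weight_star I = nustar I *\<^sub>R ratio_star I"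

lemma dual_star:
  "weights_for Is a nustar (\<lambda>I. nustar I *\<^sub>R (subinv Sigma I *v dual_star))"
  "weight_cost Is Sigma nustar (\<lambda>I. nustar I *\<^sub>R (subinv Sigma I *v dual_star)) = Vstar"
proof -
  obtain y where y: "weights_for Is a nustar (\<lambda>I. nustar I *\<^sub>R (subinv Sigma I *v y))"
    "weight_cost Is Sigma nustar (\<lambda>I. nustar I *\<^sub>R (subinv Sigma I *v y)) = var_obj Is Sigma a nustar"
    by (rule optimal_weights[OF sym pd nustar_nonneg nustar_supp])
  then have "\<exists>y. weights_for Is a nustar (\<lambda>I. nustar I *\<^sub>R (subinv Sigma I *v y)) \<and>
    weight_cost Is Sigma nustar (\<lambda>I. nustar I *\<^sub>R (subinv Sigma I *v y)) = var_obj Is Sigma a nustar"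
    by blast
  from someI_ex[OF this] show
    "weights_for Is a nustar (\<lambda>I. nustar I *\<^sub>R (subinv Sigma I *v dual_star))"
    "weight_cost Is Sigma nustar (\<lambda>I. nustar I *\<^sub>R (subinv Sigma I *v dual_star)) = Vstar"
    unfolding dual_star_def Vstar_eq by blast+
qed

lemma weight_star_eq: "I \<in> Is \<Longrightarrow> weight_star I = nustar I *\<^sub>R (subinv Sigma I *v dual_star)"
  using nustar_nonneg[of I] by (auto simp: weight_star_def ratio_star_def less_eq_real_def)

lemma weight_star_feas: "weights_for Is a nustar weight_star"
proof -
  have "(\<Sum>I\<in>{I\<in>Is. 0 < nustar I}. weight_star I) =
      (\<Sum>I\<in>{I\<in>Is. 0 < nustar I}. nustar I *\<^sub>R (subinv Sigma I *v dual_star))"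
    by (rule sum.cong) (auto simp: weight_star_eq)
  then show ?thesis using dual_star(1) by (simp add: weights_for_def weight_star_eq)
qed

lemma weight_star_obj: "weight_cost Is Sigma nustar weight_star = Vstar"
proof -
  have "weight_cost Is Sigma nustar weight_star = weight_cost Is Sigma nustar (\<lambda>I. nustar I *\<^sub>R (subinv Sigma I *v dual_star))"
    unfolding weight_cost_def by (rule sum.cong) (auto simp: weight_star_eq)
  then show ?thesis using dual_star(2) by simp
qed

text \<open>The form in which the variance arises from the central limit theorem: per unit of
  \<open>t\<close>, \<open>nustar I\<close> observations, each projected along
  \<open>ratio_star I\<close>.\<close>

lemma Vstar_ratio_star: "Vstar = (\<Sum>I\<in>Is. nustar I * (ratio_star I \<bullet> (Sigma *v ratio_star I)))"
proof -
  have "weight_cost Is Sigma nustar weight_star = (\<Sum>I\<in>{I\<in>Is. 0 < nustar I}. nustar I * (ratio_star I \<bullet> (Sigma *v ratio_star I)))"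
    unfolding weight_cost_def
    by (intro sum.cong) (auto simp: weight_star_def matrix_vector_mult_scaleR)
  also have "\<dots> = (\<Sum>I\<in>Is. nustar I * (ratio_star I \<bullet> (Sigma *v ratio_star I)))"
    by (rule sum.mono_neutral_left) (auto simp: ratio_star_def)
  finally show ?thesis by (simp add: weight_star_obj)
qed

text \<open>A zero cost would make all weights vanish, but they add up to \<open>a\<close>. The
  limit law is therefore not degenerate.\<close>

lemma Vstar_pos: "0 < Vstar"
proof (rule ccontr)
  assume "\<not> 0 < Vstar"
  then have 0: "weight_cost Is Sigma nustar weight_star = 0"
    using weight_star_obj weight_cost_nonneg[OF pd, of Is nustar weight_star] by simp
  have "(\<Sum>I\<in>{I\<in>Is. 0 < nustar I}. weight_star I) = 0"
    by (rule sum.neutral) (use weight_cost_eq_0D[OF pd 0] in auto)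
  then show False using weight_star_feas a_nz by (simp add: weights_for_def)
qed

text \<open>One further unit of a free set would respect the budget, leave
  \<open>weight_star\<close> admissible and not increase its cost, giving a second
  minimizer.\<close>

lemma cost_pos:
  assumes I: "I \<in> Is"
  shows "\<exists>i. 0 < c I $ i"
proof (rule ccontr)
  assume "\<not> ?thesis"
  then have c0: "c I $ i = 0" for i using c_nonneg[OF I, of i] by (auto simp: not_less intro: antisym)
  define w where "w = nustar(I := nustar I + 1)"
  have "(\<Sum>J\<in>Is. w J * c J $ i) = (\<Sum>J\<in>Is. nustar J * c J $ i)" for i
    by (rule sum.cong) (auto simp: w_def c0)
  then have bw: "budget Is c B0 w"
    using nustar_budget I by (auto simp: budget_def w_def)
  have supp: "supp a \<subseteq> \<Union>{I\<in>Is. 0 < w I}"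
    using nustar_supp nustar_nonneg[OF I] by (force simp: w_def)
  have sub: "{I\<in>Is. 0 < nustar I} \<subseteq> {I\<in>Is. 0 < w I}"
    by (auto simp: w_def)
  \<comment> \<open>The only set that can become newly used is \<open>I\<close>, and there
    \<open>weight_star\<close> is zero in that case.\<close>
  have "weights_for Is a w weight_star"
  proof -
    have "(\<Sum>I\<in>{I\<in>Is. 0 < w I}. weight_star I) = (\<Sum>I\<in>{I\<in>Is. 0 < nustar I}. weight_star I)"
      by (rule sum.mono_neutral_right[OF _ sub]) (auto simp: weight_star_def ratio_star_def)
    then show ?thesis using weight_star_feas by (simp add: weights_for_def)
  qed
  then have "var_obj Is Sigma a w \<le> weight_cost Is Sigma w weight_star"
    by (rule var_obj_le_weight_cost[OF sym pd, rotated]) (use bw in \<open>auto simp: budget_def\<close>)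
  also have "\<dots> = (\<Sum>I\<in>{I\<in>Is. 0 < nustar I}. (1 / w I) * (weight_star I \<bullet> (Sigma *v weight_star I)))"
    unfolding weight_cost_def by (rule sum.mono_neutral_right[OF _ sub]) (auto simp: weight_star_def ratio_star_def)
  also have "\<dots> \<le> weight_cost Is Sigma nustar weight_star"
    unfolding weight_cost_def
    by (intro sum_mono mult_right_mono pos_def_on_ge0[OF pd]) (auto simp: w_def field_simps)
  finally have "var_obj Is Sigma a w \<le> Vstar" by (simp add: weight_star_obj)
  then have "cont_minimizer Is c B0 Sigma a w"
    using Vstar_le bw supp unfolding cont_minimizer_def cont_feasible_budget
    by (auto intro: order_trans)
  then have "w = nustar" by (rule unique)
  then show False by (auto simp: w_def fun_eq_iff split: if_splits)
qed

text \<open>Each set is capped by some resource that it really consumes; the sum of these caps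
  serves as one bound for all sets.\<close>

definition budget_max :: real where
  "budget_max = (\<Sum>I\<in>Is. B0 $ (SOME i. 0 < c I $ i) / c I $ (SOME i. 0 < c I $ i))"

lemma budget_le:
  assumes w: "budget Is c B0 w" and I: "I \<in> Is"
  shows "w I \<le> budget_max"
proof -
  define j where "j I = (SOME i. 0 < c I $ i)" for I
  have j: "0 < c I $ j I" if "I \<in> Is" for I
    unfolding j_def using cost_pos[OF that] by (rule someI_ex)
  have "w I * c I $ j I \<le> (\<Sum>J\<in>Is. w J * c J $ j I)"
    using w c_nonneg I by (intro member_le_sum) (auto simp: budget_def)
  also have "\<dots> \<le> B0 $ j I" using w by (simp add: budget_def)
  finally have "w I \<le> B0 $ j I / c I $ j I" using j[OF I] by (simp add: field_simps)
  also have "\<dots> \<le> (\<Sum>I\<in>Is. B0 $ j I / c I $ j I)"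
    by (rule member_le_sum[OF I]) (auto intro!: divide_nonneg_pos less_imp_le[OF B0_pos] j)
  finally show ?thesis by (simp add: budget_max_def j_def)
qed

section \<open>Perturbation of the covariance matrix\<close>

lemma coercive: "\<exists>\<kappa>>0. \<forall>x. \<kappa> * (norm x)\<^sup>2 \<le> x \<bullet> (Sigma *v x)"
proof -
  have "compact (sphere (0::real^'k) 1)" by simp
  moreover have "sphere (0::real^'k) 1 \<noteq> {}" by simp
  moreover have "continuous_on (sphere (0::real^'k) 1) (\<lambda>x. x \<bullet> (Sigma *v x))"
    by (intro continuous_intros linear_continuous_on matrix_vector_mul_bounded_linear)
  ultimately have "\<exists>x0\<in>sphere 0 1. \<forall>x\<in>sphere 0 1. x0 \<bullet> (Sigma *v x0) \<le> x \<bullet> (Sigma *v x)"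
    by (rule continuous_attains_inf)
  then obtain x0 where x0: "x0 \<in> sphere 0 1" 
      "\<And>x. x \<in> sphere 0 1 \<Longrightarrow> x0 \<bullet> (Sigma *v x0) \<le> x \<bullet> (Sigma *v x)"
    by blast
  have "x0 \<noteq> 0" using x0 by auto
  then have pos: "0 < x0 \<bullet> (Sigma *v x0)" using pd by (simp add: pos_def_on_def)
  have "x0 \<bullet> (Sigma *v x0) * (norm x)\<^sup>2 \<le> x \<bullet> (Sigma *v x)" for x
  proof (cases "x = 0")
    case False
    then have "x0 \<bullet> (Sigma *v x0) \<le> ((1 / norm x) *\<^sub>R x) \<bullet> (Sigma *v ((1 / norm x) *\<^sub>R x))"
      by (intro x0(2)) simp
    also have "\<dots> = x \<bullet> (Sigma *v x) / (norm x)\<^sup>2"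
      by (simp add: matrix_vector_mult_scaleR power2_eq_square)
    finally show ?thesis using False by (simp add: field_simps)
  qed simp
  with pos show ?thesis by blast
qed

definition \<kappa> :: real where
  "\<kappa> = (SOME \<kappa>. 0 < \<kappa> \<and> (\<forall>x. \<kappa> * (norm x)\<^sup>2 \<le> x \<bullet> (Sigma *v x)))"

lemma \<kappa>: "0 < \<kappa>" "\<kappa> * (norm x)\<^sup>2 \<le> x \<bullet> (Sigma *v x)"
  using someI_ex[OF coercive] unfolding \<kappa>_def by auto

abbreviation close :: "real \<Rightarrow> real^'k^'k \<Rightarrow> bool" where
  "close \<delta> S \<equiv> transpose S = S \<and> onorm (\<lambda>x. (S - Sigma) *v x) \<le> \<delta>"

lemma close_norm: "close \<delta> S \<Longrightarrow> norm (S *v x - Sigma *v x) \<le> \<delta> * norm x"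
proof -
  assume S: "close \<delta> S"
  have "norm ((S - Sigma) *v x) \<le> onorm (\<lambda>x. (S - Sigma) *v x) * norm x"
    by (rule onorm) (rule matrix_vector_mul_bounded_linear)
  also have "\<dots> \<le> \<delta> * norm x" using S by (intro mult_right_mono) auto
  finally show ?thesis by (simp add: matrix_vector_mult_diff_rdistrib)
qed

lemma close_form: "close \<delta> S \<Longrightarrow> \<bar>x \<bullet> (S *v x) - x \<bullet> (Sigma *v x)\<bar> \<le> \<delta> * (norm x)\<^sup>2"
proof -
  assume S: "close \<delta> S"
  have "\<bar>x \<bullet> (S *v x) - x \<bullet> (Sigma *v x)\<bar> = \<bar>x \<bullet> (S *v x - Sigma *v x)\<bar>"
    by (simp add: inner_diff_right)
  also have "\<dots> \<le> norm x * norm (S *v x - Sigma *v x)" by (rule Cauchy_Schwarz_ineq2)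
  also have "\<dots> \<le> norm x * (\<delta> * norm x)" by (intro mult_left_mono close_norm S) simp
  finally show ?thesis by (simp add: power2_eq_square mult_ac)
qed

lemma close_coercive: "close \<delta> S \<Longrightarrow> (\<kappa> - \<delta>) * (norm x)\<^sup>2 \<le> x \<bullet> (S *v x)"
  using close_form[of S \<delta> x] \<kappa>(2)[of x] by (simp add: left_diff_distrib abs_le_iff)

lemma close_pd:
  assumes "close \<delta> S" "\<delta> < \<kappa>"
  shows "pos_def_on UNIV S"
  unfolding pos_def_on_def
proof (intro allI impI)
  fix v :: "real^'k" assume "v \<noteq> 0"
  then have "0 < (\<kappa> - \<delta>) * (norm v)\<^sup>2" using assms by simp
  then show "0 < v \<bullet> (S *v v)" using close_coercive[OF assms(1), of v] by linarith
qed

text \<open>Measuring the perturbation in units of \<open>\<kappa>\<close> turns the additive error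
  of the quadratic form into a relative one, so the estimate is uniform in sizes and
  weights.\<close>

lemma close_weight_cost:
  assumes S: "close (\<theta> * \<kappa>) S" and \<theta>: "0 \<le> \<theta>"
  shows "(1 - \<theta>) * weight_cost Is Sigma w lam \<le> weight_cost Is S w lam"
    and "weight_cost Is S w lam \<le> (1 + \<theta>) * weight_cost Is Sigma w lam"
proof -
  have *: "\<bar>x \<bullet> (S *v x) - x \<bullet> (Sigma *v x)\<bar> \<le> \<theta> * (x \<bullet> (Sigma *v x))" for x
    using close_form[OF S, of x] mult_left_mono[OF \<kappa>(2)[of x] \<theta>] by (simp add: mult.assoc)
  have "(1 - \<theta>) * (x \<bullet> (Sigma *v x)) \<le> x \<bullet> (S *v x)" "x \<bullet> (S *v x) \<le> (1 + \<theta>) * (x \<bullet> (Sigma *v x))" for x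
    using *[of x] by (auto simp: abs_le_iff algebra_simps)
  then show "(1 - \<theta>) * weight_cost Is Sigma w lam \<le> weight_cost Is S w lam"
    "weight_cost Is S w lam \<le> (1 + \<theta>) * weight_cost Is Sigma w lam"
    unfolding weight_cost_def sum_distrib_left mult.left_commute[of _ "1 / _"]
    by (auto intro!: sum_mono mult_left_mono divide_right_mono)
qed

text \<open>A sequence of nearly optimal pairs that stays away from the optimum would have a limit
  that is again feasible and optimal. Uniqueness of \<open>nustar\<close> fixes the limit sizes, and
  the exact decomposition of the cost fixes the limit weights.\<close>

lemma near_minimizer:
  assumes \<epsilon>: "0 < \<epsilon>"
  shows "\<exists>\<eta>>0. \<forall>w lam. budget Is c B0 w \<longrightarrow> weights_for Is a w lam \<longrightarrow> weight_cost Is Sigma w lam \<le> Vstar + \<eta> \<longrightarrow>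
    (\<forall>I\<in>Is. \<bar>w I - nustar I\<bar> \<le> \<epsilon> \<and> (0 < w I \<longrightarrow> norm (lam I - weight_star I) \<le> \<epsilon>))"
proof (rule ccontr)
  assume neg: "\<not> ?thesis"
  have "\<exists>w lam. budget Is c B0 w \<and> weights_for Is a w lam \<and> weight_cost Is Sigma w lam \<le> Vstar + 1 / Suc k \<and>
    \<not> (\<forall>I\<in>Is. \<bar>w I - nustar I\<bar> \<le> \<epsilon> \<and> (0 < w I \<longrightarrow> norm (lam I - weight_star I) \<le> \<epsilon>))" for k
    using neg by (metis of_nat_0_less_iff zero_less_Suc zero_less_divide_1_iff)
  then obtain w lam where w: "\<And>k. budget Is c B0 (w k)" and lam: "\<And>k. weights_for Is a (w k) (lam k)"
    and obj: "\<And>k. weight_cost Is Sigma (w k) (lam k) \<le> Vstar + 1 / Suc k"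
    and far: "\<And>k. \<exists>I\<in>Is. \<not> (\<bar>w k I - nustar I\<bar> \<le> \<epsilon> \<and> (0 < w k I \<longrightarrow> norm (lam k I - weight_star I) \<le> \<epsilon>))"
    by metis
  have w0: "0 \<le> w k I" if "I \<in> Is" for k I using w[of k] that by (simp add: budget_def)
  define l where "l k I = (if 0 < w k I then lam k I else 0)" for k I
  have lSigma: "l k I \<bullet> (Sigma *v l k I) \<le> w k I * (Vstar + 1)" if I: "I \<in> Is" for k I
  proof (cases "0 < w k I")
    case True
    have "(1 / w k I) * (lam k I \<bullet> (Sigma *v lam k I)) \<le> weight_cost Is Sigma (w k) (lam k)"
      unfolding weight_cost_def using I True pos_def_on_ge0[OF pd] by (intro member_le_sum) auto
    also have "\<dots> \<le> Vstar + 1 / Suc k" by (rule obj)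
    also have "\<dots> \<le> Vstar + 1" by simp
    finally show ?thesis using True by (simp add: l_def field_simps)
  next
    case False
    then show ?thesis using w0[OF I, of k] Vstar_pos by (simp add: l_def)
  qed
  \<comment> \<open>The cost bounds the square of a weight by a multiple of its size. This serves
    twice: for boundedness, and to show that a weight vanishes in the limit when its size
    does.\<close>
  have lnorm: "\<kappa> * (norm (l k I))\<^sup>2 \<le> w k I * (Vstar + 1)" if I: "I \<in> Is" for k I
    using lSigma[OF I] \<kappa>(2) by (rule order_trans[rotated])
  define L where "L = budget_max * (Vstar + 1) / \<kappa>"
  have lb: "(norm (l k I))\<^sup>2 \<le> L" if I: "I \<in> Is" for k I
  proof -
    have "w k I * (Vstar + 1) \<le> budget_max * (Vstar + 1)"
      using budget_le[OF w I] Vstar_pos by (intro mult_right_mono) auto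
    with lnorm[OF I, of k] show ?thesis using \<kappa>(1) by (simp add: L_def field_simps)
  qed
  \<comment> \<open>Sizes and weights of all sets are packed into one vector of a Euclidean space,
    in order to extract a single convergent subsequence.\<close>
  define p :: "nat \<Rightarrow> (real \<times> (real^'k), 'k set) vec"
    where "p k = (\<chi> I. if I \<in> Is then (w k I, l k I) else 0)" for k
  have "bounded (range p)"
    unfolding bounded_iff
  proof (intro exI ballI)
    fix x assume "x \<in> range p"
    then obtain k where x: "x = p k" by blast
    have "norm (p k) \<le> (\<Sum>I\<in>UNIV. norm (p k $ I))"
      unfolding norm_vec_def by (rule L2_set_le_sum) simp
    also have "\<dots> \<le> (\<Sum>I\<in>(UNIV::'k set set). \<bar>budget_max\<bar> + sqrt (\<bar>L\<bar>))"
    proof (rule sum_mono)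
      fix I
      show "norm (p k $ I) \<le> \<bar>budget_max\<bar> + sqrt (\<bar>L\<bar>)"
      proof (cases "I \<in> Is")
        case True
        have "norm (w k I, l k I) \<le> norm (w k I) + norm (l k I)" by (rule norm_Pair_le)
        then have "norm (p k $ I) \<le> norm (w k I) + norm (l k I)" using True by (simp add: p_def)
        moreover have "norm (w k I) \<le> \<bar>budget_max\<bar>" using budget_le[OF w True, of k] w0[OF True, of k] by simp
        moreover have "norm (l k I) \<le> sqrt \<bar>L\<bar>"
          using lb[OF True, of k] by (intro real_le_rsqrt) linarith
        ultimately show ?thesis by linarith
      qed (simp add: p_def)
    qed
    finally show "norm x \<le> (\<Sum>I\<in>(UNIV::'k set set). \<bar>budget_max\<bar> + sqrt (\<bar>L\<bar>))" using x by simp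
  qed
  then obtain q r where r: "strict_mono r" and q: "(p \<circ> r) \<longlonglongrightarrow> q"
    using bounded_imp_convergent_subsequence by blast
  define wl where "wl I = fst (q $ I)" for I
  define ll where "ll I = snd (q $ I)" for I
  have conv: "(\<lambda>k. w (r k) I) \<longlonglongrightarrow> wl I" "(\<lambda>k. l (r k) I) \<longlonglongrightarrow> ll I" if I: "I \<in> Is" for I
  proof -
    have "(\<lambda>k. (p \<circ> r) k $ I) \<longlonglongrightarrow> q $ I" by (rule tendsto_vec_nth[OF q])
    then have *: "(\<lambda>k. (w (r k) I, l (r k) I)) \<longlonglongrightarrow> q $ I" using I by (simp add: p_def comp_def)
    show "(\<lambda>k. w (r k) I) \<longlonglongrightarrow> wl I" "(\<lambda>k. l (r k) I) \<longlonglongrightarrow> ll I"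
      using tendsto_fst[OF *] tendsto_snd[OF *] by (simp_all add: wl_def ll_def)
  qed
  have out: "wl I = 0" if "I \<notin> Is" for I
  proof -
    have "(\<lambda>k. (p \<circ> r) k $ I) \<longlonglongrightarrow> q $ I" by (rule tendsto_vec_nth[OF q])
    then have "(\<lambda>k. 0) \<longlonglongrightarrow> q $ I" using that by (simp add: p_def comp_def)
    then show ?thesis by (simp add: wl_def LIMSEQ_const_iff flip: zero_prod_def)
  qed
  have wl0: "0 \<le> wl I" if I: "I \<in> Is" for I
    by (rule LIMSEQ_le_const[OF conv(1)[OF I]]) (use w0[OF I] in blast)
  have budget_wl: "budget Is c B0 wl"
    unfolding budget_def
  proof (intro conjI allI impI ballI)
    fix i
    have "(\<lambda>k. \<Sum>I\<in>Is. w (r k) I * c I $ i) \<longlonglongrightarrow> (\<Sum>I\<in>Is. wl I * c I $ i)"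
      by (intro tendsto_intros conv)
    then show "(\<Sum>I\<in>Is. wl I * c I $ i) \<le> B0 $ i"
      by (rule LIMSEQ_le_const2) (use w in \<open>auto simp: budget_def\<close>)
  qed (use out wl0 in auto)
  have ll0: "ll I = 0" if I: "I \<in> Is" and z: "wl I = 0" for I
  proof -
    have "(\<lambda>k. \<kappa> * (norm (l (r k) I))\<^sup>2) \<longlonglongrightarrow> \<kappa> * (norm (ll I))\<^sup>2"
      by (intro tendsto_intros conv I)
    moreover have "(\<lambda>k. w (r k) I * (Vstar + 1)) \<longlonglongrightarrow> wl I * (Vstar + 1)"
      by (intro tendsto_intros conv I)
    ultimately have "\<kappa> * (norm (ll I))\<^sup>2 \<le> wl I * (Vstar + 1)"
      by (rule LIMSEQ_le) (use lnorm[OF I] in blast)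
    then show ?thesis using z \<kappa>(1) by (simp add: mult_le_0_iff)
  qed
  have feas_l: "(\<Sum>I\<in>Is. l k I) = a" for k
  proof -
    have "(\<Sum>I\<in>Is. l k I) = (\<Sum>I\<in>{I\<in>Is. 0 < w k I}. lam k I)"
      by (rule sum.mono_neutral_cong_right) (auto simp: l_def)
    then show ?thesis using lam[of k] by (simp add: weights_for_def)
  qed
  have feas_ll: "weights_for Is a wl ll"
  proof -
    have "(\<lambda>k. \<Sum>I\<in>Is. l (r k) I) \<longlonglongrightarrow> (\<Sum>I\<in>Is. ll I)" by (intro tendsto_intros conv)
    then have "(\<Sum>I\<in>Is. ll I) = a" unfolding feas_l by (simp add: LIMSEQ_const_iff)
    moreover have "(\<Sum>I\<in>Is. ll I) = (\<Sum>I\<in>{I\<in>Is. 0 < wl I}. ll I)"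
      by (rule sum.mono_neutral_right) (use ll0 wl0 in \<open>force simp: less_eq_real_def\<close>)+
    moreover have "supp (ll I) \<subseteq> I" if I: "I \<in> Is" for I
    proof
      fix i assume i: "i \<in> supp (ll I)"
      show "i \<in> I"
      proof (rule ccontr)
        assume "i \<notin> I"
        then have "l k I $ i = 0" for k using lam[of k] I by (auto simp: l_def weights_for_def supp_def)
        moreover have "(\<lambda>k. l (r k) I $ i) \<longlonglongrightarrow> ll I $ i" by (intro tendsto_vec_nth conv I)
        ultimately have "ll I $ i = 0" by (simp add: LIMSEQ_const_iff)
        with i show False by (simp add: supp_def)
      qed
    qed
    ultimately show ?thesis by (simp add: weights_for_def)
  qed
  \<comment> \<open>Only the sets of positive limit size are kept. Their terms converge and the
    dropped ones are nonnegative, so the cost of the limit is no larger than the limit of the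
    bounds.\<close>
  have obj_ll: "weight_cost Is Sigma wl ll \<le> Vstar"
  proof (rule LIMSEQ_le)
    show "(\<lambda>k. \<Sum>I\<in>{I\<in>Is. 0 < wl I}. (1 / w (r k) I) * (l (r k) I \<bullet> (Sigma *v l (r k) I)))
        \<longlonglongrightarrow> weight_cost Is Sigma wl ll"
      unfolding weight_cost_def
      by (intro tendsto_sum tendsto_mult tendsto_divide tendsto_const tendsto_inner conv
          bounded_linear.tendsto[OF matrix_vector_mul_bounded_linear]) auto
    have "(\<lambda>k. Vstar + 1 / Suc k) \<longlonglongrightarrow> Vstar + 0"
      using LIMSEQ_inverse_real_of_nat by (intro tendsto_add tendsto_const) (simp add: inverse_eq_divide)
    from LIMSEQ_subseq_LIMSEQ[OF this r]
    show "(\<lambda>k. Vstar + 1 / Suc (r k)) \<longlonglongrightarrow> Vstar" by (simp add: comp_def)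
    have "(\<Sum>I\<in>{I\<in>Is. 0 < wl I}. (1 / w k I) * (l k I \<bullet> (Sigma *v l k I))) \<le> Vstar + 1 / Suc k" for k
    proof -
      have "(\<Sum>I\<in>{I\<in>Is. 0 < wl I}. (1 / w k I) * (l k I \<bullet> (Sigma *v l k I)))
          \<le> (\<Sum>I\<in>Is. (1 / w k I) * (l k I \<bullet> (Sigma *v l k I)))"
        using w0 pos_def_on_ge0[OF pd] by (intro sum_mono2) auto
      also have "\<dots> = weight_cost Is Sigma (w k) (lam k)"
        unfolding weight_cost_def by (rule sum.mono_neutral_cong_right) (auto simp: l_def)
      also have "\<dots> \<le> Vstar + 1 / Suc k" by (rule obj)
      finally show ?thesis .
    qed
    then show "\<exists>N. \<forall>k\<ge>N. (\<Sum>I\<in>{I\<in>Is. 0 < wl I}. (1 / w (r k) I) * (l (r k) I \<bullet> (Sigma *v l (r k) I)))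
        \<le> Vstar + 1 / Suc (r k)" by blast
  qed
  have "var_obj Is Sigma a wl \<le> Vstar"
    using var_obj_le_weight_cost[OF sym pd wl0 feas_ll] obj_ll by linarith
  then have "cont_minimizer Is c B0 Sigma a wl"
    unfolding cont_minimizer_def cont_feasible_budget
    using budget_wl weights_for_supp[OF feas_ll] Vstar_le by (auto intro: order_trans)
  then have wl: "wl = nustar" by (rule unique)
  \<comment> \<open>The optimal weights already exhaust \<open>Vstar\<close>, which leaves nothing
    for the difference term.\<close>
  have "weight_cost Is Sigma nustar ll = weight_cost Is Sigma nustar (\<lambda>I. nustar I *\<^sub>R (subinv Sigma I *v dual_star))
    + weight_cost Is Sigma nustar (\<lambda>I. ll I - nustar I *\<^sub>R (subinv Sigma I *v dual_star))"
    by (rule weight_cost_decomp[OF sym pd _ dual_star(1)]) (use feas_ll wl in simp)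
  then have "weight_cost Is Sigma nustar (\<lambda>I. ll I - nustar I *\<^sub>R (subinv Sigma I *v dual_star)) = 0"
    using dual_star(2) obj_ll[unfolded wl] weight_cost_nonneg[OF pd, of Is nustar "\<lambda>I. ll I - nustar I *\<^sub>R (subinv Sigma I *v dual_star)"]
    by linarith
  from weight_cost_eq_0D[OF pd this] have ll: "ll I = weight_star I" if "I \<in> Is" for I
    using that ll0[OF that] nustar_nonneg[OF that] weight_star_eq[OF that]
    by (cases "0 < nustar I") (auto simp: wl)
  have "\<forall>\<^sub>F k in sequentially. \<forall>I\<in>Is. \<bar>w (r k) I - nustar I\<bar> \<le> \<epsilon> \<and> norm (l (r k) I - weight_star I) \<le> \<epsilon>"
  proof (rule eventually_ball_finite, simp, intro ballI)
    fix I assume I: "I \<in> Is"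
    have "\<forall>\<^sub>F k in sequentially. dist (w (r k) I) (nustar I) < \<epsilon>"
      using conv(1)[OF I] \<epsilon> wl by (simp add: tendsto_iff)
    moreover have "\<forall>\<^sub>F k in sequentially. dist (l (r k) I) (weight_star I) < \<epsilon>"
      using conv(2)[OF I] \<epsilon> ll[OF I] by (simp add: tendsto_iff)
    ultimately show "\<forall>\<^sub>F k in sequentially. \<bar>w (r k) I - nustar I\<bar> \<le> \<epsilon> \<and> norm (l (r k) I - weight_star I) \<le> \<epsilon>"
      by eventually_elim (auto simp: dist_norm)
  qed
  from eventually_happens'[OF sequentially_bot this]
  obtain k where "\<forall>I\<in>Is. \<bar>w (r k) I - nustar I\<bar> \<le> \<epsilon> \<and> norm (l (r k) I - weight_star I) \<le> \<epsilon>"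
    by blast
  then show False using far[of "r k"] by (auto simp: l_def split: if_splits)
qed

section \<open>Rounded allocations and the limit of the budget problem\<close>

definition floor_star :: "real \<Rightarrow> 'k set \<Rightarrow> nat" where
  "floor_star t I = nat \<lfloor>t * nustar I\<rfloor>"

lemma nustar_outside: "I \<notin> Is \<Longrightarrow> nustar I = 0"
  using nustar_budget by (simp add: budget_def)

lemma nustar_ge0: "0 \<le> nustar I"
  using nustar_nonneg nustar_outside by (cases "I \<in> Is") auto

lemma floor_star_bounds:
  assumes "0 < t"
  shows "real (floor_star t I) \<le> t * nustar I" "t * nustar I - 1 \<le> real (floor_star t I)"
  using assms nustar_ge0[of I] unfolding floor_star_def by (auto simp: of_nat_nat)

lemma floor_star_pos: "0 < floor_star t I \<Longrightarrow> 0 < nustar I"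
  using nustar_ge0[of I] by (cases "nustar I = 0") (auto simp: floor_star_def)

lemma floor_star_tendsto: "((\<lambda>t. real (floor_star t I) / t) \<longlongrightarrow> nustar I) at_top"
proof (rule tendsto_sandwich)
  show "\<forall>\<^sub>F t in at_top. nustar I - 1 / t \<le> real (floor_star t I) / t"
    using eventually_gt_at_top[of 0]
  proof eventually_elim
    case (elim t)
    have "(t * nustar I - 1) / t \<le> real (floor_star t I) / t"
      by (intro divide_right_mono floor_star_bounds(2)) (use elim in auto)
    then show ?case using elim by (simp add: diff_divide_distrib)
  qed
  show "\<forall>\<^sub>F t in at_top. real (floor_star t I) / t \<le> nustar I"
    using eventually_gt_at_top[of 0]
  proof eventually_elim
    case (elim t)
    then show ?case using floor_star_bounds(1)[OF elim, of I] by (simp add: field_simps)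
  qed
  have "((\<lambda>t. nustar I - 1 / t) \<longlongrightarrow> nustar I - 0) at_top"
    by (intro tendsto_diff tendsto_const tendsto_divide_0[OF tendsto_const] filterlim_at_top_imp_at_infinity filterlim_ident)
  then show "((\<lambda>t. nustar I - 1 / t) \<longlongrightarrow> nustar I) at_top" by simp
qed simp

text \<open>Rounding down is safe because all costs are nonnegative.\<close>

lemma floor_star_budget:
  assumes t: "0 < t"
  shows "budget Is c B0 (\<lambda>I. real (floor_star t I) / t)"
  unfolding budget_def
proof (intro conjI allI impI ballI)
  show "real (floor_star t I) / t = 0" if "I \<notin> Is" for I
    using that by (simp add: floor_star_def nustar_outside)
  show "0 \<le> real (floor_star t I) / t" for I using t by simp
  fix i
  have "(\<Sum>I\<in>Is. real (floor_star t I) / t * c I $ i) \<le> (\<Sum>I\<in>Is. nustar I * c I $ i)"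
    using t floor_star_bounds(1)[OF t] c_nonneg by (intro sum_mono mult_right_mono) (auto simp: field_simps)
  also have "\<dots> \<le> B0 $ i" using nustar_budget by (simp add: budget_def)
  finally show "(\<Sum>I\<in>Is. real (floor_star t I) / t * c I $ i) \<le> B0 $ i" .
qed

lemma floor_star_feas: "\<forall>\<^sub>F t in at_top. weights_for Is a (\<lambda>I. real (floor_star t I)) weight_star"
proof -
  have "\<forall>\<^sub>F t in at_top. 0 < nustar I \<longrightarrow> 0 < floor_star t I" for I
  proof (cases "0 < nustar I")
    case True
    have "\<forall>\<^sub>F t in at_top. 0 < real (floor_star t I) / t"
      by (rule order_tendstoD(1)[OF floor_star_tendsto True])
    with eventually_gt_at_top[of 0] show ?thesis
      by eventually_elim (auto simp: zero_less_divide_iff)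
  qed simp
  then have "\<forall>\<^sub>F t in at_top. \<forall>I\<in>Is. 0 < nustar I \<longrightarrow> 0 < floor_star t I"
    by (intro eventually_ball_finite) auto
  then show ?thesis
    using eventually_gt_at_top[of 0]
  proof eventually_elim
    case (elim t)
    have "{I\<in>Is. 0 < real (floor_star t I)} = {I\<in>Is. 0 < nustar I}"
      using elim floor_star_pos by auto
    then show ?case using weight_star_feas unfolding weights_for_def by simp
  qed
qed

lemma floor_star_obj: "((\<lambda>t. weight_cost Is Sigma (\<lambda>I. real (floor_star t I) / t) weight_star) \<longlongrightarrow> Vstar) at_top"
proof -
  have "((\<lambda>t. \<Sum>I\<in>{I\<in>Is. 0 < nustar I}. (1 / (real (floor_star t I) / t)) * (weight_star I \<bullet> (Sigma *v weight_star I)))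
      \<longlongrightarrow> weight_cost Is Sigma nustar weight_star) at_top"
    unfolding weight_cost_def by (intro tendsto_intros floor_star_tendsto) auto
  then show ?thesis unfolding weight_star_obj
  proof (rule Lim_transform_eventually)
    show "\<forall>\<^sub>F t in at_top. (\<Sum>I\<in>{I\<in>Is. 0 < nustar I}. (1 / (real (floor_star t I) / t)) * (weight_star I \<bullet> (Sigma *v weight_star I)))
      = weight_cost Is Sigma (\<lambda>I. real (floor_star t I) / t) weight_star"
      using eventually_gt_at_top[of 0]
    proof eventually_elim
      case (elim t)
      show ?case unfolding weight_cost_def
      proof (rule sum.mono_neutral_right)
        show "{I \<in> Is. 0 < real (floor_star t I) / t} \<subseteq> {I \<in> Is. 0 < nustar I}"
          using elim floor_star_pos by (auto simp: zero_less_divide_iff)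
      qed (use elim in \<open>auto simp: zero_less_divide_iff\<close>)
    qed
  qed
qed

lemma Vstar_le_var:
  assumes t: "0 < t" and n: "alloc_feasible Is c (t *\<^sub>R B0) n" and s: "supp a \<subseteq> \<Union>{I\<in>Is. 0 < n I}"
  shows "Vstar \<le> t * var_obj Is Sigma a (\<lambda>I. real (n I))"
proof -
  have n0: "0 \<le> real (n I)" for I by simp
  have s': "supp a \<subseteq> \<Union>{I\<in>Is. 0 < real (n I)}" using s by simp
  obtain y where y: "weights_for Is a (\<lambda>I. real (n I)) (\<lambda>I. real (n I) *\<^sub>R (subinv Sigma I *v y))"
    "weight_cost Is Sigma (\<lambda>I. real (n I)) (\<lambda>I. real (n I) *\<^sub>R (subinv Sigma I *v y)) = var_obj Is Sigma a (\<lambda>I. real (n I))"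
    by (rule optimal_weights[OF sym pd n0 s'])
  have b: "budget Is c B0 (\<lambda>I. real (n I) / t)" using n alloc_feasible_budget[OF t] by blast
  have f: "weights_for Is a (\<lambda>I. real (n I) / t) (\<lambda>I. real (n I) *\<^sub>R (subinv Sigma I *v y))"
    by (rule iffD2[OF weights_for_scale[OF t] y(1)])
  have "Vstar \<le> var_obj Is Sigma a (\<lambda>I. real (n I) / t)" by (rule Vstar_le[OF b weights_for_supp[OF f]])
  also have "\<dots> \<le> weight_cost Is Sigma (\<lambda>I. real (n I) / t) (\<lambda>I. real (n I) *\<^sub>R (subinv Sigma I *v y))"
    by (rule var_obj_le_weight_cost[OF sym pd _ f]) (use t in simp)
  finally show ?thesis unfolding weight_cost_scale[OF t] y(2) .
qed

text \<open>Dividing an integer allocation by \<open>t\<close> makes it feasible for the continuous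
  problem, which gives the lower bound for every positive \<open>t\<close>; the rounded optimum with
  the fixed weights \<open>weight_star\<close> gives the upper bound.\<close>

lemma V_budget_tendsto: "((\<lambda>t. t * V_budget Is c Sigma a (t *\<^sub>R B0)) \<longlongrightarrow> Vstar) at_top"
proof (rule tendsto_sandwich[OF _ _ tendsto_const floor_star_obj])
  let ?X = "\<lambda>t. {var_obj Is Sigma a (\<lambda>I. real (n I)) | n.
      alloc_feasible Is c (t *\<^sub>R B0) n \<and> supp a \<subseteq> \<Union>{I\<in>Is. 0 < n I}}"
  have lower: "Vstar / t \<le> x" if "0 < t" "x \<in> ?X t" for t x
    using that Vstar_le_var[OF that(1)] by (auto simp: divide_le_eq mult.commute)
  have mem: "\<forall>\<^sub>F t in at_top. 0 < t \<and> var_obj Is Sigma a (\<lambda>I. real (floor_star t I)) \<in> ?X t \<and>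
      weights_for Is a (\<lambda>I. real (floor_star t I)) weight_star"
    using floor_star_feas eventually_gt_at_top[of 0]
  proof eventually_elim
    case (elim t)
    have "alloc_feasible Is c (t *\<^sub>R B0) (floor_star t)"
      using floor_star_budget[OF elim(2)] alloc_feasible_budget[OF elim(2)] by blast
    then show ?case using elim weights_for_supp[OF elim(1)] by auto
  qed
  show "\<forall>\<^sub>F t in at_top. Vstar \<le> t * V_budget Is c Sigma a (t *\<^sub>R B0)"
    using mem
  proof eventually_elim
    case (elim t)
    have "Vstar / t \<le> V_budget Is c Sigma a (t *\<^sub>R B0)"
      unfolding V_budget_def by (rule cInf_greatest) (use elim lower in blast)+
    then show ?case using elim by (simp add: field_simps)
  qed
  show "\<forall>\<^sub>F t in at_top. t * V_budget Is c Sigma a (t *\<^sub>R B0) \<le> weight_cost Is Sigma (\<lambda>I. real (floor_star t I) / t) weight_star"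
    using mem
  proof eventually_elim
    case (elim t)
    have "V_budget Is c Sigma a (t *\<^sub>R B0) \<le> var_obj Is Sigma a (\<lambda>I. real (floor_star t I))"
      unfolding V_budget_def
    proof (rule cInf_lower)
      show "bdd_below (?X t)" using lower elim by (intro bdd_belowI[of _ "Vstar / t"]) blast
    qed (use elim in blast)
    also have "\<dots> \<le> weight_cost Is Sigma (\<lambda>I. real (floor_star t I)) weight_star"
      by (rule var_obj_le_weight_cost[OF sym pd]) (use elim in auto)
    finally show ?case using elim by (simp add: weight_cost_scale mult_left_mono)
  qed
qed

section \<open>Existence, near optimality and stability of plug-in minimizers\<close>

lemma est_minimizer_exists:
  assumes \<delta>: "\<delta> < \<kappa>" 
  shows "\<forall>\<^sub>F t in at_top. \<forall>S. close \<delta> S \<longrightarrow> (\<exists>n lam. est_minimizer Is c (t *\<^sub>R B0) S a n lam)"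
  using floor_star_feas eventually_gt_at_top[of 0]
proof (eventually_elim, intro allI impI)
  fix t :: real and S assume feas: "weights_for Is a (\<lambda>I. real (floor_star t I)) weight_star" and t: "0 < t" and S: "close \<delta> S"
  have pdS: "pos_def_on UNIV S" by (rule close_pd[OF S \<delta>])
  have symS: "transpose S = S" using S by blast
  \<comment> \<open>The budget leaves finitely many allocations, and for each the best weights are
    explicit, so a finite search finds a minimizer. This is what activates the hypothesis on the
    plug-in pair, which speaks only of instances that have a minimizer.\<close>
  let ?F = "{n. alloc_feasible Is c (t *\<^sub>R B0) n \<and> supp a \<subseteq> \<Union>{I\<in>Is. 0 < real (n I)}}"
  have "?F \<subseteq> {n. \<forall>I. (I \<in> Is \<longrightarrow> n I \<in> {..nat \<lceil>t * budget_max\<rceil>}) \<and> (I \<notin> Is \<longrightarrow> n I = 0)}"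
  proof (intro subsetI CollectI allI conjI impI)
    fix n I assume n: "n \<in> ?F"
    then have b: "budget Is c B0 (\<lambda>I. real (n I) / t)" using alloc_feasible_budget[OF t] by blast
    show "n I \<in> {..nat \<lceil>t * budget_max\<rceil>}" if "I \<in> Is"
    proof -
      have "real (n I) \<le> t * budget_max" using budget_le[OF b that] t by (simp add: field_simps)
      then show ?thesis by (simp add: le_nat_iff) linarith
    qed
    show "n I = 0" if "I \<notin> Is" using n that by (simp add: alloc_feasible_def)
  qed
  moreover have "finite \<dots>" by (rule finite_set_of_finite_funs) auto
  ultimately have fin: "finite ?F" by (rule finite_subset)
  have "floor_star t \<in> ?F"
    using floor_star_budget[OF t] alloc_feasible_budget[OF t] weights_for_supp[OF feas] by auto
  then have ne: "?F \<noteq> {}" by blast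
  define n where "n = arg_min_on (\<lambda>n. var_obj Is S a (\<lambda>I. real (n I))) ?F"
  have n: "n \<in> ?F"
    unfolding n_def by (rule arg_min_if_finite(1)[OF fin ne])
  have n_min: "var_obj Is S a (\<lambda>I. real (n I)) \<le> var_obj Is S a (\<lambda>I. real (n' I))" if "n' \<in> ?F" for n'
    unfolding n_def by (rule arg_min_least[OF fin ne that])
  have n0: "0 \<le> real (n I)" for I by simp
  have s': "supp a \<subseteq> \<Union>{I\<in>Is. 0 < real (n I)}" using n by blast
  obtain y where y: "weights_for Is a (\<lambda>I. real (n I)) (\<lambda>I. real (n I) *\<^sub>R (subinv S I *v y))"
    "weight_cost Is S (\<lambda>I. real (n I)) (\<lambda>I. real (n I) *\<^sub>R (subinv S I *v y)) = var_obj Is S a (\<lambda>I. real (n I))"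
    by (rule optimal_weights[OF symS pdS n0 s'])
  have "est_minimizer Is c (t *\<^sub>R B0) S a n (\<lambda>I. real (n I) *\<^sub>R (subinv S I *v y))"
    unfolding est_minimizer_def weights_feasible_weights_for est_obj_eq_weight_cost
  proof (intro conjI allI impI)
    show "alloc_feasible Is c (t *\<^sub>R B0) n" using n by blast
    show "weights_for Is a (\<lambda>I. real (n I)) (\<lambda>I. real (n I) *\<^sub>R (subinv S I *v y))" by (rule y(1))
    fix n' lam' assume n': "alloc_feasible Is c (t *\<^sub>R B0) n' \<and> weights_for Is a (\<lambda>I. real (n' I)) lam'"
    then have "n' \<in> ?F" using weights_for_supp by blast
    then have "var_obj Is S a (\<lambda>I. real (n I)) \<le> var_obj Is S a (\<lambda>I. real (n' I))" by (rule n_min)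
    also have "\<dots> \<le> weight_cost Is S (\<lambda>I. real (n' I)) lam'"
      by (rule var_obj_le_weight_cost[OF symS pdS]) (use n' in auto)
    finally show "weight_cost Is S (\<lambda>I. real (n I)) (\<lambda>I. real (n I) *\<^sub>R (subinv S I *v y))
        \<le> weight_cost Is S (\<lambda>I. real (n' I)) lam'" unfolding y(2) .
  qed
  then show "\<exists>n lam. est_minimizer Is c (t *\<^sub>R B0) S a n lam" by blast
qed

lemma est_near_optimal:
  assumes \<eta>: "0 < \<eta>"
  shows "\<exists>\<delta>>0. \<forall>\<^sub>F t in at_top. \<forall>S n lam. close \<delta> S \<longrightarrow> est_minimizer Is c (t *\<^sub>R B0) S a n lam \<longrightarrow>
    weight_cost Is Sigma (\<lambda>I. real (n I) / t) lam \<le> Vstar + \<eta>"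
proof -
  \<comment> \<open>Passing from \<open>Sigma\<close> to \<open>S\<close> for the rounded optimum
    costs the factor \<open>1 + \<theta>\<close>, passing back for the minimizer costs
    \<open>1 / (1 - \<theta>)\<close>, and rounding costs the added \<open>\<theta>\<close>; for
    small \<open>\<theta>\<close> the total stays below \<open>Vstar + \<eta>\<close>.\<close>
  have "((\<lambda>\<theta>. (1 + \<theta>) * (Vstar + \<theta>) / (1 - \<theta>)) \<longlongrightarrow> (1 + 0) * (Vstar + 0) / (1 - 0)) (at_right 0)"
    by (intro tendsto_intros) auto
  then have "\<forall>\<^sub>F \<theta> in at_right 0. (1 + \<theta>) * (Vstar + \<theta>) / (1 - \<theta>) < Vstar + \<eta>"
    using \<eta> by (intro order_tendstoD(2)) auto
  moreover have "\<forall>\<^sub>F \<theta> in at_right 0. (0::real) < \<theta> \<and> \<theta> < 1"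
    using eventually_at_right_real[of 0 1] by (auto elim: eventually_mono)
  ultimately have "\<forall>\<^sub>F \<theta> in at_right 0. (1 + \<theta>) * (Vstar + \<theta>) / (1 - \<theta>) < Vstar + \<eta> \<and> 0 < \<theta> \<and> \<theta> < 1"
    by eventually_elim auto
  from eventually_happens[OF this] obtain \<theta> where \<theta>: "(1 + \<theta>) * (Vstar + \<theta>) / (1 - \<theta>) < Vstar + \<eta>" "0 < \<theta>" "\<theta> < 1"
    by (auto simp: trivial_limit_at_right_real)
  have "\<forall>\<^sub>F t in at_top. weight_cost Is Sigma (\<lambda>I. real (floor_star t I) / t) weight_star < Vstar + \<theta>"
    by (rule order_tendstoD(2)[OF floor_star_obj]) (use \<theta> in simp)
  then have "\<forall>\<^sub>F t in at_top. \<forall>S n lam. close (\<theta> * \<kappa>) S \<longrightarrow> est_minimizer Is c (t *\<^sub>R B0) S a n lam \<longrightarrow>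
    weight_cost Is Sigma (\<lambda>I. real (n I) / t) lam \<le> Vstar + \<eta>"
    using floor_star_feas eventually_gt_at_top[of 0]
  proof (eventually_elim, intro allI impI)
    fix t S n lam assume o: "weight_cost Is Sigma (\<lambda>I. real (floor_star t I) / t) weight_star < Vstar + \<theta>"
      and f: "weights_for Is a (\<lambda>I. real (floor_star t I)) weight_star" and t: "0 < t"
      and S: "close (\<theta> * \<kappa>) S" and m: "est_minimizer Is c (t *\<^sub>R B0) S a n lam"
    have \<theta>0: "0 \<le> \<theta>" using \<theta> by simp
    have "alloc_feasible Is c (t *\<^sub>R B0) (floor_star t)"
      using floor_star_budget[OF t] alloc_feasible_budget[OF t] by blast
    with m f have "weight_cost Is S (\<lambda>I. real (n I)) lam \<le> weight_cost Is S (\<lambda>I. real (floor_star t I)) weight_star"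
      unfolding est_minimizer_def weights_feasible_weights_for est_obj_eq_weight_cost by blast
    then have "weight_cost Is S (\<lambda>I. real (n I) / t) lam \<le> weight_cost Is S (\<lambda>I. real (floor_star t I) / t) weight_star"
      unfolding weight_cost_scale[OF t] using t by (intro mult_left_mono) auto
    also have "\<dots> \<le> (1 + \<theta>) * weight_cost Is Sigma (\<lambda>I. real (floor_star t I) / t) weight_star"
      by (rule close_weight_cost(2)[OF S \<theta>0])
    also have "\<dots> \<le> (1 + \<theta>) * (Vstar + \<theta>)" using o \<theta> by (intro mult_left_mono) auto
    finally have "(1 - \<theta>) * weight_cost Is Sigma (\<lambda>I. real (n I) / t) lam \<le> (1 + \<theta>) * (Vstar + \<theta>)"
      using close_weight_cost(1)[OF S \<theta>0, of "\<lambda>I. real (n I) / t" lam] by linarith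
    then have "weight_cost Is Sigma (\<lambda>I. real (n I) / t) lam \<le> (1 + \<theta>) * (Vstar + \<theta>) / (1 - \<theta>)"
      using \<theta> by (simp add: field_simps)
    then show "weight_cost Is Sigma (\<lambda>I. real (n I) / t) lam \<le> Vstar + \<eta>" using \<theta> by linarith
  qed
  then show ?thesis using \<theta> \<kappa>(1) by (intro exI[of _ "\<theta> * \<kappa>"]) auto
qed

text \<open>The constant \<open>C\<close> is fixed before \<open>\<epsilon>\<close>, since it
  multiplies an error that is made small by a later choice of \<open>\<epsilon>\<close>. Where
  \<open>nustar I = 0\<close> the ratio is only bounded: it is a quotient of two quantities that
  both tend to zero.\<close>

lemma stability:
  obtains C where "0 \<le> C"
    and "\<forall>\<epsilon>. 0 < \<epsilon> \<longrightarrow> \<epsilon> \<le> 1 \<longrightarrow> (\<exists>\<delta>>0. \<forall>\<^sub>F t in at_top. \<forall>S n lam.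
      close \<delta> S \<longrightarrow> est_minimizer Is c (t *\<^sub>R B0) S a n lam \<longrightarrow>
      (\<forall>I\<in>Is. \<bar>real (n I) - t * nustar I\<bar> \<le> \<epsilon> * t \<and>
        (0 < n I \<longrightarrow> norm ((t / real (n I)) *\<^sub>R lam I - ratio_star I) \<le> (if 0 < nustar I then \<epsilon> else C))))"
proof -
  \<comment> \<open>The smallest positive optimal size; the inserted 1 makes the set visibly
    nonempty.\<close>
  define m where "m = Min (insert 1 (nustar ` {I\<in>Is. 0 < nustar I}))"
  have m0: "0 < m" unfolding m_def by (subst Min_gr_iff) auto
  have m: "m \<le> nustar I" if "I \<in> Is" "0 < nustar I" for I
    unfolding m_def using that by (intro Min_le) auto
  define G where "G = (\<Sum>I\<in>Is. norm (ratio_star I))"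
  have G: "norm (ratio_star I) \<le> G" if "I \<in> Is" for I
    unfolding G_def using that by (intro member_le_sum) auto
  have G0: "0 \<le> G" by (simp add: G_def sum_nonneg)
  define K where "K = onorm (\<lambda>x. Sigma *v x) + 1"
  have K0: "0 \<le> K" unfolding K_def
    using onorm_pos_le[OF matrix_vector_mul_bounded_linear[of Sigma]] by simp
  have KS: "norm (S *v x) \<le> K * norm x" if "close 1 S" for S x
  proof -
    have "norm (Sigma *v x) \<le> onorm (\<lambda>x. Sigma *v x) * norm x"
      by (rule onorm) (rule matrix_vector_mul_bounded_linear)
    moreover have "norm (S *v x) \<le> norm (Sigma *v x) + norm (S *v x - Sigma *v x)"
      by (rule norm_triangle_sub)
    ultimately show ?thesis using close_norm[OF that, of x] by (simp add: K_def algebra_simps)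
  qed
  \<comment> \<open>On \<open>C0\<close> the rescaled dual vector is read off from \<open>S\<close>
    applied to ratios of norm at most \<open>G + 1\<close>, hence the bound \<open>D\<close>.
    \<open>R\<close> and \<open>E\<close> come from \<open>dual_bound\<close> with the coercivity
    constant \<open>\<kappa> / 2\<close>, which survives perturbations of size up to
    \<open>\<kappa> / 2\<close>.\<close>
  define C0 where "C0 = \<Union>{I\<in>Is. 0 < nustar I}"
  define D where "D = K * (G + 1)"
  define R where "R = 1 + K\<^sup>2 / (\<kappa> / 2) * (card Is * (CARD('k) / (\<kappa> / 2)))"
  define E where "E = D * R ^ card (- C0)"
  define C where "C = CARD('k) * E / (\<kappa> / 2)"
  have D0: "0 \<le> D" using K0 G0 by (simp add: D_def)
  have "0 \<le> R" using \<kappa>(1) by (simp add: R_def)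
  then have E0: "0 \<le> E" using D0 by (simp add: E_def)
  have C_pos: "0 \<le> C" using E0 \<kappa>(1) by (simp add: C_def)
  show thesis
  proof (rule that[OF C_pos], intro allI impI)
    fix \<epsilon> :: real assume \<epsilon>: "0 < \<epsilon>" "\<epsilon> \<le> 1"
    \<comment> \<open>The first entry keeps the sizes above \<open>m / 2\<close> on the optimal
      sets, the second makes the error of the ratio at most \<open>\<epsilon>\<close>, the third
      bounds the error of the sizes.\<close>
    define e where "e = min (m / 2) (min (\<epsilon> * m / (2 * (1 + G))) \<epsilon>)"
    have e: "0 < e" "e \<le> m / 2" "e \<le> \<epsilon>" "e \<le> \<epsilon> * m / (2 * (1 + G))"
    proof -
      show "0 < e" using \<epsilon> m0 G0 by (simp add: e_def)
    qed (unfold e_def, linarith+)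
    have eG: "e * (1 + G) \<le> \<epsilon> * (m / 2)"
      using e(4) G0 by (simp add: field_simps)
    obtain \<eta> where \<eta>: "0 < \<eta>" "\<And>w lam I. budget Is c B0 w \<Longrightarrow> weights_for Is a w lam \<Longrightarrow> weight_cost Is Sigma w lam \<le> Vstar + \<eta> \<Longrightarrow>
        I \<in> Is \<Longrightarrow> \<bar>w I - nustar I\<bar> \<le> e \<and> (0 < w I \<longrightarrow> norm (lam I - weight_star I) \<le> e)"
      using near_minimizer[OF e(1)] by blast
    obtain \<delta>1 where \<delta>1: "0 < \<delta>1" "\<forall>\<^sub>F t in at_top. \<forall>S n lam. close \<delta>1 S \<longrightarrow> est_minimizer Is c (t *\<^sub>R B0) S a n lam \<longrightarrow>
      weight_cost Is Sigma (\<lambda>I. real (n I) / t) lam \<le> Vstar + \<eta>"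
      using est_near_optimal[OF \<eta>(1)] by blast
    define \<delta> where "\<delta> = min \<delta>1 (min (\<kappa> / 2) 1)"
    have \<delta>: "0 < \<delta>" "\<delta> \<le> \<delta>1" "\<delta> \<le> \<kappa> / 2" "\<delta> \<le> 1" using \<delta>1(1) \<kappa>(1) by (auto simp: \<delta>_def)
    have "\<forall>\<^sub>F t in at_top. \<forall>S n lam.
      close \<delta> S \<longrightarrow> est_minimizer Is c (t *\<^sub>R B0) S a n lam \<longrightarrow>
      (\<forall>I\<in>Is. \<bar>real (n I) - t * nustar I\<bar> \<le> \<epsilon> * t \<and>
        (0 < n I \<longrightarrow> norm ((t / real (n I)) *\<^sub>R lam I - ratio_star I) \<le> (if 0 < nustar I then \<epsilon> else C)))"
      using \<delta>1(2) eventually_gt_at_top[of 0]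
    proof (eventually_elim, intro allI impI)
      fix t S n lam
      assume near: "\<forall>S n lam. close \<delta>1 S \<longrightarrow> est_minimizer Is c (t *\<^sub>R B0) S a n lam \<longrightarrow>
          weight_cost Is Sigma (\<lambda>I. real (n I) / t) lam \<le> Vstar + \<eta>"
        and t: "0 < t" and S: "close \<delta> S" and min: "est_minimizer Is c (t *\<^sub>R B0) S a n lam"
      have S1: "close \<delta>1 S" "close 1 S" and symS: "transpose S = S" using S \<delta> by auto
      have coer: "\<kappa> / 2 * (norm x)\<^sup>2 \<le> x \<bullet> (S *v x)" for x
      proof -
        have "\<kappa> / 2 * (norm x)\<^sup>2 \<le> (\<kappa> - \<delta>) * (norm x)\<^sup>2" using \<delta> by (intro mult_right_mono) auto
        with close_coercive[OF S, of x] show ?thesis by linarith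
      qed
      have pdS: "pos_def_on UNIV S" by (rule close_pd[OF S]) (use \<delta> \<kappa>(1) in linarith)
      have pdI: "pos_def_on I S" for I using pos_def_on_mono[OF pdS] by simp
      define w where "w I = real (n I) / t" for I
      have w0: "0 \<le> w I" for I using t by (simp add: w_def)
      have wpos: "0 < w I \<longleftrightarrow> 0 < n I" for I using t by (simp add: w_def zero_less_divide_iff)
      have feas: "weights_for Is a (\<lambda>I. real (n I)) lam" and alloc: "alloc_feasible Is c (t *\<^sub>R B0) n"
        and opt: "\<And>lam'. weights_for Is a (\<lambda>I. real (n I)) lam' \<Longrightarrow>
          weight_cost Is S (\<lambda>I. real (n I)) lam \<le> weight_cost Is S (\<lambda>I. real (n I)) lam'"
        using min unfolding est_minimizer_def weights_feasible_weights_for est_obj_eq_weight_cost by blast+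
      have bw: "budget Is c B0 w" using alloc alloc_feasible_budget[OF t] unfolding w_def by blast
      have fw: "weights_for Is a w lam" unfolding w_def by (rule iffD2[OF weights_for_scale[OF t] feas])
      have ow: "weight_cost Is Sigma w lam \<le> Vstar + \<eta>" unfolding w_def using near S1(1) min by blast
      have close_w: "\<bar>w I - nustar I\<bar> \<le> e" if "I \<in> Is" for I
        using \<eta>(2)[OF bw fw ow that] by blast
      have close_l: "norm (lam I - weight_star I) \<le> e" if "I \<in> Is" "0 < n I" for I
        using \<eta>(2)[OF bw fw ow that(1)] that(2) wpos by blast
      have gam: "(t / real (n I)) *\<^sub>R lam I = (1 / w I) *\<^sub>R lam I" for I by (simp add: w_def)
      have big: "m / 2 \<le> w I" "0 < n I" if "I \<in> Is" "0 < nustar I" for I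
      proof -
        show "m / 2 \<le> w I" using close_w[OF that(1)] m[OF that] e(2) by (simp add: abs_le_iff)
        then have "0 < w I" using m0 by linarith
        then show "0 < n I" using wpos by blast
      qed
      have main: "norm ((t / real (n I)) *\<^sub>R lam I - ratio_star I) \<le> \<epsilon>" if I: "I \<in> Is" "0 < nustar I" for I
      proof -
        have wI: "0 < w I" using big[OF I] wpos by blast
        \<comment> \<open>The error of a quotient is split into the error of the weight and the
          error of the size, both divided by a size of at least \<open>m / 2\<close>.\<close>
        have "(1 / w I) *\<^sub>R lam I - ratio_star I = (1 / w I) *\<^sub>R ((lam I - weight_star I) + (nustar I - w I) *\<^sub>R ratio_star I)"
          using wI by (simp add: weight_star_def algebra_simps)
        then have "norm ((1 / w I) *\<^sub>R lam I - ratio_star I)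
            = norm ((lam I - weight_star I) + (nustar I - w I) *\<^sub>R ratio_star I) / w I"
          using wI by simp
        also have "\<dots> \<le> (e + e * G) / w I"
        proof (rule divide_right_mono)
          have "norm ((lam I - weight_star I) + (nustar I - w I) *\<^sub>R ratio_star I)
            \<le> norm (lam I - weight_star I) + \<bar>nustar I - w I\<bar> * norm (ratio_star I)"
            using norm_triangle_ineq[of "lam I - weight_star I" "(nustar I - w I) *\<^sub>R ratio_star I"] by simp
          also have "\<dots> \<le> e + e * G"
            using close_l[OF I(1) big(2)[OF I]] close_w[OF I(1)] G[OF I(1)] e(1)
            by (intro add_mono mult_mono) (auto simp: abs_minus_commute)
          finally show "norm ((lam I - weight_star I) + (nustar I - w I) *\<^sub>R ratio_star I) \<le> e + e * G" .
        qed (use wI in simp)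
        also have "\<dots> \<le> \<epsilon>"
        proof -
          have "e + e * G \<le> \<epsilon> * (m / 2)" using eG by (simp add: algebra_simps)
          also have "\<dots> \<le> \<epsilon> * w I" using big(1)[OF I] \<epsilon> by (intro mult_left_mono) auto
          finally show ?thesis using wI by (simp add: divide_le_eq)
        qed
        finally show ?thesis unfolding gam .
      qed
      have n0: "0 \<le> real (n I)" for I by simp
      obtain y where y: "weights_for Is a (\<lambda>I. real (n I)) (\<lambda>I. real (n I) *\<^sub>R (subinv S I *v y))"
        "weight_cost Is S (\<lambda>I. real (n I)) (\<lambda>I. real (n I) *\<^sub>R (subinv S I *v y)) = var_obj Is S a (\<lambda>I. real (n I))"
        by (rule optimal_weights[OF symS pdS n0 weights_for_supp[OF feas]])
      \<comment> \<open>The plug-in weights are optimal for their own sizes, so by the decomposition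
        they coincide with the dual form on all used sets.\<close>
      have "weight_cost Is S (\<lambda>I. real (n I)) (\<lambda>I. lam I - real (n I) *\<^sub>R (subinv S I *v y)) = 0"
        using weight_cost_decomp[OF symS pdS feas y(1)] opt[OF y(1)]
          weight_cost_nonneg[OF pdS, of Is "\<lambda>I. real (n I)" "\<lambda>I. lam I - real (n I) *\<^sub>R (subinv S I *v y)"] by linarith
      from weight_cost_eq_0D[OF pdS this]
      have lam: "lam I = real (n I) *\<^sub>R (subinv S I *v y)" if "I \<in> Is" "0 < n I" for I
        using that by simp
      have gamy: "(t / real (n I)) *\<^sub>R lam I = subinv S I *v (t *\<^sub>R y)" if "I \<in> Is" "0 < n I" for I
        using lam[OF that] that by (simp add: matrix_vector_mult_scaleR)
      have eq: "(\<Sum>I\<in>{I\<in>Is. 0 < w I}. w I *\<^sub>R (subinv S I *v (t *\<^sub>R y))) = a"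
      proof -
        have "w I *\<^sub>R (subinv S I *v (t *\<^sub>R y)) = real (n I) *\<^sub>R (subinv S I *v y)" for I
          using t by (simp add: matrix_vector_mult_scaleR w_def)
        then show ?thesis using y(1) wpos by (simp add: weights_for_def)
      qed
      \<comment> \<open>With sizes divided by \<open>t\<close>, the dual vector becomes
        \<open>t *\<^sub>R y\<close>, and \<open>dual_bound\<close> bounds it independently of
        \<open>t\<close>.\<close>
      have dual: "\<bar>(t *\<^sub>R y) $ i\<bar> \<le> E" if i: "i \<in> \<Union>{I\<in>Is. 0 < w I}" for i
        unfolding E_def
      proof (rule dual_bound[OF symS _ coer K0 KS[OF S1(2)] w0 eq _ _ D0 R_def i])
        show "0 < \<kappa> / 2" using \<kappa>(1) by simp
        show "supp a \<subseteq> C0" unfolding C0_def by (rule nustar_supp)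
        fix j assume "j \<in> C0"
        then obtain I where I: "I \<in> Is" "0 < nustar I" "j \<in> I" by (auto simp: C0_def)
        let ?h = "subinv S I *v (t *\<^sub>R y)"
        have "\<bar>(t *\<^sub>R y) $ j\<bar> = \<bar>(S *v ?h) $ j\<bar>" using mult_subinv[OF symS pdI I(3)] by simp
        also have "\<dots> \<le> norm (S *v ?h)" by (rule component_le_norm_cart)
        also have "\<dots> \<le> K * norm ?h" by (rule KS[OF S1(2)])
        also have "\<dots> \<le> K * (G + 1)"
        proof (rule mult_left_mono[OF _ K0])
          have "norm ?h \<le> norm (ratio_star I) + norm (?h - ratio_star I)" by (rule norm_triangle_sub)
          then show "norm ?h \<le> G + 1"
            using main[OF I(1,2)] G[OF I(1)] \<epsilon>(2) unfolding gamy[OF I(1) big(2)[OF I(1,2)]] by linarith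
        qed
        finally show "\<bar>(t *\<^sub>R y) $ j\<bar> \<le> D" by (simp add: D_def)
      qed
      show "\<forall>I\<in>Is. \<bar>real (n I) - t * nustar I\<bar> \<le> \<epsilon> * t \<and>
        (0 < n I \<longrightarrow> norm ((t / real (n I)) *\<^sub>R lam I - ratio_star I) \<le> (if 0 < nustar I then \<epsilon> else C))"
      proof (intro ballI conjI impI)
        fix I assume I: "I \<in> Is"
        have "\<bar>real (n I) - t * nustar I\<bar> = t * \<bar>w I - nustar I\<bar>"
          using t by (simp add: w_def abs_mult_pos' right_diff_distrib)
        also have "\<dots> \<le> t * \<epsilon>" using close_w[OF I] e(3) t by (intro mult_left_mono) auto
        finally show "\<bar>real (n I) - t * nustar I\<bar> \<le> \<epsilon> * t" by (simp add: mult.commute)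
        assume n: "0 < n I"
        show "norm ((t / real (n I)) *\<^sub>R lam I - ratio_star I) \<le> (if 0 < nustar I then \<epsilon> else C)"
        proof (cases "0 < nustar I")
          case True
          then show ?thesis using main[OF I] by simp
        next
          case False
          \<comment> \<open>The bound \<open>dual\<close> is available on the coordinates in
            \<open>I\<close>, hence the restriction \<open>?r\<close>; it loses nothing because
            \<open>?h\<close> is supported there.\<close>
          let ?h = "subinv S I *v (t *\<^sub>R y)" and ?r = "coord_restrict I (t *\<^sub>R y)"
          have supp: "supp ?h \<subseteq> I" by (rule supp_subinv_mult[OF symS pdI])
          have "\<kappa> / 2 * (norm ?h)\<^sup>2 \<le> ?h \<bullet> (S *v ?h)" by (rule coer)
          also have "\<dots> = ?h \<bullet> (t *\<^sub>R y)" by (rule inner_subinv[OF symS pdS supp])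
          also have "\<dots> = ?h \<bullet> ?r" by (rule inner_coord_restrict[OF supp, symmetric])
          also have "\<dots> \<le> norm ?h * norm ?r" by (rule norm_cauchy_schwarz)
          finally have "(\<kappa> / 2 * norm ?h) * norm ?h \<le> norm ?r * norm ?h"
            by (simp add: power2_eq_square mult_ac)
          then have 1: "\<kappa> / 2 * norm ?h \<le> norm ?r"
            by (cases "norm ?h = 0") (auto simp: mult_le_cancel_right)
          have "norm ?r \<le> (\<Sum>i\<in>UNIV. \<bar>?r $ i\<bar>)" by (rule norm_le_l1_cart)
          also have "\<dots> \<le> (\<Sum>i\<in>(UNIV::'k set). E)"
          proof (rule sum_mono)
            fix i
            show "\<bar>?r $ i\<bar> \<le> E"
              using dual[of i] I n wpos E0 by (cases "i \<in> I") (auto simp: coord_restrict_def)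
          qed
          also have "\<dots> = CARD('k) * E" by simp
          finally have "norm ?h \<le> C" using 1 \<kappa>(1) by (simp add: C_def field_simps)
          moreover have "ratio_star I = 0" using False by (simp add: ratio_star_def)
          ultimately show ?thesis using False gamy[OF I n] by simp
        qed
      qed
    qed
    then show "\<exists>\<delta>>0. \<forall>\<^sub>F t in at_top. \<forall>S n lam.
      close \<delta> S \<longrightarrow> est_minimizer Is c (t *\<^sub>R B0) S a n lam \<longrightarrow>
      (\<forall>I\<in>Is. \<bar>real (n I) - t * nustar I\<bar> \<le> \<epsilon> * t \<and>
        (0 < n I \<longrightarrow> norm ((t / real (n I)) *\<^sub>R lam I - ratio_star I) \<le> (if 0 < nustar I then \<epsilon> else C)))"
      using \<delta>(1) by blast
  qed
qed

end

section \<open>A maximal inequality and a central limit theorem\<close>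

text \<open>Used to extract from the independent array one row, shifted to the start of a window, as
  an independent sequence.\<close>

lemma (in prob_space) indep_vars_reindex:
  assumes indep: "indep_vars M' X (f ` I)" and inj: "inj_on f I"
  shows "indep_vars (\<lambda>i. M' (f i)) (\<lambda>i. X (f i)) I"
  unfolding indep_vars_def2
proof (intro conjI ballI)
  show "random_variable (M' (f i)) (X (f i))" if "i \<in> I" for i
    using indep that by (auto simp: indep_vars_def2)
  have F: "indep_sets (\<lambda>i. {X i -` A \<inter> space M |A. A \<in> sets (M' i)}) (f ` I)" (is "indep_sets ?F _")
    using indep by (auto simp: indep_vars_def2)
  show "indep_sets (\<lambda>i. {X (f i) -` A \<inter> space M |A. A \<in> sets (M' (f i))}) I"
  proof (rule indep_setsI)
    show "{X (f i) -` A \<inter> space M |A. A \<in> sets (M' (f i))} \<subseteq> events" if "i \<in> I" for i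
      using F that by (auto simp: indep_sets_def)
  next
    fix A J assume J: "J \<noteq> {}" "J \<subseteq> I" "finite J"
      and A: "\<forall>j\<in>J. A j \<in> {X (f j) -` A \<inter> space M |A. A \<in> sets (M' (f j))}"
    from J inj have injJ: "inj_on f J" by (blast intro: inj_on_subset)
    \<comment> \<open>Independence is available for finite subfamilies of the image, so the chosen
      events are transported along the inverse of \<open>f\<close>.\<close>
    let ?g = "the_inv_into J f"
    have "prob (\<Inter>i\<in>f ` J. A (?g i)) = (\<Prod>i\<in>f ` J. prob (A (?g i)))"
      by (rule indep_setsD[OF F]) (use J A injJ in \<open>auto simp: the_inv_into_f_f\<close>)
    then show "prob (\<Inter>j\<in>J. A j) = (\<Prod>j\<in>J. prob (A j))"
      using injJ by (simp add: prod.reindex the_inv_into_f_f cong: prod.cong)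
  qed
qed

text \<open>The partial sums of \<open>z\<close>, frozen from the first time their absolute value reaches \<open>x\<close>.  Each new
  increment is multiplied by a function of the earlier ones, which makes the cross terms in the
  second moment vanish.\<close>

fun stopped_sum :: "real \<Rightarrow> (nat \<Rightarrow> real) \<Rightarrow> nat \<Rightarrow> real" where
  "stopped_sum x z 0 = 0"
| "stopped_sum x z (Suc n) = stopped_sum x z n + (if \<bar>stopped_sum x z n\<bar> < x then z n else 0)"

lemma stopped_sum_cong: "(\<And>j. j < n \<Longrightarrow> y j = z j) \<Longrightarrow> stopped_sum x y n = stopped_sum x z n"
  by (induction n) auto

text \<open>Stated on the product over the first \<open>N\<close> indices, so that
  \<open>stopped_sum\<close> can be composed with a restricted family that is independent of the
  next increment.\<close>

lemma stopped_sum_measurable: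
  assumes "n \<le> N"
  shows "(\<lambda>z. stopped_sum x z n) \<in> borel_measurable (PiM {..<N} (\<lambda>_. borel))"
  using assms
proof (induction n)
  case (Suc n)
  have [measurable]: "(\<lambda>z. stopped_sum x z n) \<in> borel_measurable (PiM {..<N} (\<lambda>_. borel))"
    using Suc by simp
  have [measurable]: "(\<lambda>z. z n) \<in> borel_measurable (PiM {..<N} (\<lambda>_. borel :: real measure))"
    using Suc by (intro measurable_component_singleton) simp
  show ?case by simp
qed simp

lemma stopped_sum_eq:
  "(\<And>m. m \<le> n \<Longrightarrow> \<bar>\<Sum>j<m. z j\<bar> < x) \<Longrightarrow> stopped_sum x z n = (\<Sum>j<n. z j)"
proof (induction n)
  case (Suc n)
  have "stopped_sum x z n = (\<Sum>j<n. z j)" "\<bar>\<Sum>j<n. z j\<bar> < x"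
    using Suc.prems by (auto intro!: Suc.IH)
  then show ?case by simp
qed simp

lemma stopped_sum_stays: "x \<le> \<bar>stopped_sum x z m\<bar> \<Longrightarrow> m \<le> n \<Longrightarrow> x \<le> \<bar>stopped_sum x z n\<bar>"
  by (induction n) (auto simp: le_Suc_eq)

text \<open>At the first index where the partial sums reach \<open>x\<close> nothing has been frozen
  yet, so the stopped sum equals the partial sum there and keeps its value afterwards.\<close>

lemma stopped_sum_ge:
  assumes "m \<le> n" "x \<le> \<bar>\<Sum>j<m. z j\<bar>"
  shows "x \<le> \<bar>stopped_sum x z n\<bar>"
proof -
  define k where "k = (LEAST m. x \<le> \<bar>\<Sum>j<m. z j\<bar>)"
  have k: "x \<le> \<bar>\<Sum>j<k. z j\<bar>" "k \<le> m"
    unfolding k_def using assms(2) by (auto intro: LeastI Least_le)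
  have less: "\<bar>\<Sum>j<i. z j\<bar> < x" if "i < k" for i
    using not_less_Least[of i "\<lambda>m. x \<le> \<bar>\<Sum>j<m. z j\<bar>"] that unfolding k_def by auto
  have "x \<le> \<bar>stopped_sum x z k\<bar>"
  proof (cases k)
    case 0
    then show ?thesis using k by simp
  next
    case (Suc l)
    have "stopped_sum x z l = (\<Sum>j<l. z j)"
      by (rule stopped_sum_eq) (use less Suc in auto)
    moreover have "\<bar>\<Sum>j<l. z j\<bar> < x" using less Suc by simp
    ultimately show ?thesis using k Suc by simp
  qed
  with k(2) assms(1) show ?thesis by (metis stopped_sum_stays order_trans)
qed

text \<open>Freezing turns a maximum over time into an event about the last time, to which Markov's
  inequality for the square applies.\<close>

lemma (in prob_space) kolmogorov_maximal:
  fixes \<xi> :: "nat \<Rightarrow> 'a \<Rightarrow> real"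
  assumes indep: "indep_vars (\<lambda>_. borel) \<xi> UNIV"
    and mean: "\<And>j. expectation (\<xi> j) = 0"
    and sq: "\<And>j. integrable M (\<lambda>\<omega>. (\<xi> j \<omega>)\<^sup>2)"
    and var: "\<And>j. expectation (\<lambda>\<omega>. (\<xi> j \<omega>)\<^sup>2) \<le> v"
    and x: "0 < x"
  shows "prob {\<omega>\<in>space M. \<exists>m\<le>N. x \<le> \<bar>\<Sum>j<m. \<xi> j \<omega>\<bar>} \<le> real N * v / x\<^sup>2"
proof -
  have rv[measurable]: "random_variable borel (\<xi> j)" for j
    using indep unfolding indep_vars_def2 by simp
  have int\<xi>: "integrable M (\<xi> j)" for j
    by (rule square_integrable_imp_integrable[OF rv sq])
  define T where "T n \<omega> = stopped_sum x (\<lambda>j. \<xi> j \<omega>) n" for n \<omega>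
  have T_rv[measurable]: "random_variable borel (T n)" for n
  proof (induction n)
    case (Suc n)
    have [measurable]: "T n \<in> borel_measurable M" by fact
    have "T (Suc n) = (\<lambda>\<omega>. T n \<omega> + (if \<bar>T n \<omega>\<bar> < x then \<xi> n \<omega> else 0))"
      by (simp add: T_def fun_eq_iff)
    then show ?case by simp
  qed (simp add: T_def[abs_def])
  \<comment> \<open>\<open>G\<close> agrees with \<open>T\<close> whenever the next increment is
    added, and it is bounded by \<open>x\<close>, which gives integrability at once.\<close>
  define G where "G n \<omega> = (if \<bar>T n \<omega>\<bar> < x then T n \<omega> else 0)" for n \<omega>
  have G_rv[measurable]: "random_variable borel (G n)" for n
    unfolding G_def by measurable
  have cross: "expectation (\<lambda>\<omega>. G n \<omega> * \<xi> n \<omega>) = 0" "integrable M (\<lambda>\<omega>. G n \<omega> * \<xi> n \<omega>)" for n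
  proof -
    let ?g = "\<lambda>z. if \<bar>stopped_sum x z n\<bar> < x then stopped_sum x z n else 0"
    have ind: "indep_var (PiM {..<n} (\<lambda>_. borel)) (\<lambda>\<omega>. restrict (\<lambda>i. \<xi> i \<omega>) {..<n})
        (PiM {n} (\<lambda>_. borel)) (\<lambda>\<omega>. restrict (\<lambda>i. \<xi> i \<omega>) {n})"
      by (rule indep_var_restrict[OF indep]) auto
    have [measurable]: "(\<lambda>z. stopped_sum x z n) \<in> borel_measurable (PiM {..<n} (\<lambda>_. borel))"
      by (rule stopped_sum_measurable) simp
    have "indep_var borel (?g \<circ> (\<lambda>\<omega>. restrict (\<lambda>i. \<xi> i \<omega>) {..<n}))
        borel ((\<lambda>z. z n) \<circ> (\<lambda>\<omega>. restrict (\<lambda>i. \<xi> i \<omega>) {n}))"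
      by (rule indep_var_compose[OF ind]) measurable
    also have "?g \<circ> (\<lambda>\<omega>. restrict (\<lambda>i. \<xi> i \<omega>) {..<n}) = G n"
    proof
      fix \<omega>
      have "stopped_sum x (restrict (\<lambda>i. \<xi> i \<omega>) {..<n}) n = T n \<omega>"
        unfolding T_def by (rule stopped_sum_cong) simp
      then show "(?g \<circ> (\<lambda>\<omega>. restrict (\<lambda>i. \<xi> i \<omega>) {..<n})) \<omega> = G n \<omega>"
        by (simp add: G_def)
    qed
    also have "(\<lambda>z. z n) \<circ> (\<lambda>\<omega>. restrict (\<lambda>i. \<xi> i \<omega>) {n}) = \<xi> n"
      by (simp add: fun_eq_iff)
    finally have ind2: "indep_var borel (G n) borel (\<xi> n)" .
    have intG: "integrable M (G n)"
      by (rule integrable_const_bound[of _ x]) (use x in \<open>auto simp: G_def\<close>)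
    show "expectation (\<lambda>\<omega>. G n \<omega> * \<xi> n \<omega>) = 0"
      using indep_var_lebesgue_integral[OF ind2 intG int\<xi>] mean by simp
    show "integrable M (\<lambda>\<omega>. G n \<omega> * \<xi> n \<omega>)"
      by (rule indep_var_integrable[OF ind2 intG int\<xi>])
  qed
  have step: "(T (Suc n) \<omega>)\<^sup>2 = (T n \<omega>)\<^sup>2 + 2 * (G n \<omega> * \<xi> n \<omega>)
      + (if \<bar>T n \<omega>\<bar> < x then (\<xi> n \<omega>)\<^sup>2 else 0)" for n \<omega>
    by (simp add: T_def G_def power2_eq_square algebra_simps)
  have last: "integrable M (\<lambda>\<omega>. if \<bar>T n \<omega>\<bar> < x then (\<xi> n \<omega>)\<^sup>2 else 0)" for n
    by (rule Bochner_Integration.integrable_bound[OF sq[of n]]) auto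
  have T2: "integrable M (\<lambda>\<omega>. (T n \<omega>)\<^sup>2) \<and> expectation (\<lambda>\<omega>. (T n \<omega>)\<^sup>2) \<le> real n * v" for n
  proof (induction n)
    case 0
    then show ?case by (simp add: T_def)
  next
    case (Suc n)
    have "integrable M (\<lambda>\<omega>. (T (Suc n) \<omega>)\<^sup>2)"
      unfolding step using Suc cross last by (intro Bochner_Integration.integrable_add integrable_mult_right) auto
    moreover have "expectation (\<lambda>\<omega>. (T (Suc n) \<omega>)\<^sup>2) = expectation (\<lambda>\<omega>. (T n \<omega>)\<^sup>2)
      + expectation (\<lambda>\<omega>. if \<bar>T n \<omega>\<bar> < x then (\<xi> n \<omega>)\<^sup>2 else 0)"
      unfolding step using Suc cross last by (simp add: Bochner_Integration.integral_add)
    moreover have "expectation (\<lambda>\<omega>. if \<bar>T n \<omega>\<bar> < x then (\<xi> n \<omega>)\<^sup>2 else 0) \<le> expectation (\<lambda>\<omega>. (\<xi> n \<omega>)\<^sup>2)"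
      by (rule integral_mono[OF last sq]) auto
    ultimately show ?case using Suc var[of n] by (simp add: algebra_simps)
  qed
  have "prob {\<omega>\<in>space M. \<exists>m\<le>N. x \<le> \<bar>\<Sum>j<m. \<xi> j \<omega>\<bar>} \<le> prob {\<omega>\<in>space M. x\<^sup>2 \<le> (T N \<omega>)\<^sup>2}"
  proof (rule finite_measure_mono)
    show "{\<omega>\<in>space M. \<exists>m\<le>N. x \<le> \<bar>\<Sum>j<m. \<xi> j \<omega>\<bar>} \<subseteq> {\<omega>\<in>space M. x\<^sup>2 \<le> (T N \<omega>)\<^sup>2}"
      using stopped_sum_ge x by (force simp: T_def abs_le_square_iff[symmetric])
  qed measurable
  also have "\<dots> \<le> expectation (\<lambda>\<omega>. (T N \<omega>)\<^sup>2) / x\<^sup>2"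
    by (rule integral_Markov_inequality_measure[where A="{}"]) (use T2 x in auto)
  also have "\<dots> \<le> real N * v / x\<^sup>2"
    using T2 by (intro divide_right_mono) auto
  finally show ?thesis .
qed

section \<open>Characteristic functions and the central limit theorem\<close>

lemma (in prob_space) char_diff_le:
  assumes [measurable]: "random_variable borel X" "random_variable borel Y" and \<eta>: "0 \<le> \<eta>"
  shows "cmod (char (distr M borel X) u - char (distr M borel Y) u)
    \<le> \<bar>u\<bar> * \<eta> + 2 * prob {\<omega>\<in>space M. \<eta> < \<bar>X \<omega> - Y \<omega>\<bar>}"
proof -
  let ?A = "{\<omega>\<in>space M. \<eta> < \<bar>X \<omega> - Y \<omega>\<bar>}"
  have intA: "integrable M (indicator ?A :: 'a \<Rightarrow> real)"
    by (rule integrable_real_indicator) (auto simp: less_top[symmetric])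
  have int: "integrable M (\<lambda>\<omega>. iexp (u * Z \<omega>))" if "random_variable borel Z" for Z
    using that by (intro integrable_iexp) auto
  have "char (distr M borel X) u - char (distr M borel Y) u
      = (CLINT \<omega>|M. iexp (u * X \<omega>) - iexp (u * Y \<omega>))"
    unfolding char_def by (subst Bochner_Integration.integral_diff[OF int int]) (auto simp: integral_distr)
  \<comment> \<open>The two exponentials differ by at most the distance of their arguments, which is
    at most \<open>\<bar>u\<bar> * \<eta>\<close> off the exceptional event, and by at most 2
    everywhere.\<close>
  also have "cmod \<dots> \<le> (\<integral>\<omega>. \<bar>u\<bar> * \<eta> + 2 * indicator ?A \<omega> \<partial>M)"
  proof (rule order_trans[OF integral_norm_bound], rule integral_mono)
    show "integrable M (\<lambda>\<omega>. cmod (iexp (u * X \<omega>) - iexp (u * Y \<omega>)))"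
      by (intro integrable_norm Bochner_Integration.integrable_diff int) auto
    show "integrable M (\<lambda>\<omega>. \<bar>u\<bar> * \<eta> + 2 * indicator ?A \<omega>)"
      by (intro Bochner_Integration.integrable_add integrable_mult_right integrable_const intA)
    fix \<omega> assume \<omega>: "\<omega> \<in> space M"
    have "iexp (u * X \<omega>) - iexp (u * Y \<omega>) = iexp (u * Y \<omega>) * (iexp (u * (X \<omega> - Y \<omega>)) - 1)"
      by (simp add: algebra_simps flip: exp_add)
    then have *: "cmod (iexp (u * X \<omega>) - iexp (u * Y \<omega>)) = cmod (iexp (u * (X \<omega> - Y \<omega>)) - 1)"
      by (simp only: norm_mult norm_exp_i_times mult_1)
    show "cmod (iexp (u * X \<omega>) - iexp (u * Y \<omega>)) \<le> \<bar>u\<bar> * \<eta> + 2 * indicator ?A \<omega>"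
    proof (cases "\<omega> \<in> ?A")
      case True
      have "cmod (iexp (u * X \<omega>) - iexp (u * Y \<omega>)) \<le> 2"
        by (rule order_trans[OF norm_triangle_ineq4]) (simp only: norm_exp_i_times)
      then show ?thesis using True \<eta> by (simp add: add_increasing)
    next
      case False
      have "cmod (iexp (u * (X \<omega> - Y \<omega>)) - 1) \<le> \<bar>u * (X \<omega> - Y \<omega>)\<bar>"
        using iexp_approx1[of "u * (X \<omega> - Y \<omega>)" 0] by simp
      also have "\<dots> \<le> \<bar>u\<bar> * \<eta>"
        using False \<omega> by (auto simp: abs_mult intro!: mult_left_mono)
      finally show ?thesis using False * by simp
    qed
  qed
  also have "\<dots> = \<bar>u\<bar> * \<eta> + 2 * prob ?A"
    using intA by (simp add: prob_space)
  finally show ?thesis .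
qed

text \<open>The power is compared with that of \<open>w k\<close>, a real exponential with the same
  expansion to first order in \<open>1 / s k\<close>, whose powers are explicit. The number of
  factors matters only through its ratio to the scale, so one normalisation serves all sets, and a
  limit ratio of zero is allowed.\<close>

lemma (in real_distribution) char_power_tendsto:
  assumes "integrable M (\<lambda>x. x)" "expectation (\<lambda>x. x) = 0" "integrable M (\<lambda>x. x^2)"
    and v: "expectation (\<lambda>x. x^2) = v"
    and s: "filterlim s at_top sequentially" and n: "(\<lambda>k. real (n k) / s k) \<longlonglongrightarrow> \<nu>"
  shows "(\<lambda>k. char M (u / sqrt (s k)) ^ n k) \<longlonglongrightarrow> exp (- (\<nu> * v * u\<^sup>2 / 2))"
proof -
  have v0: "0 \<le> v" unfolding v[symmetric] by (rule Bochner_Integration.integral_nonneg) simp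
  have spos: "\<forall>\<^sub>F k in sequentially. 0 < s k"
    using s by (simp add: filterlim_at_top_dense)
  have sinv: "(\<lambda>k. 1 / s k) \<longlonglongrightarrow> 0"
    using s by (intro tendsto_divide_0[OF tendsto_const] filterlim_at_top_imp_at_infinity)
  define w where "w k = exp (- (v * u\<^sup>2 / 2) * (1 / s k))" for k
  define q where "q k = 1 - v * u\<^sup>2 / 2 * (1 / s k)" for k
  \<comment> \<open>The remainder of the second-order expansion of the characteristic function,
    without its factor of order \<open>1 / s k\<close>. The minimum keeps the integrand below an
    integrable bound, so dominated convergence works with second moments only.\<close>
  define R where "R k = expectation (\<lambda>x. min (6 * x^2) (\<bar>u / sqrt (s k)\<bar> * \<bar>x\<bar>^3))" for k
  have "R \<longlonglongrightarrow> (\<integral>x. 0 \<partial>M)"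
    unfolding R_def
  proof (rule integral_dominated_convergence[where w="\<lambda>x. 6 * x\<^sup>2"])
    have "(\<lambda>k. \<bar>u / sqrt (s k)\<bar>) \<longlonglongrightarrow> 0"
      using s by (intro tendsto_rabs_zero tendsto_divide_0[OF tendsto_const]
          filterlim_at_top_imp_at_infinity filterlim_compose[OF sqrt_at_top])
    then have "(\<lambda>k. min (6 * x\<^sup>2) (\<bar>u / sqrt (s k)\<bar> * \<bar>x\<bar> ^ 3)) \<longlonglongrightarrow> min (6 * x\<^sup>2) (0 * \<bar>x\<bar> ^ 3)" for x
      by (intro tendsto_min tendsto_mult tendsto_const)
    then show "AE x in M. (\<lambda>k. min (6 * x\<^sup>2) (\<bar>u / sqrt (s k)\<bar> * \<bar>x\<bar> ^ 3)) \<longlonglongrightarrow> 0"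
      by simp
    show "integrable M (\<lambda>x. 6 * x\<^sup>2)" using assms(3) by simp
    show "AE x in M. norm (min (6 * x\<^sup>2) (\<bar>u / sqrt (s k)\<bar> * \<bar>x\<bar> ^ 3)) \<le> 6 * x\<^sup>2" for k
      by (intro AE_I2) (simp add: min_le_iff_disj)
  qed simp_all
  then have R: "R \<longlonglongrightarrow> 0" by simp
  have qb: "\<forall>\<^sub>F k in sequentially. cmod (char M (u / sqrt (s k)) - q k) \<le> u\<^sup>2 / 6 * (1 / s k) * R k"
    using spos
  proof eventually_elim
    case (elim k)
    have "variance (\<lambda>x. x) = v" using v assms(2) by simp
    from char_approx3[OF assms(1-3) this, of "u / sqrt (s k)"]
    have "cmod (char M (u / sqrt (s k)) - (1 - (u / sqrt (s k))^2 * v / 2)) \<le> (u / sqrt (s k))^2 / 6 * R k"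
      unfolding R_def .
    moreover have "(u / sqrt (s k))^2 = u\<^sup>2 * (1 / s k)"
      using elim by (simp add: power_divide)
    ultimately show ?case by (simp add: q_def mult_ac)
  qed
  \<comment> \<open>The difference quotient of the exponential at zero, evaluated along
    \<open>1 / s k\<close>.\<close>
  have wq: "(\<lambda>k. s k * (w k - q k)) \<longlonglongrightarrow> 0"
  proof -
    let ?c = "- (v * u\<^sup>2 / 2)"
    have "((\<lambda>h. (exp (?c * h) - 1) / h) \<longlongrightarrow> ?c) (at 0)"
    proof -
      have "((\<lambda>h. exp (?c * h)) has_real_derivative ?c) (at 0)"
        by (auto intro!: derivative_eq_intros)
      then show ?thesis by (auto dest!: DERIV_D)
    qed
    then have "((\<lambda>h. (exp (?c * h) - 1) / h - ?c) \<longlongrightarrow> 0) (at 0)"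
      by (rule LIM_zero)
    moreover have "filterlim (\<lambda>k. 1 / s k) (at 0) sequentially"
      using sinv spos by (auto simp: filterlim_at elim: eventually_mono)
    ultimately have "(\<lambda>k. (exp (?c * (1 / s k)) - 1) / (1 / s k) - ?c) \<longlonglongrightarrow> 0"
      by (rule filterlim_compose)
    then show ?thesis
    proof (rule Lim_transform_eventually)
      show "\<forall>\<^sub>F k in sequentially. (exp (?c * (1 / s k)) - 1) / (1 / s k) - ?c = s k * (w k - q k)"
        using spos by eventually_elim (simp add: w_def q_def field_simps)
    qed
  qed
  have diff: "(\<lambda>k. char M (u / sqrt (s k)) ^ n k - complex_of_real (w k) ^ n k) \<longlonglongrightarrow> 0"
  proof (rule Lim_null_comparison)
    show "(\<lambda>k. (real (n k) / s k) * (u\<^sup>2 / 6 * R k + \<bar>s k * (w k - q k)\<bar>)) \<longlonglongrightarrow> 0"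
    proof -
      have "(\<lambda>k. u\<^sup>2 / 6 * R k + \<bar>s k * (w k - q k)\<bar>) \<longlonglongrightarrow> u\<^sup>2 / 6 * 0 + 0"
        by (intro tendsto_add tendsto_mult tendsto_const R tendsto_rabs_zero wq)
      from tendsto_mult[OF n this] show ?thesis by simp
    qed
    show "\<forall>\<^sub>F k in sequentially. cmod (char M (u / sqrt (s k)) ^ n k - complex_of_real (w k) ^ n k)
        \<le> (real (n k) / s k) * (u\<^sup>2 / 6 * R k + \<bar>s k * (w k - q k)\<bar>)"
      using qb spos
    proof eventually_elim
      case (elim k)
      \<comment> \<open>Both bases have modulus at most one, so the difference of the powers is at
        most \<open>n k\<close> times the difference of the bases.\<close>
      have "w k \<le> 1" "0 \<le> w k" using elim v0 by (auto simp: w_def)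
      then have power: "cmod (char M (u / sqrt (s k)) ^ n k - complex_of_real (w k) ^ n k)
        \<le> n k * cmod (char M (u / sqrt (s k)) - complex_of_real (w k))"
        by (intro norm_power_diff cmod_char_le_1) simp
      have "cmod (char M (u / sqrt (s k)) - complex_of_real (w k))
         \<le> cmod (char M (u / sqrt (s k)) - q k) + cmod (of_real (q k) - complex_of_real (w k))"
        by (metis dist_norm dist_triangle)
      also have "cmod (of_real (q k) - complex_of_real (w k)) = \<bar>w k - q k\<bar>"
        by (metis abs_minus_commute norm_of_real of_real_diff)
      also have "\<bar>w k - q k\<bar> = 1 / s k * \<bar>s k * (w k - q k)\<bar>"
        using elim by (simp add: abs_mult)
      finally have "cmod (char M (u / sqrt (s k)) - complex_of_real (w k))
          \<le> u\<^sup>2 / 6 * (1 / s k) * R k + 1 / s k * \<bar>s k * (w k - q k)\<bar>"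
        using elim by linarith
      then have "n k * cmod (char M (u / sqrt (s k)) - complex_of_real (w k))
          \<le> n k * (u\<^sup>2 / 6 * (1 / s k) * R k + 1 / s k * \<bar>s k * (w k - q k)\<bar>)"
        by (rule mult_left_mono) simp
      also have "\<dots> = (real (n k) / s k) * (u\<^sup>2 / 6 * R k + \<bar>s k * (w k - q k)\<bar>)"
        using elim by (simp add: field_simps)
      finally show ?case using power by linarith
    qed
  qed
  have "(\<lambda>k. exp (- (v * u\<^sup>2 / 2) * (real (n k) / s k))) \<longlonglongrightarrow> exp (- (v * u\<^sup>2 / 2) * \<nu>)"
    by (intro tendsto_intros n)
  moreover have "w k ^ n k = exp (- (v * u\<^sup>2 / 2) * (real (n k) / s k))" for k
    by (simp add: w_def flip: exp_of_nat_mult)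
  ultimately have "(\<lambda>k. w k ^ n k) \<longlonglongrightarrow> exp (- (v * u\<^sup>2 / 2) * \<nu>)" by simp
  then have "(\<lambda>k. complex_of_real (w k ^ n k)) \<longlonglongrightarrow> complex_of_real (exp (- (v * u\<^sup>2 / 2) * \<nu>))"
    by (rule tendsto_of_real)
  with diff have "(\<lambda>k. char M (u / sqrt (s k)) ^ n k - complex_of_real (w k) ^ n k + complex_of_real (w k ^ n k))
    \<longlonglongrightarrow> 0 + complex_of_real (exp (- (v * u\<^sup>2 / 2) * \<nu>))"
    by (rule tendsto_add)
  then show ?thesis by (simp add: mult_ac)
qed

text \<open>Independence factors the characteristic function over all pairs, and equal laws within a
  row turn its product into a power.\<close>

lemma (in prob_space) char_sum_tendsto:
  fixes \<zeta> :: "'i \<Rightarrow> nat \<Rightarrow> 'a \<Rightarrow> real"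
  assumes J: "finite J"
    and indep: "indep_vars (\<lambda>_. borel) (\<lambda>(i, j). \<zeta> i j) (J \<times> {1..})"
    and distr: "\<And>i j. i \<in> J \<Longrightarrow> 1 \<le> j \<Longrightarrow> distr M borel (\<zeta> i j) = distr M borel (Z i)"
    and Z[measurable]: "\<And>i. i \<in> J \<Longrightarrow> Z i \<in> borel_measurable M"
    and mean: "\<And>i. i \<in> J \<Longrightarrow> expectation (Z i) = 0"
    and sq: "\<And>i. i \<in> J \<Longrightarrow> integrable M (\<lambda>\<omega>. (Z i \<omega>)\<^sup>2)"
    and s: "filterlim s at_top sequentially"
    and n: "\<And>i. i \<in> J \<Longrightarrow> (\<lambda>k. real (n k i) / s k) \<longlonglongrightarrow> \<nu> i"
  shows "(\<lambda>k. char (distr M borel (\<lambda>\<omega>. (\<Sum>i\<in>J. \<Sum>j=1..n k i. \<zeta> i j \<omega>) / sqrt (s k))) u)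
    \<longlonglongrightarrow> exp (- ((\<Sum>i\<in>J. \<nu> i * expectation (\<lambda>\<omega>. (Z i \<omega>)\<^sup>2)) * u\<^sup>2 / 2))"
proof -
  let ?\<mu> = "\<lambda>i. distr M borel (Z i)"
  have rv: "random_variable borel (\<zeta> i j)" if "i \<in> J" "1 \<le> j" for i j
    using indep that unfolding indep_vars_def2 by force
  have eq: "char (distr M borel (\<lambda>\<omega>. (\<Sum>i\<in>J. \<Sum>j=1..n k i. \<zeta> i j \<omega>) / sqrt (s k))) u
    = (\<Prod>i\<in>J. char (?\<mu> i) (u / sqrt (s k)) ^ n k i)" for k
  proof -
    let ?P = "SIGMA i:J. {1..n k i}"
    have "char (distr M borel (\<lambda>\<omega>. (\<Sum>i\<in>J. \<Sum>j=1..n k i. \<zeta> i j \<omega>) / sqrt (s k))) u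
      = char (distr M borel (\<lambda>\<omega>. \<Sum>p\<in>?P. (case p of (i, j) \<Rightarrow> \<zeta> i j) \<omega> / sqrt (s k))) u"
      using J by (simp add: sum.Sigma sum_divide_distrib case_prod_unfold)
    also have "\<dots> = (\<Prod>p\<in>?P. char (distr M borel (\<lambda>\<omega>. (case p of (i, j) \<Rightarrow> \<zeta> i j) \<omega> / sqrt (s k))) u)"
    proof (rule char_distr_sum, rule indep_vars_compose2[where M'="\<lambda>_. borel" and Y="\<lambda>_ x. x / sqrt (s k)"])
      show "indep_vars (\<lambda>_. borel) (\<lambda>(i, j). \<zeta> i j) ?P"
        by (rule indep_vars_subset[OF indep]) auto
    qed auto
    also have "\<dots> = (\<Prod>p\<in>?P. char (?\<mu> (fst p)) (u / sqrt (s k)))"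
    proof (intro prod.cong refl)
      fix p assume p: "p \<in> ?P"
      obtain i j where ij: "p = (i, j)" by (cases p)
      then have i: "i \<in> J" "1 \<le> j" using p by auto
      note [measurable] = rv[OF i]
      have "char (distr M borel (\<lambda>\<omega>. \<zeta> i j \<omega> / sqrt (s k))) u = char (distr M borel (\<zeta> i j)) (u / sqrt (s k))"
        by (simp add: char_def integral_distr)
      then show "char (distr M borel (\<lambda>\<omega>. (case p of (i, j) \<Rightarrow> \<zeta> i j) \<omega> / sqrt (s k))) u
          = char (?\<mu> (fst p)) (u / sqrt (s k))"
        using distr[OF i] ij by simp
    qed
    also have "\<dots> = (\<Prod>i\<in>J. \<Prod>j=1..n k i. char (?\<mu> i) (u / sqrt (s k)))"
      using J by (subst prod.Sigma) (auto intro!: prod.cong)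
    finally show ?thesis by simp
  qed
  have "(\<lambda>k. \<Prod>i\<in>J. char (?\<mu> i) (u / sqrt (s k)) ^ n k i)
    \<longlonglongrightarrow> (\<Prod>i\<in>J. complex_of_real (exp (- (\<nu> i * expectation (\<lambda>\<omega>. (Z i \<omega>)\<^sup>2) * u\<^sup>2 / 2))))"
  proof (rule tendsto_prod)
    fix i assume i: "i \<in> J"
    note [measurable] = Z[OF i]
    interpret d: real_distribution "?\<mu> i" by (rule real_distribution_distr) fact
    have "integrable M (Z i)" by (rule square_integrable_imp_integrable[OF Z[OF i] sq[OF i]])
    then show "(\<lambda>k. char (?\<mu> i) (u / sqrt (s k)) ^ n k i) \<longlonglongrightarrow>
      complex_of_real (exp (- (\<nu> i * expectation (\<lambda>\<omega>. (Z i \<omega>)\<^sup>2) * u\<^sup>2 / 2)))"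
      using d.char_power_tendsto[OF _ _ _ refl s n[OF i], of u] mean[OF i] sq[OF i]
      by (simp add: integrable_distr_eq integral_distr)
  qed
  then show ?thesis
    unfolding eq using J by (simp add: exp_sum sum_distrib_right sum_divide_distrib flip: sum_negf of_real_prod)
qed

lemma normal_measure_char:
  assumes v: "0 < v"
  shows "real_distribution (normal_measure v)"
    and "char (normal_measure v) u = exp (- (v * u\<^sup>2 / 2))"
proof -
  interpret std: prob_space std_normal_distribution
    by (rule prob_space_normal_density) simp
  have id: "distributed std_normal_distribution lborel (\<lambda>x. x) std_normal_density"
    unfolding distributed_def by (auto simp: distr_id2)
  have "distributed std_normal_distribution lborel (\<lambda>x. 0 + sqrt v * x)
      (normal_density (0 + sqrt v * 0) (\<bar>sqrt v\<bar> * 1))"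
    by (rule std.normal_density_affine[OF id]) (use v in auto)
  then have *: "distr std_normal_distribution lborel (\<lambda>x. sqrt v * x) = density lborel (normal_density 0 (sqrt v))"
    using v by (simp add: distributed_def)
  have eq: "normal_measure v = distr std_normal_distribution borel (\<lambda>x. sqrt v * x)"
    using v unfolding normal_measure_def by (simp add: *[symmetric] cong: distr_cong)
  show "real_distribution (normal_measure v)"
    unfolding eq by (rule std.real_distribution_distr) simp
  have "char (normal_measure v) u = char std_normal_distribution (u * sqrt v)"
    unfolding eq by (simp add: char_def integral_distr mult.assoc)
  also have "\<dots> = exp (- (v * u\<^sup>2 / 2))"
    using v by (simp add: char_std_normal_distribution power_mult_distrib mult.commute)
  finally show "char (normal_measure v) u = exp (- (v * u\<^sup>2 / 2))" .
qed

section \<open>The estimator\<close>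

definition dev :: "('i \<Rightarrow> nat \<Rightarrow> real^'k) \<Rightarrow> real^'k \<Rightarrow> 'i \<Rightarrow> nat \<Rightarrow> real^'k" where
  "dev x \<mu> I n = (\<Sum>j=1..n. x I j - \<mu>)"

lemma dev_0 [simp]: "dev x \<mu> I 0 = 0"
  by (simp add: dev_def)

lemma dev_diff: "dev x \<mu> I (n0 + m) - dev x \<mu> I n0 = (\<Sum>j<m. x I (n0 + 1 + j) - \<mu>)"
  by (induction m) (auto simp: dev_def)

text \<open>As the weights add up to \<open>a\<close>, the true value
  \<open>a \<bullet> \<mu>\<close> splits over the sets like the estimator, and only centred sums
  remain. Their coefficients are the ratios that \<open>stability\<close> controls.\<close>

lemma estimator_dev:
  assumes t: "0 < t" and feas: "weights_for Is a (\<lambda>I. real (n I)) lam"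
  shows "sqrt t * ((\<Sum>I\<in>{I\<in>Is. 0 < n I}. (1 / real (n I)) * (\<Sum>j=1..n I. lam I \<bullet> x I j)) - a \<bullet> \<mu>)
    = (\<Sum>I\<in>Is. ((t / real (n I)) *\<^sub>R lam I) \<bullet> dev x \<mu> I (n I)) / sqrt t"
proof -
  let ?P = "{I\<in>Is. 0 < n I}"
  have "a \<bullet> \<mu> = (\<Sum>I\<in>?P. lam I \<bullet> \<mu>)"
    using feas by (auto simp: weights_for_def inner_sum_left)
  also have "\<dots> = (\<Sum>I\<in>?P. (1 / real (n I)) * (\<Sum>j=1..n I. lam I \<bullet> \<mu>))"
  proof (rule sum.cong[OF refl])
    fix I assume "I \<in> ?P"
    moreover have "(\<Sum>j=1..n I. lam I \<bullet> \<mu>) = real (n I) * (lam I \<bullet> \<mu>)" by (subst sum_constant) simp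
    ultimately show "lam I \<bullet> \<mu> = (1 / real (n I)) * (\<Sum>j=1..n I. lam I \<bullet> \<mu>)" by simp
  qed
  finally have a: "a \<bullet> \<mu> = (\<Sum>I\<in>?P. (1 / real (n I)) * (\<Sum>j=1..n I. lam I \<bullet> \<mu>))" .
  have "(\<Sum>I\<in>?P. (1 / real (n I)) * (\<Sum>j=1..n I. lam I \<bullet> x I j)) - a \<bullet> \<mu>
      = (\<Sum>I\<in>?P. (1 / real (n I)) * (lam I \<bullet> dev x \<mu> I (n I)))"
    unfolding a dev_def by (simp only: inner_sum_right inner_diff_right sum_subtractf right_diff_distrib)
  also have "sqrt t * \<dots> = (\<Sum>I\<in>?P. ((t / real (n I)) *\<^sub>R lam I) \<bullet> dev x \<mu> I (n I) / sqrt t)"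
    unfolding sum_distrib_left
  proof (rule sum.cong[OF refl])
    fix I
    have "sqrt t = t / sqrt t" using t by (simp add: real_div_sqrt)
    then show "sqrt t * (1 / real (n I) * (lam I \<bullet> dev x \<mu> I (n I)))
      = ((t / real (n I)) *\<^sub>R lam I) \<bullet> dev x \<mu> I (n I) / sqrt t"
      by (metis (no_types, opaque_lifting) inner_scaleR_left mult.assoc mult.commute mult_1 times_divide_eq_left times_divide_eq_right)
  qed
  also have "\<dots> = (\<Sum>I\<in>Is. ((t / real (n I)) *\<^sub>R lam I) \<bullet> dev x \<mu> I (n I) / sqrt t)"
    by (rule sum.mono_neutral_left) auto \<comment> \<open>\<open>t / 0 = 0\<close> covers the sets with \<open>n I = 0\<close>\<close>
  finally show ?thesis by (simp add: sum_divide_distrib)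
qed

text \<open>The random size \<open>n\<close> and the deterministic \<open>n'\<close> lie in one
  window that starts at the deterministic index \<open>n0\<close>; both values are compared with
  \<open>f n0\<close>, which accounts for the factor 2.\<close>

lemma dev_window:
  assumes t: "0 < t" and \<nu>: "0 \<le> \<nu>" and \<epsilon>: "0 \<le> \<epsilon>"
    and n: "\<bar>real n - t * \<nu>\<bar> \<le> \<epsilon> * t"
    and n': "n' = nat \<lfloor>t * \<nu>\<rfloor>"
    and n0: "n0 = nat \<lfloor>t * \<nu> - \<epsilon> * t\<rfloor>" and N: "N = nat \<lceil>2 * \<epsilon> * t\<rceil> + 2"
    and win: "\<And>m. m \<le> N \<Longrightarrow> \<bar>f (n0 + m) - f n0\<bar> < (\<rho>::real)"
  shows "\<bar>f n - f n'\<bar> \<le> 2 * \<rho>"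
proof -
  have \<epsilon>t: "0 \<le> \<epsilon> * t" using t \<epsilon> by simp
  \<comment> \<open>The 2 added in \<open>N\<close> absorbs the rounding of \<open>n0\<close>. If
    the lower end of the window is negative, \<open>n0\<close> is 0 and the window starts
    there.\<close>
  have low: "t * \<nu> - \<epsilon> * t - 1 \<le> real n0" unfolding n0 by linarith
  have up: "real n0 \<le> t * \<nu> - \<epsilon> * t \<or> n0 = 0" unfolding n0 by linarith
  have N': "2 * \<epsilon> * t + 2 \<le> real N" unfolding N by linarith
  have *: "\<bar>f k - f n0\<bar> < \<rho>" if k: "n0 \<le> k" "real k \<le> t * \<nu> + \<epsilon> * t" for k
  proof -
    have "real (k - n0) \<le> real N"
      using k low N' \<epsilon>t by (simp add: of_nat_diff)
    then have "k - n0 \<le> N" by simp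
    from win[OF this] show ?thesis using k by simp
  qed
  have "n0 \<le> n"
    using up n by (cases "n0 = 0") (auto simp: abs_le_iff)
  moreover have "n0 \<le> n'"
    unfolding n0 n' using \<epsilon>t by (intro nat_mono floor_mono) simp
  moreover have "real n' \<le> t * \<nu>" unfolding n' using t \<nu> by (simp add: of_nat_nat)
  ultimately have "\<bar>f n - f n0\<bar> < \<rho>" "\<bar>f n' - f n0\<bar> < \<rho>"
    using * n \<epsilon>t by (auto simp: abs_le_iff)
  then show ?thesis by linarith
qed

context design
begin

text \<open>In each coordinate the error splits into the error of the ratio times the centred sum,
  and \<open>ratio_star\<close> times the error of the centred sum. Where
  \<open>nustar I = 0\<close> the error of the ratio need not be small, but
  \<open>floor_star t I\<close> is 0, so the window bound makes the centred sum itself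
  small.\<close>

lemma estimator_error:
  assumes t: "0 < t" and feas: "weights_for Is a (\<lambda>I. real (n I)) lam"
    and \<epsilon>: "0 \<le> \<epsilon>" and C: "0 \<le> C" and Q: "0 \<le> Q" and r: "0 \<le> r"
    and G: "\<And>I. I \<in> Is \<Longrightarrow> norm (ratio_star I) \<le> G"
    and lam: "\<And>I. I \<in> Is \<Longrightarrow> 0 < n I \<Longrightarrow>
      norm ((t / real (n I)) *\<^sub>R lam I - ratio_star I) \<le> (if 0 < nustar I then \<epsilon> else C)"
    and big: "\<And>I i. I \<in> Is \<Longrightarrow> \<bar>dev x \<mu> I (n I) $ i\<bar> \<le> Q * sqrt t"
    and win: "\<And>I i. I \<in> Is \<Longrightarrow> \<bar>dev x \<mu> I (n I) $ i - dev x \<mu> I (floor_star t I) $ i\<bar> \<le> 2 * (r * sqrt t)"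
  shows "\<bar>sqrt t * ((\<Sum>I\<in>{I\<in>Is. 0 < n I}. (1 / real (n I)) * (\<Sum>j=1..n I. lam I \<bullet> x I j)) - a \<bullet> \<mu>)
    - (\<Sum>I\<in>Is. ratio_star I \<bullet> dev x \<mu> I (floor_star t I)) / sqrt t\<bar>
    \<le> real (card Is * CARD('k)) * (\<epsilon> * Q + 2 * (C + G) * r)"
proof -
  have st: "0 < sqrt t" using t by simp
  let ?\<gamma> = "\<lambda>I. (t / real (n I)) *\<^sub>R lam I"
  have coord: "\<bar>?\<gamma> I $ i * dev x \<mu> I (n I) $ i - ratio_star I $ i * dev x \<mu> I (floor_star t I) $ i\<bar>
      \<le> (\<epsilon> * Q + 2 * (C + G) * r) * sqrt t" if I: "I \<in> Is" for I i
  proof -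
    let ?d = "dev x \<mu> I (n I) $ i" and ?d' = "dev x \<mu> I (floor_star t I) $ i"
    have g: "\<bar>ratio_star I $ i\<bar> \<le> G" using component_le_norm_cart[of "ratio_star I" i] G[OF I] by linarith
    have G0: "0 \<le> G" using g by linarith
    have 1: "\<bar>ratio_star I $ i * (?d - ?d')\<bar> \<le> G * (2 * (r * sqrt t))"
      unfolding abs_mult using g win[OF I, of i] G0 by (intro mult_mono) auto
    have 2: "\<bar>(?\<gamma> I - ratio_star I) $ i * ?d\<bar> \<le> (\<epsilon> * Q + 2 * C * r) * sqrt t"
    proof (cases "n I = 0")
      case True
      then show ?thesis using \<epsilon> C Q r st by simp
    next
      case False
      then have "0 < n I" by simp
      from lam[OF I this]
      have ga: "\<bar>(?\<gamma> I - ratio_star I) $ i\<bar> \<le> (if 0 < nustar I then \<epsilon> else C)"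
        using component_le_norm_cart[of "?\<gamma> I - ratio_star I" i] by linarith
      show ?thesis
      proof (cases "0 < nustar I")
        case True
        then have "\<bar>(?\<gamma> I - ratio_star I) $ i * ?d\<bar> \<le> \<epsilon> * (Q * sqrt t)"
          unfolding abs_mult using ga big[OF I, of i] \<epsilon> by (intro mult_mono) auto
        moreover have "0 \<le> 2 * C * r * sqrt t" using C r st by simp
        ultimately show ?thesis by (simp add: algebra_simps)
      next
        case False
        then have "nustar I = 0" using nustar_ge0[of I] by simp
        then have "floor_star t I = 0" by (simp add: floor_star_def)
        then have "\<bar>?d\<bar> \<le> 2 * (r * sqrt t)" using win[OF I, of i] by simp
        then have "\<bar>(?\<gamma> I - ratio_star I) $ i * ?d\<bar> \<le> C * (2 * (r * sqrt t))"
          unfolding abs_mult using ga False C by (intro mult_mono) auto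
        moreover have "0 \<le> \<epsilon> * Q * sqrt t" using \<epsilon> Q st by simp
        ultimately show ?thesis by (simp add: algebra_simps)
      qed
    qed
    have "?\<gamma> I $ i * ?d - ratio_star I $ i * ?d' = (?\<gamma> I - ratio_star I) $ i * ?d + ratio_star I $ i * (?d - ?d')"
      by (simp add: algebra_simps)
    with 1 2 show ?thesis by (simp add: algebra_simps)
  qed
  have "\<bar>(\<Sum>I\<in>Is. ?\<gamma> I \<bullet> dev x \<mu> I (n I)) - (\<Sum>I\<in>Is. ratio_star I \<bullet> dev x \<mu> I (floor_star t I))\<bar>
    = \<bar>\<Sum>I\<in>Is. \<Sum>i\<in>UNIV. ?\<gamma> I $ i * dev x \<mu> I (n I) $ i - ratio_star I $ i * dev x \<mu> I (floor_star t I) $ i\<bar>"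
    by (simp add: inner_vec_def sum_subtractf)
  also have "\<dots> \<le> (\<Sum>I\<in>Is. \<Sum>i\<in>(UNIV::'k set). (\<epsilon> * Q + 2 * (C + G) * r) * sqrt t)"
    by (intro order_trans[OF sum_abs] sum_mono coord)
  also have "\<dots> = real (card Is * CARD('k)) * (\<epsilon> * Q + 2 * (C + G) * r) * sqrt t" by simp
  finally show ?thesis
    unfolding estimator_dev[OF t feas] diff_divide_distrib[symmetric] abs_divide
    using st by (simp add: divide_le_eq)
qed

end

section \<open>Moments and independence of the sample array\<close>

locale sampled_design = prob_space M + design Is c B0 a Sigma nustar Vstar
  for M :: "'a measure" and Is :: "'k::finite set set" and c :: "'k set \<Rightarrow> real^'m" and B0 a Sigma nustar Vstar +
  fixes X :: "'a \<Rightarrow> real^'k" and Xs :: "'k set \<Rightarrow> nat \<Rightarrow> 'a \<Rightarrow> real^'k" and \<mu> :: "real^'k"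
  assumes X_rv [measurable]: "X \<in> borel_measurable M"
    and X_mom2: "\<And>i. integrable M (\<lambda>\<omega>. (X \<omega> $ i)\<^sup>2)"
    and mean: "\<And>i. expectation (\<lambda>\<omega>. X \<omega> $ i) = \<mu> $ i"
    and cov: "\<And>i j. Sigma $ i $ j = expectation (\<lambda>\<omega>. (X \<omega> $ i - \<mu> $ i) * (X \<omega> $ j - \<mu> $ j))"
    and Xs_rv: "\<And>I j. I \<in> Is \<Longrightarrow> 1 \<le> j \<Longrightarrow> Xs I j \<in> borel_measurable M"
    and Xs_indep: "indep_vars (\<lambda>_. borel) (\<lambda>(I, j). Xs I j) (Is \<times> {1..})"
    and Xs_distr: "\<And>I j. I \<in> Is \<Longrightarrow> 1 \<le> j \<Longrightarrow> distr M borel (Xs I j) = distr M borel X"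
begin

lemma component_measurable [measurable]: "(\<lambda>x. x $ i :: real) \<in> borel_measurable borel"
  by (intro borel_measurable_continuous_onI continuous_intros)

lemma X_comp_int: "integrable M (\<lambda>\<omega>. X \<omega> $ i)"
  by (rule square_integrable_imp_integrable[OF _ X_mom2]) simp

lemma X_dev_sq_int: "integrable M (\<lambda>\<omega>. (X \<omega> $ i - \<mu> $ i)\<^sup>2)"
  unfolding power2_diff using X_mom2 X_comp_int by simp

lemma X_dev_prod_int: "integrable M (\<lambda>\<omega>. (X \<omega> $ i - \<mu> $ i) * (X \<omega> $ j - \<mu> $ j))"
proof (rule Bochner_Integration.integrable_bound)
  show "integrable M (\<lambda>\<omega>. (X \<omega> $ i - \<mu> $ i)\<^sup>2 + (X \<omega> $ j - \<mu> $ j)\<^sup>2)"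
    by (intro Bochner_Integration.integrable_add X_dev_sq_int)
  have "\<bar>x * y\<bar> \<le> x\<^sup>2 + y\<^sup>2" for x y :: real
  proof -
    have "2 * (\<bar>x\<bar> * \<bar>y\<bar>) \<le> x\<^sup>2 + y\<^sup>2" using sum_squares_bound[of "\<bar>x\<bar>" "\<bar>y\<bar>"] by simp
    moreover have "0 \<le> \<bar>x\<bar> * \<bar>y\<bar>" by simp
    ultimately show ?thesis unfolding abs_mult by linarith
  qed
  then show "AE \<omega> in M. norm ((X \<omega> $ i - \<mu> $ i) * (X \<omega> $ j - \<mu> $ j)) \<le> norm ((X \<omega> $ i - \<mu> $ i)\<^sup>2 + (X \<omega> $ j - \<mu> $ j)\<^sup>2)"
    by (intro AE_I2) simp
qed simp

lemma proj_measurable [measurable]: "(\<lambda>x. g \<bullet> (x - \<mu>)) \<in> borel_measurable borel"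
  by (intro borel_measurable_continuous_onI continuous_intros)

lemma proj_moments:
  shows "expectation (\<lambda>\<omega>. g \<bullet> (X \<omega> - \<mu>)) = 0"
    and "integrable M (\<lambda>\<omega>. (g \<bullet> (X \<omega> - \<mu>))\<^sup>2)"
    and "expectation (\<lambda>\<omega>. (g \<bullet> (X \<omega> - \<mu>))\<^sup>2) = g \<bullet> (Sigma *v g)"
proof -
  have int: "integrable M (\<lambda>\<omega>. X \<omega> $ i - \<mu> $ i)" for i using X_comp_int by simp
  have "expectation (\<lambda>\<omega>. g \<bullet> (X \<omega> - \<mu>)) = (\<Sum>i\<in>UNIV. expectation (\<lambda>\<omega>. g $ i * (X \<omega> $ i - \<mu> $ i)))"
    unfolding inner_vec_def using int by (subst Bochner_Integration.integral_sum[symmetric]) auto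
  also have "\<dots> = 0" using X_comp_int mean by (simp add: prob_space)
  finally show "expectation (\<lambda>\<omega>. g \<bullet> (X \<omega> - \<mu>)) = 0" .
  have eq: "(g \<bullet> (X \<omega> - \<mu>))\<^sup>2 =
    (\<Sum>i\<in>UNIV. \<Sum>j\<in>UNIV. (g $ i * g $ j) * ((X \<omega> $ i - \<mu> $ i) * (X \<omega> $ j - \<mu> $ j)))" for \<omega>
    unfolding inner_vec_def power2_eq_square sum_product by (intro sum.cong refl) (simp add: mult_ac)
  show "integrable M (\<lambda>\<omega>. (g \<bullet> (X \<omega> - \<mu>))\<^sup>2)"
    unfolding eq by (intro Bochner_Integration.integrable_sum integrable_mult_right X_dev_prod_int)
  have "expectation (\<lambda>\<omega>. (g \<bullet> (X \<omega> - \<mu>))\<^sup>2) = (\<Sum>i\<in>UNIV. \<Sum>j\<in>UNIV. (g $ i * g $ j) * Sigma $ i $ j)"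
    unfolding eq cov by (simp add: X_dev_prod_int)
  also have "\<dots> = g \<bullet> (Sigma *v g)"
    by (simp add: inner_vec_def matrix_vector_mult_def sum_distrib_left mult_ac)
  finally show "expectation (\<lambda>\<omega>. (g \<bullet> (X \<omega> - \<mu>))\<^sup>2) = g \<bullet> (Sigma *v g)" .
qed

text \<open>The increments of one row after index \<open>n0\<close> form an independent centred
  sequence of variance \<open>Sigma $ i $ i\<close>, to which the maximal inequality
  applies.\<close>

lemma window_prob:
  assumes I: "I \<in> Is" and x: "0 < x"
  shows "prob {\<omega>\<in>space M. \<exists>m\<le>N. x \<le> \<bar>dev (\<lambda>I j. Xs I j \<omega>) \<mu> I (n0 + m) $ i - dev (\<lambda>I j. Xs I j \<omega>) \<mu> I n0 $ i\<bar>}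
    \<le> real N * Sigma $ i $ i / x\<^sup>2"
proof -
  let ?\<xi> = "\<lambda>j \<omega>. Xs I (n0 + 1 + j) \<omega> $ i - \<mu> $ i"
  have "indep_vars (\<lambda>_. borel) (\<lambda>j. (\<lambda>(I, j). Xs I j) (I, n0 + 1 + j)) UNIV"
    by (rule indep_vars_reindex[where f="\<lambda>j. (I, n0 + 1 + j)" and M'="\<lambda>_. borel", OF indep_vars_subset[OF Xs_indep]])
      (use I in \<open>auto simp: inj_on_def\<close>)
  then have "indep_vars (\<lambda>_. borel) (\<lambda>j. Xs I (n0 + 1 + j)) UNIV" by simp
  then have ind: "indep_vars (\<lambda>_. borel) ?\<xi> UNIV"
    by (rule indep_vars_compose2[where Y="\<lambda>_ x. x $ i - \<mu> $ i"]) simp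
  have tr: "expectation (\<lambda>\<omega>. f (Xs I (n0 + 1 + j) \<omega>)) = expectation (\<lambda>\<omega>. f (X \<omega>))"
      "integrable M (\<lambda>\<omega>. f (Xs I (n0 + 1 + j) \<omega>)) = integrable M (\<lambda>\<omega>. f (X \<omega>))"
    if f: "f \<in> borel_measurable borel" for f :: "real^'k \<Rightarrow> real" and j
  proof -
    have m: "Xs I (n0 + 1 + j) \<in> borel_measurable M" by (rule Xs_rv[OF I]) simp
    have d: "distr M borel (Xs I (n0 + 1 + j)) = distr M borel X" by (rule Xs_distr[OF I]) simp
    show "expectation (\<lambda>\<omega>. f (Xs I (n0 + 1 + j) \<omega>)) = expectation (\<lambda>\<omega>. f (X \<omega>))"
      unfolding integral_distr[OF m f, symmetric] integral_distr[OF X_rv f, symmetric] d ..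
    show "integrable M (\<lambda>\<omega>. f (Xs I (n0 + 1 + j) \<omega>)) = integrable M (\<lambda>\<omega>. f (X \<omega>))"
      unfolding integrable_distr_eq[OF m f, symmetric] integrable_distr_eq[OF X_rv f, symmetric] d ..
  qed
  have "prob {\<omega>\<in>space M. \<exists>m\<le>N. x \<le> \<bar>\<Sum>j<m. ?\<xi> j \<omega>\<bar>} \<le> real N * Sigma $ i $ i / x\<^sup>2"
  proof (rule kolmogorov_maximal[OF ind _ _ _ x])
    show "expectation (?\<xi> j) = 0" for j
      using tr(1)[of "\<lambda>x. x $ i - \<mu> $ i"] X_comp_int[of i] mean[of i] by (simp add: prob_space)
    show "integrable M (\<lambda>\<omega>. (?\<xi> j \<omega>)\<^sup>2)" for j
      using tr(2)[of "\<lambda>x. (x $ i - \<mu> $ i)\<^sup>2"] X_dev_sq_int[of i] by simp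
    show "expectation (\<lambda>\<omega>. (?\<xi> j \<omega>)\<^sup>2) \<le> Sigma $ i $ i" for j
      using tr(1)[of "\<lambda>x. (x $ i - \<mu> $ i)\<^sup>2"] by (simp add: cov power2_eq_square)
  qed
  then show ?thesis unfolding vector_minus_component[symmetric] dev_diff sum_component by simp
qed

lemma normal_limit:
  assumes s: "filterlim s at_top sequentially"
  shows "(\<lambda>k. char (distr M borel (\<lambda>\<omega>. (\<Sum>I\<in>Is. ratio_star I \<bullet> dev (\<lambda>I j. Xs I j \<omega>) \<mu> I (floor_star (s k) I)) / sqrt (s k))) u)
    \<longlonglongrightarrow> exp (- (Vstar * u\<^sup>2 / 2))"
proof -
  let ?\<zeta> = "\<lambda>I j \<omega>. ratio_star I \<bullet> (Xs I j \<omega> - \<mu>)" and ?Z = "\<lambda>I \<omega>. ratio_star I \<bullet> (X \<omega> - \<mu>)"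
  have "(\<lambda>k. char (distr M borel (\<lambda>\<omega>. (\<Sum>I\<in>Is. \<Sum>j=1..floor_star (s k) I. ?\<zeta> I j \<omega>) / sqrt (s k))) u)
    \<longlonglongrightarrow> exp (- ((\<Sum>I\<in>Is. nustar I * expectation (\<lambda>\<omega>. (?Z I \<omega>)\<^sup>2)) * u\<^sup>2 / 2))"
  proof (rule char_sum_tendsto[OF _ _ _ _ _ _ s])
    have "indep_vars (\<lambda>_. borel) (\<lambda>p \<omega>. ratio_star (fst p) \<bullet> ((case p of (I, j) \<Rightarrow> Xs I j) \<omega> - \<mu>)) (Is \<times> {1..})"
      by (rule indep_vars_compose2[OF Xs_indep, where Y="\<lambda>p x. ratio_star (fst p) \<bullet> (x - \<mu>)"]) simp
    then show "indep_vars (\<lambda>_. borel) (\<lambda>(I, j). ?\<zeta> I j) (Is \<times> {1..})"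
      by (simp add: case_prod_unfold)
    fix I assume I: "I \<in> Is"
    show "distr M borel (?\<zeta> I j) = distr M borel (?Z I)" if "1 \<le> j" for j
    proof -
      note [measurable] = Xs_rv[OF I that]
      have "distr M borel (?\<zeta> I j) = distr (distr M borel (Xs I j)) borel (\<lambda>x. ratio_star I \<bullet> (x - \<mu>))"
        by (subst distr_distr) (auto simp: comp_def)
      also have "\<dots> = distr M borel (?Z I)"
        unfolding Xs_distr[OF I that] by (subst distr_distr) (auto simp: comp_def)
      finally show ?thesis .
    qed
    show "(\<lambda>k. real (floor_star (s k) I) / s k) \<longlonglongrightarrow> nustar I"
      by (rule filterlim_compose[OF floor_star_tendsto s])
  qed (auto simp: proj_moments)
  then show ?thesis
    by (simp add: dev_def inner_sum_right proj_moments flip: Vstar_ratio_star)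
qed

end

text \<open>Makes the event of a poor covariance estimate measurable. The set is open, being a union
  over test vectors \<open>x\<close> of conditions that are open in the matrix.\<close>

lemma borel_onorm_gt: "{A :: real^'k^'k. \<delta> < onorm (\<lambda>x. (A - B) *v x)} \<in> sets borel"
proof (rule borel_open)
  let ?S = "{A :: real^'k^'k. \<delta> < onorm (\<lambda>x. (A - B) *v x)}"
  show "open ?S"
  proof (cases "\<delta> < 0")
    case True
    then have "?S = UNIV"
      using onorm_pos_le[OF matrix_vector_mul_bounded_linear[of "A - B" for A]] by (auto intro: less_le_trans)
    then show ?thesis by simp
  next
    case False
    have "?S = (\<Union>x. {A. \<delta> * norm x < norm ((A - B) *v x)})"
    proof (intro set_eqI iffI)
      fix A assume "A \<in> ?S"
      then have "\<not> onorm (\<lambda>x. (A - B) *v x) \<le> \<delta>" by simp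
      then have "\<not> (\<forall>x. norm ((A - B) *v x) \<le> \<delta> * norm x)" using onorm_le by blast
      then show "A \<in> (\<Union>x. {A. \<delta> * norm x < norm ((A - B) *v x)})" by (auto simp: not_le)
    next
      fix A assume "A \<in> (\<Union>x. {A. \<delta> * norm x < norm ((A - B) *v x)})"
      then obtain x where x: "\<delta> * norm x < norm ((A - B) *v x)" by blast
      also have "\<dots> \<le> onorm (\<lambda>x. (A - B) *v x) * norm x"
        by (rule onorm) (rule matrix_vector_mul_bounded_linear)
      finally show "A \<in> ?S" by (simp add: mult_less_cancel_right)
    qed
    moreover have "open {A. \<delta> * norm x < norm ((A - B) *v x)}" for x
    proof (rule open_Collect_less)
      have "bounded_linear (\<lambda>A :: real^'k^'k. A *v x)"
        by (rule linear_conv_bounded_linear[THEN iffD1], rule linearI)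
          (auto simp: matrix_vector_mult_add_rdistrib scaleR_matrix_vector_assoc)
      then have "continuous_on UNIV (\<lambda>A :: real^'k^'k. A *v x)" by (rule linear_continuous_on)
      then have "continuous_on UNIV (\<lambda>A. (A - B) *v x)"
        unfolding matrix_vector_mult_diff_rdistrib by (intro continuous_intros)
      then show "continuous_on UNIV (\<lambda>A. norm ((A - B) *v x))" by (intro continuous_intros)
    qed (intro continuous_intros)
    ultimately show ?thesis by auto
  qed
qed

section \<open>Replacing random sample sizes by deterministic ones, and the weak limit\<close>

context sampled_design
begin

lemma dev_measurable:
  assumes "I \<in> Is"
  shows "(\<lambda>\<omega>. dev (\<lambda>I j. Xs I j \<omega>) \<mu> I n $ i) \<in> borel_measurable M"
proof -
  have "(\<lambda>\<omega>. Xs I j \<omega> $ i) \<in> borel_measurable M" if "j \<in> {1..n}" for j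
    using measurable_compose[OF Xs_rv[OF assms] component_measurable] that by simp
  then show ?thesis unfolding dev_def sum_component vector_minus_component
    by (intro borel_measurable_sum borel_measurable_diff) auto
qed

lemma window_event:
  assumes I: "I \<in> Is"
  shows "{\<omega>\<in>space M. \<exists>m\<le>N. x \<le> \<bar>dev (\<lambda>I j. Xs I j \<omega>) \<mu> I (n0 + m) $ i - dev (\<lambda>I j. Xs I j \<omega>) \<mu> I n0 $ i\<bar>} \<in> events"
proof -
  note [measurable] = dev_measurable[OF I]
  show ?thesis by measurable
qed

text \<open>Outside one event of small probability, the covariance estimate is close and all centred
  sums obey a global bound and a window bound. There the comparison is purely deterministic,
  whatever the dependence between the estimate and the sample.\<close>

lemma estimator_close:
  fixes Sh :: "real \<Rightarrow> 'a \<Rightarrow> real^'k^'k" and nh :: "real \<Rightarrow> 'a \<Rightarrow> 'k set \<Rightarrow> nat" and lh :: "real \<Rightarrow> 'a \<Rightarrow> 'k set \<Rightarrow> real^'k"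
  assumes Sh_rv: "\<And>t. Sh t \<in> borel_measurable M"
    and Sh_sym: "\<And>t \<omega>. transpose (Sh t \<omega>) = Sh t \<omega>"
    and Sh_conv: "\<And>\<delta>. 0 < \<delta> \<Longrightarrow> ((\<lambda>t. prob {\<omega> \<in> space M. \<delta> < onorm (\<lambda>x. (Sh t \<omega> - Sigma) *v x)}) \<longlongrightarrow> 0) at_top"
    and hat_min: "\<And>t \<omega>. \<exists>n lam. est_minimizer Is c (t *\<^sub>R B0) (Sh t \<omega>) a n lam \<Longrightarrow>
        est_minimizer Is c (t *\<^sub>R B0) (Sh t \<omega>) a (nh t \<omega>) (lh t \<omega>)"
    and \<eta>: "0 < \<eta>" and \<rho>: "0 < \<rho>"
  shows "\<forall>\<^sub>F t in at_top. prob {\<omega>\<in>space M. \<eta> <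
    \<bar>sqrt t * ((\<Sum>I\<in>{I\<in>Is. 0 < nh t \<omega> I}. (1 / real (nh t \<omega> I)) * (\<Sum>j=1..nh t \<omega> I. lh t \<omega> I \<bullet> Xs I j \<omega>)) - a \<bullet> \<mu>)
    - (\<Sum>I\<in>Is. ratio_star I \<bullet> dev (\<lambda>I j. Xs I j \<omega>) \<mu> I (floor_star t I)) / sqrt t\<bar>} \<le> \<rho>"
    (is "\<forall>\<^sub>F t in at_top. prob {\<omega>\<in>space M. \<eta> < ?D t \<omega>} \<le> \<rho>")
proof -
  obtain C where C: "0 \<le> C" and stab: "\<forall>\<epsilon>. 0 < \<epsilon> \<longrightarrow> \<epsilon> \<le> 1 \<longrightarrow> (\<exists>\<delta>>0. \<forall>\<^sub>F t in at_top. \<forall>S n lam.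
      close \<delta> S \<longrightarrow> est_minimizer Is c (t *\<^sub>R B0) S a n lam \<longrightarrow>
      (\<forall>I\<in>Is. \<bar>real (n I) - t * nustar I\<bar> \<le> \<epsilon> * t \<and>
        (0 < n I \<longrightarrow> norm ((t / real (n I)) *\<^sub>R lam I - ratio_star I) \<le> (if 0 < nustar I then \<epsilon> else C))))"
    by (rule stability)
  define G where "G = (\<Sum>I\<in>Is. norm (ratio_star I))"
  have G: "norm (ratio_star I) \<le> G" if "I \<in> Is" for I
    unfolding G_def using that by (intro member_le_sum) auto
  have G0: "0 \<le> G" by (simp add: G_def sum_nonneg)
  define v where "v = 1 + (\<Sum>i\<in>UNIV. \<bar>Sigma $ i $ i\<bar>)"
  have v0: "0 < v" unfolding v_def by (intro add_pos_nonneg sum_nonneg) auto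
  have v: "Sigma $ i $ i \<le> v" for i
    using member_le_sum[of i UNIV "\<lambda>i. \<bar>Sigma $ i $ i\<bar>"] by (simp add: v_def)
  \<comment> \<open>Sizes will be at most \<open>b * t\<close>, because \<open>\<epsilon>\<close> is
    chosen to be at most 1.\<close>
  define b where "b = 3 + (\<Sum>I\<in>Is. nustar I)"
  have b: "nustar I + 2 \<le> b - 1" if "I \<in> Is" for I
    using member_le_sum[of I Is nustar] that nustar_ge0 by (simp add: b_def)
  have b0: "0 < b" unfolding b_def using nustar_ge0 by (intro add_pos_nonneg sum_nonneg) auto
  define p where "p = card Is * CARD('k)"
  \<comment> \<open>The failure probability is shared by the covariance event and, for each of the
    \<open>p\<close> pairs of a set and a coordinate, two events on centred sums.\<close>
  define \<rho>' where "\<rho>' = \<rho> / (2 * real p + 1)"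
  define \<eta>' where "\<eta>' = \<eta> / (real p + 1)"
  have \<rho>': "0 < \<rho>'" using \<rho> by (simp add: \<rho>'_def add_nonneg_pos)
  have \<eta>': "0 < \<eta>'" using \<eta> by (simp add: \<eta>'_def add_nonneg_pos)
  \<comment> \<open>Makes the maximal inequality over at most \<open>(b + 1) * t\<close> steps give
    the bound \<open>\<rho>'\<close>.\<close>
  define Q where "Q = sqrt ((b + 1) * v / \<rho>')"
  have Q: "0 < Q" "Q\<^sup>2 = (b + 1) * v / \<rho>'" using b0 v0 \<rho>' by (auto simp: Q_def)
  define r where "r = \<eta>' / (4 * (C + G + 1))"
  have r: "0 < r" "2 * (C + G) * r \<le> \<eta>' / 2"
  proof -
    have pos: "0 < C + G + 1" using C G0 by linarith
    show "0 < r" unfolding r_def using \<eta>' pos by simp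
    have "2 * (C + G) * r \<le> 2 * (C + G + 1) * r" using \<open>0 < r\<close> by (intro mult_right_mono) auto
    also have "\<dots> = \<eta>' / 2" using pos by (simp add: r_def field_simps)
    finally show "2 * (C + G) * r \<le> \<eta>' / 2" .
  qed
  \<comment> \<open>In turn: admissible for \<open>stability\<close>; ratio errors that contribute
    at most \<open>\<eta>' / 2\<close>; windows of at most \<open>3 * \<epsilon> * t\<close> steps
    that fail with probability at most \<open>\<rho>'\<close>.\<close>
  define \<epsilon> where "\<epsilon> = min 1 (min (\<eta>' / (2 * Q)) (\<rho>' * r\<^sup>2 / (3 * v)))"
  have \<epsilon>1: "\<epsilon> \<le> 1" "\<epsilon> \<le> \<eta>' / (2 * Q)" "\<epsilon> \<le> \<rho>' * r\<^sup>2 / (3 * v)"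
    unfolding \<epsilon>_def by linarith+
  have \<epsilon>: "0 < \<epsilon>" using \<eta>' Q r \<rho>' v0 by (simp add: \<epsilon>_def)
  have \<epsilon>Q: "\<epsilon> * Q \<le> \<eta>' / 2" using \<epsilon>1(2) Q(1) by (simp add: field_simps)
  have \<epsilon>r: "3 * \<epsilon> * v / r\<^sup>2 \<le> \<rho>'" using \<epsilon>1(3) v0 r(1) by (simp add: field_simps)
  obtain \<delta>1 where \<delta>1: "0 < \<delta>1" "\<forall>\<^sub>F t in at_top. \<forall>S n lam.
      close \<delta>1 S \<longrightarrow> est_minimizer Is c (t *\<^sub>R B0) S a n lam \<longrightarrow>
      (\<forall>I\<in>Is. \<bar>real (n I) - t * nustar I\<bar> \<le> \<epsilon> * t \<and>
        (0 < n I \<longrightarrow> norm ((t / real (n I)) *\<^sub>R lam I - ratio_star I) \<le> (if 0 < nustar I then \<epsilon> else C)))"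
    using stab \<epsilon> \<epsilon>1(1) by blast
  define \<delta> where "\<delta> = min \<delta>1 (\<kappa> / 2)"
  have \<delta>: "0 < \<delta>" "\<delta> \<le> \<delta>1" "\<delta> < \<kappa>" using \<delta>1(1) \<kappa>(1) by (auto simp: \<delta>_def)
  define T where "T t = {\<omega> \<in> space M. \<delta> < onorm (\<lambda>x. (Sh t \<omega> - Sigma) *v x)}" for t
  have T_event: "T t \<in> events" for t
    unfolding T_def using measurable_sets[OF Sh_rv borel_onorm_gt] by (simp add: vimage_def Int_def conj_commute)
  have T_prob: "\<forall>\<^sub>F t in at_top. prob (T t) < \<rho>'"
    unfolding T_def by (rule order_tendstoD(2)[OF Sh_conv[OF \<delta>(1)] \<rho>'])
  let ?dev = "\<lambda>\<omega>. dev (\<lambda>I j. Xs I j \<omega>) \<mu>"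
  define W where "W I i n0 N x = {\<omega>\<in>space M. \<exists>m\<le>N. x \<le> \<bar>?dev \<omega> I (n0 + m) $ i - ?dev \<omega> I n0 $ i\<bar>}"
    for I i n0 N x
  have W_event: "W I i n0 N x \<in> events" if "I \<in> Is" for I i n0 N x
    unfolding W_def by (rule window_event[OF that])
  have W_prob: "prob (W I i n0 N x) \<le> real N * v / x\<^sup>2" if I: "I \<in> Is" and x: "0 < x" for I i n0 N x
  proof -
    have "prob (W I i n0 N x) \<le> real N * Sigma $ i $ i / x\<^sup>2" unfolding W_def by (rule window_prob[OF I x])
    also have "\<dots> \<le> real N * v / x\<^sup>2" using v by (intro divide_right_mono mult_left_mono) auto
    finally show ?thesis .
  qed
  define N1 where "N1 t = nat \<lceil>b * t\<rceil>" for t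
  define N2 where "N2 t = nat \<lceil>2 * \<epsilon> * t\<rceil> + 2" for t
  define n0 where "n0 t I = nat \<lfloor>t * nustar I - \<epsilon> * t\<rfloor>" for t I
  \<comment> \<open>The first event concerns every size that can occur, the second only the window
    around the rounded optimum, where a finer bound holds.\<close>
  define E where "E t I i = W I i 0 (N1 t) (Q * sqrt t) \<union> W I i (n0 t I) (N2 t) (r * sqrt t)" for t I i
  have E_event: "E t I i \<in> events" if "I \<in> Is" for t I i
    unfolding E_def using W_event[OF that] by auto
  have E_prob: "prob (E t I i) \<le> 2 * \<rho>'" if I: "I \<in> Is" and t: "1 \<le> t" "3 \<le> \<epsilon> * t" for t I i
  proof -
    have st: "0 < sqrt t" "(sqrt t)\<^sup>2 = t" using t by auto
    have bt: "0 \<le> b * t" "0 \<le> 2 * \<epsilon> * t" using b0 t \<epsilon> by auto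
    have "prob (W I i 0 (N1 t) (Q * sqrt t)) \<le> real (N1 t) * v / (Q * sqrt t)\<^sup>2"
      using W_prob[OF I] Q(1) st by simp
    also have "\<dots> \<le> ((b + 1) * t) * v / (Q * sqrt t)\<^sup>2"
    proof (intro divide_right_mono mult_right_mono)
      have "real (N1 t) \<le> b * t + 1" unfolding N1_def using bt(1) by linarith
      then show "real (N1 t) \<le> (b + 1) * t" using t by (simp add: distrib_right)
    qed (use v0 in auto)
    also have "\<dots> = \<rho>'"
    proof -
      have "(b + 1) * v / \<rho>' * t \<noteq> 0" using b0 v0 \<rho>' t by simp
      moreover have "(b + 1) * t * v = \<rho>' * ((b + 1) * v / \<rho>' * t)" using \<rho>' by simp
      ultimately show ?thesis
        unfolding power_mult_distrib st(2) Q(2) by (simp only: nonzero_mult_div_cancel_right not_False_eq_True)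
    qed
    finally have 1: "prob (W I i 0 (N1 t) (Q * sqrt t)) \<le> \<rho>'" .
    have "prob (W I i (n0 t I) (N2 t) (r * sqrt t)) \<le> real (N2 t) * v / (r * sqrt t)\<^sup>2"
      using W_prob[OF I] r(1) st by simp
    also have "\<dots> \<le> (3 * \<epsilon> * t) * v / (r * sqrt t)\<^sup>2"
    proof (intro divide_right_mono mult_right_mono)
      \<comment> \<open>Rounding contributes at most 3, which \<open>\<epsilon> * t\<close> absorbs
        once \<open>t\<close> is at least \<open>3 / \<epsilon>\<close>.\<close>
      have "real (N2 t) \<le> 2 * \<epsilon> * t + 3" unfolding N2_def using bt(2) by linarith
      then show "real (N2 t) \<le> 3 * \<epsilon> * t" using t by linarith
    qed (use v0 in auto)
    also have "\<dots> = 3 * \<epsilon> * v / r\<^sup>2" unfolding power_mult_distrib st(2) using t by simp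
    also have "\<dots> \<le> \<rho>'" by (rule \<epsilon>r)
    finally have 2: "prob (W I i (n0 t I) (N2 t) (r * sqrt t)) \<le> \<rho>'" .
    show ?thesis
      unfolding E_def using measure_Un_le[OF W_event[OF I] W_event[OF I], of i 0 "N1 t" "Q * sqrt t" i "n0 t I" "N2 t" "r * sqrt t"] 1 2
      by linarith
  qed
  \<comment> \<open>Since \<open>nh\<close> and \<open>lh\<close> are not assumed measurable, the
    deviation is bounded through this event, a finite union of measurable ones.\<close>
  define Bad where "Bad t = T t \<union> (\<Union>q\<in>Is \<times> UNIV. E t (fst q) (snd q))" for t
  have Bad_event: "Bad t \<in> events" for t
    unfolding Bad_def using T_event E_event by (intro sets.Un sets.finite_UN) auto
  show ?thesis
    using T_prob \<delta>1(2) est_minimizer_exists[OF \<delta>(3)] floor_star_feas eventually_ge_at_top[of 1] eventually_ge_at_top[of "3 / \<epsilon>"]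
  proof eventually_elim
    case (elim t)
    have t: "1 \<le> t" "3 \<le> \<epsilon> * t" "0 < t" using elim(5,6) \<epsilon> by (auto simp: field_simps)
    have st: "0 < sqrt t" using t by simp
    have good: "?D t \<omega> \<le> \<eta>" if \<omega>: "\<omega> \<in> space M" "\<omega> \<notin> Bad t" for \<omega>
    proof -
      have "onorm (\<lambda>x. (Sh t \<omega> - Sigma) *v x) \<le> \<delta>" using \<omega> by (auto simp: Bad_def T_def)
      then have cl: "close \<delta> (Sh t \<omega>)" "close \<delta>1 (Sh t \<omega>)" using Sh_sym \<delta>(2) by auto
      have min: "est_minimizer Is c (t *\<^sub>R B0) (Sh t \<omega>) a (nh t \<omega>) (lh t \<omega>)"
        by (rule hat_min) (use elim(3) cl(1) in blast)
      have nh: "\<bar>real (nh t \<omega> I) - t * nustar I\<bar> \<le> \<epsilon> * t" if "I \<in> Is" for I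
        using elim(2) cl(2) min that by blast
      have lh: "norm ((t / real (nh t \<omega> I)) *\<^sub>R lh t \<omega> I - ratio_star I) \<le> (if 0 < nustar I then \<epsilon> else C)"
        if "I \<in> Is" "0 < nh t \<omega> I" for I
        using elim(2) cl(2) min that by blast
      have feas: "weights_for Is a (\<lambda>I. real (nh t \<omega> I)) (lh t \<omega>)"
        using min by (simp add: est_minimizer_def weights_feasible_weights_for)
      have "?D t \<omega> \<le> real p * (\<epsilon> * Q + 2 * (C + G) * r)"
        unfolding p_def
      proof (rule estimator_error[OF t(3) feas _ C _ _ G lh])
        fix I i assume I: "I \<in> Is"
        have nE: "\<omega> \<notin> E t I i" using \<omega>(2) I by (force simp: Bad_def)
        have "real (nh t \<omega> I) \<le> (nustar I + 2) * t"
        proof -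
          have "\<epsilon> * t \<le> 1 * t" using \<epsilon>1(1) t by (intro mult_right_mono) auto
          then have "real (nh t \<omega> I) \<le> t * nustar I + 2 * t"
            using nh[OF I] t unfolding abs_le_iff by linarith
          then show ?thesis by (simp add: algebra_simps)
        qed
        also have "\<dots> \<le> b * t" using b[OF I] t by (intro mult_right_mono) auto
        finally have "nh t \<omega> I \<le> N1 t" unfolding N1_def by linarith
        then have "\<bar>?dev \<omega> I (nh t \<omega> I) $ i\<bar> < Q * sqrt t"
          using nE \<omega>(1) by (force simp: E_def W_def)
        then show "\<bar>?dev \<omega> I (nh t \<omega> I) $ i\<bar> \<le> Q * sqrt t" by simp
        show "\<bar>?dev \<omega> I (nh t \<omega> I) $ i - ?dev \<omega> I (floor_star t I) $ i\<bar> \<le> 2 * (r * sqrt t)"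
        proof (rule dev_window[OF t(3) nustar_ge0 _ nh[OF I] floor_star_def n0_def N2_def, where f="\<lambda>n. ?dev \<omega> I n $ i"])
          fix m assume "m \<le> N2 t"
          then show "\<bar>?dev \<omega> I (n0 t I + m) $ i - ?dev \<omega> I (n0 t I) $ i\<bar> < r * sqrt t"
            using nE \<omega>(1) by (force simp: E_def W_def)
        qed (use \<epsilon> in simp)
      qed (use \<epsilon> Q r in auto)
      also have "\<dots> \<le> real p * \<eta>'" using \<epsilon>Q r(2) by (intro mult_left_mono) auto
      also have "\<dots> \<le> (real p + 1) * \<eta>'" using \<eta>' by (intro mult_right_mono) auto
      also have "\<dots> = \<eta>" by (simp add: \<eta>'_def add_nonneg_pos)
      finally show ?thesis .
    qed
    have "prob {\<omega>\<in>space M. \<eta> < ?D t \<omega>} \<le> prob (Bad t)"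
    proof (rule finite_measure_mono[OF subsetI Bad_event], rule ccontr)
      fix \<omega> assume \<omega>: "\<omega> \<in> {\<omega>\<in>space M. \<eta> < ?D t \<omega>}" "\<omega> \<notin> Bad t"
      from \<omega>(1) have \<omega>1: "\<omega> \<in> space M" and "\<eta> < ?D t \<omega>" by blast+
      with good[OF \<omega>1 \<omega>(2)] show False by linarith
    qed
    also have "\<dots> \<le> prob (T t) + prob (\<Union>q\<in>Is \<times> UNIV. E t (fst q) (snd q))"
      unfolding Bad_def using T_event E_event by (intro measure_Un_le sets.finite_UN) auto
    also have "prob (\<Union>q\<in>Is \<times> (UNIV::'k set). E t (fst q) (snd q)) \<le> (\<Sum>q\<in>Is \<times> (UNIV::'k set). prob (E t (fst q) (snd q)))"
      using E_event by (intro measure_UNION_le) auto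
    also have "\<dots> \<le> (\<Sum>q\<in>Is \<times> (UNIV::'k set). 2 * \<rho>')"
      using E_prob t by (intro sum_mono) auto
    also have "\<dots> = real p * (2 * \<rho>')" by (simp add: p_def card_cartesian_product)
    finally have "prob {\<omega>\<in>space M. \<eta> < ?D t \<omega>} \<le> \<rho>' + real p * (2 * \<rho>')"
      using elim(1) by linarith
    also have "\<dots> = (2 * real p + 1) * \<rho>'" by (simp add: algebra_simps)
    also have "\<dots> = \<rho>" by (simp add: \<rho>'_def add_nonneg_pos)
    finally show ?case .
  qed
qed

text \<open>A difference that tends to zero in probability does not change the limit of the
  characteristic functions, and Levy's continuity theorem then applies along every sequence of
  values of \<open>t\<close>.\<close>

lemma weak_limit:
  assumes rv: "\<And>t. Y t \<in> borel_measurable M"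
    and close: "\<And>\<eta> \<rho>. 0 < \<eta> \<Longrightarrow> 0 < \<rho> \<Longrightarrow> \<forall>\<^sub>F t in at_top. prob {\<omega>\<in>space M. \<eta> <
      \<bar>Y t \<omega> - (\<Sum>I\<in>Is. ratio_star I \<bullet> dev (\<lambda>I j. Xs I j \<omega>) \<mu> I (floor_star t I)) / sqrt t\<bar>} \<le> \<rho>"
  shows "conv_distr_at_top M Y (normal_measure Vstar)"
  unfolding conv_distr_at_top_def
proof (intro allI impI)
  fix s :: "nat \<Rightarrow> real" assume s: "filterlim s at_top sequentially"
  let ?W = "\<lambda>t \<omega>. (\<Sum>I\<in>Is. ratio_star I \<bullet> dev (\<lambda>I j. Xs I j \<omega>) \<mu> I (floor_star t I)) / sqrt t"
  have W_rv: "?W t \<in> borel_measurable M" for t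
    unfolding inner_vec_def using dev_measurable by measurable
  show "weak_conv_m (\<lambda>k. distr M borel (Y (s k))) (normal_measure Vstar)"
  proof (rule levy_continuity)
    show "real_distribution (distr M borel (Y (s k)))" for k
      by (rule real_distribution_distr[OF rv])
    show "real_distribution (normal_measure Vstar)" by (rule normal_measure_char(1)[OF Vstar_pos])
    fix u :: real
    have "(\<lambda>k. char (distr M borel (Y (s k))) u - char (distr M borel (?W (s k))) u) \<longlonglongrightarrow> 0"
    proof (rule tendstoI)
      fix e :: real assume e: "0 < e"
      \<comment> \<open>The first term of \<open>char_diff_le\<close> is then at most
        \<open>e / 4\<close>; a probability of at most \<open>e / 4\<close> adds at most
        \<open>e / 2\<close>, and the total stays below \<open>e\<close>.\<close>
      define \<eta> where "\<eta> = e / (4 * (\<bar>u\<bar> + 1))"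
      have \<eta>: "0 < \<eta>" using e by (simp add: \<eta>_def)
      have "\<bar>u\<bar> * \<eta> \<le> (\<bar>u\<bar> + 1) * \<eta>" using \<eta> by (intro mult_right_mono) auto
      also have "\<dots> = e / 4" by (simp add: \<eta>_def field_simps)
      finally have u\<eta>: "\<bar>u\<bar> * \<eta> \<le> e / 4" .
      have "\<forall>\<^sub>F t in at_top. prob {\<omega>\<in>space M. \<eta> < \<bar>Y t \<omega> - ?W t \<omega>\<bar>} \<le> e / 4"
        by (rule close[OF \<eta>]) (use e in simp)
      then have "\<forall>\<^sub>F k in sequentially. prob {\<omega>\<in>space M. \<eta> < \<bar>Y (s k) \<omega> - ?W (s k) \<omega>\<bar>} \<le> e / 4"
        using s by (rule eventually_compose_filterlim)
      then show "\<forall>\<^sub>F k in sequentially. dist (char (distr M borel (Y (s k))) u - char (distr M borel (?W (s k))) u) 0 < e"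
      proof eventually_elim
        case (elim k)
        have "cmod (char (distr M borel (Y (s k))) u - char (distr M borel (?W (s k))) u)
          \<le> \<bar>u\<bar> * \<eta> + 2 * prob {\<omega>\<in>space M. \<eta> < \<bar>Y (s k) \<omega> - ?W (s k) \<omega>\<bar>}"
          by (rule char_diff_le[OF rv W_rv]) (use \<eta> in simp)
        also have "\<dots> < e" using u\<eta> elim e by linarith
        finally show ?case by (simp add: dist_norm)
      qed
    qed
    from tendsto_add[OF this normal_limit[OF s, of u]]
    show "(\<lambda>k. char (distr M borel (Y (s k))) u) \<longlonglongrightarrow> char (normal_measure Vstar) u"
      by (simp add: normal_measure_char(2)[OF Vstar_pos])
  qed
qed

end

theorem theorem2:
  fixes M :: "'a measure"
    and X :: "'a \<Rightarrow> real^'k"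
    and Xs :: "'k set \<Rightarrow> nat \<Rightarrow> 'a \<Rightarrow> real^'k"
    and a :: "real^'k"
    and Is :: "'k set set"
    and c :: "'k set \<Rightarrow> real^'m"
    and B0 :: "real^'m"
    and Sigma :: "real^'k^'k"
    and Sh :: "real \<Rightarrow> 'a \<Rightarrow> real^'k^'k"
    and nh :: "real \<Rightarrow> 'a \<Rightarrow> 'k set \<Rightarrow> nat"
    and lh :: "real \<Rightarrow> 'a \<Rightarrow> 'k set \<Rightarrow> real^'k"
    and nustar :: "'k set \<Rightarrow> real"
    and Vstar :: real
  assumes P: "prob_space M"
    and a_nz: "a \<noteq> 0"
    and Is_ne: "\<forall>I\<in>Is. I \<noteq> {}"
    and c_nonneg: "\<forall>I\<in>Is. \<forall>i. 0 \<le> c I $ i"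
    and B0_pos: "\<forall>i. 0 < B0 $ i"
    and X_rv: "X \<in> borel_measurable M"
    and X_mom2: "\<forall>i. integrable M (\<lambda>\<omega>. (X \<omega> $ i)\<^sup>2)"
    and Sigma_def: "\<forall>i j. Sigma $ i $ j = prob_space.expectation M
        (\<lambda>\<omega>. (X \<omega> $ i - prob_space.expectation M (\<lambda>\<eta>. X \<eta> $ i)) *
              (X \<omega> $ j - prob_space.expectation M (\<lambda>\<eta>. X \<eta> $ j)))"
    and Sigma_pd: "\<forall>v. v \<noteq> 0 \<longrightarrow> 0 < v \<bullet> (Sigma *v v)"
    and nustar_min: "cont_minimizer Is c B0 Sigma a nustar"
    and nustar_unique: "\<forall>\<nu>. cont_minimizer Is c B0 Sigma a \<nu> \<longrightarrow> \<nu> = nustar"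
    and Vstar_def: "Vstar = var_obj Is Sigma a nustar"
    and Xs_rv: "\<forall>I\<in>Is. \<forall>j\<ge>1. Xs I j \<in> borel_measurable M"
    and Xs_indep: "prob_space.indep_vars M (\<lambda>_. borel) (\<lambda>(I, j). Xs I j) (Is \<times> {1..})"
    and Xs_distr: "\<forall>I\<in>Is. \<forall>j\<ge>1. distr M borel (Xs I j) = distr M borel X"
    and Sh_rv: "\<forall>t. Sh t \<in> borel_measurable M"
    and Sh_sym: "\<forall>t \<omega>. transpose (Sh t \<omega>) = Sh t \<omega>"
    and Sh_conv: "\<forall>\<epsilon>>0. ((\<lambda>t. prob_space.prob M
        {\<omega> \<in> space M. \<epsilon> < onorm (\<lambda>x. (Sh t \<omega> - Sigma) *v x)}) \<longlongrightarrow> 0) at_top"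
    and hat_min: "\<forall>t \<omega>. (\<exists>n lam. est_minimizer Is c (t *\<^sub>R B0) (Sh t \<omega>) a n lam) \<longrightarrow>
        est_minimizer Is c (t *\<^sub>R B0) (Sh t \<omega>) a (nh t \<omega>) (lh t \<omega>)"
    and theta_rv: "\<forall>t. (\<lambda>\<omega>. \<Sum>I\<in>{I\<in>Is. 0 < nh t \<omega> I}.
        (1 / real (nh t \<omega> I)) * (\<Sum>j=1..nh t \<omega> I. lh t \<omega> I \<bullet> Xs I j \<omega>)) \<in> borel_measurable M"
  shows "conv_distr_at_top M
           (\<lambda>t \<omega>. sqrt t * ((\<Sum>I\<in>{I\<in>Is. 0 < nh t \<omega> I}.
               (1 / real (nh t \<omega> I)) * (\<Sum>j=1..nh t \<omega> I. lh t \<omega> I \<bullet> Xs I j \<omega>))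
             - a \<bullet> (\<chi> i. prob_space.expectation M (\<lambda>\<omega>. X \<omega> $ i))))
           (normal_measure Vstar)
       \<and> ((\<lambda>t. t * V_budget Is c Sigma a (t *\<^sub>R B0)) \<longlongrightarrow> Vstar) at_top"
proof -
  let ?mu = "\<chi> i. prob_space.expectation M (\<lambda>\<omega>. X \<omega> $ i)"
  interpret sampled_design M Is c B0 a Sigma nustar Vstar X Xs ?mu
  proof (intro sampled_design.intro sampled_design_axioms.intro)
    show "prob_space M" by (rule P)
    show "design Is c B0 a Sigma nustar Vstar"
    proof
      show "transpose Sigma = Sigma"
        using Sigma_def by (simp add: transpose_def vec_eq_iff mult.commute)
      show "pos_def_on UNIV Sigma" using Sigma_pd by (simp add: pos_def_on_def)
      show "a \<noteq> 0" by (rule a_nz)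
      show "0 \<le> c I $ i" if "I \<in> Is" for I i using c_nonneg that by blast
      show "0 < B0 $ i" for i using B0_pos by blast
      show "cont_minimizer Is c B0 Sigma a nustar" by (rule nustar_min)
      show "\<nu> = nustar" if "cont_minimizer Is c B0 Sigma a \<nu>" for \<nu>
        using nustar_unique that by blast
      show "Vstar = var_obj Is Sigma a nustar" by (rule Vstar_def)
    qed
    show "X \<in> borel_measurable M" by (rule X_rv)
    show "integrable M (\<lambda>\<omega>. (X \<omega> $ i)\<^sup>2)" for i using X_mom2 by blast
    show "prob_space.expectation M (\<lambda>\<omega>. X \<omega> $ i) = ?mu $ i" for i by simp
    show "Sigma $ i $ j = prob_space.expectation M (\<lambda>\<omega>. (X \<omega> $ i - ?mu $ i) * (X \<omega> $ j - ?mu $ j))" for i j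
      using Sigma_def by simp
    show "Xs I j \<in> borel_measurable M" if "I \<in> Is" "1 \<le> j" for I j using Xs_rv that by blast
    show "prob_space.indep_vars M (\<lambda>_. borel) (\<lambda>(I, j). Xs I j) (Is \<times> {1..})" by (rule Xs_indep)
    show "distr M borel (Xs I j) = distr M borel X" if "I \<in> Is" "1 \<le> j" for I j
      using Xs_distr that by blast
  qed
  show ?thesis
  proof
    show "conv_distr_at_top M
           (\<lambda>t \<omega>. sqrt t * ((\<Sum>I\<in>{I\<in>Is. 0 < nh t \<omega> I}.
               (1 / real (nh t \<omega> I)) * (\<Sum>j=1..nh t \<omega> I. lh t \<omega> I \<bullet> Xs I j \<omega>))
             - a \<bullet> ?mu)) (normal_measure Vstar)"
    proof (rule weak_limit)
      show "(\<lambda>\<omega>. sqrt t * ((\<Sum>I\<in>{I\<in>Is. 0 < nh t \<omega> I}.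
               (1 / real (nh t \<omega> I)) * (\<Sum>j=1..nh t \<omega> I. lh t \<omega> I \<bullet> Xs I j \<omega>))
             - a \<bullet> ?mu)) \<in> borel_measurable M" for t
        using theta_rv by (intro borel_measurable_times borel_measurable_diff borel_measurable_const) auto
    qed (rule estimator_close; use Sh_rv Sh_sym Sh_conv hat_min in blast)
    show "((\<lambda>t. t * V_budget Is c Sigma a (t *\<^sub>R B0)) \<longlongrightarrow> Vstar) at_top"
      by (rule V_budget_tendsto)
  qed
qed

end
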